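(* Let $\mathcal{C}$ be the Cesàro operator in $L^2(\mathbb{R})$. 1) Let $F$ be a holomorphic function in a neighborhood of the spectrum $\mathbb{T}+1$ of $\mathcal{C}$ with $F(0)=0$. Then $F(\mathcal{C})=\mathcal{H}_K$ for a unique (up to a.e. equality) function $K$, and the following conditions hold: (a) $K(u)=0$ for a.e. $u<0$; (b) $K(u)u^{-\frac12}\in L^1(\mathbb{R}_+)$; (c) $(\mathcal{M}K)(z)=F(z^{-1})$ for all $z\in\mathbb{C}$ with $\mathrm{Re}(z)=\frac12$. 2) If a function $K$ satisfies conditions (a), (b), and (c), where $F$ is a function holomorphic in some neighborhood of $\mathbb{T}+1$, then $F(0)=0$ and $\mathcal{H}_K=F(\mathcal{C})$.
   Context: $\mathbb{T}$ is the unit circle in $\mathbb{C}$ and $\mathbb{T}+1=\{z\in\mathbb{C}:|z-1|=1\}$; $\mathbb{R}_+=(0,\infty)$. The Cesàro operator $\mathcal{C}$ in $L^2(\mathbb{R})$ is $(\mathcal{C}f)(x)=\frac1x\int_0^x f(t)\,dt=\int_0^1 f(ux)\,du$; it is a bounded normal operator with spectrum $\mathbb{T}+1$. For $F$ holomorphic in a neighborhood of $\mathbb{T}+1$, $F(\mathcal{C})$ is defined by the holomorphic (Riesz–Dunford) functional calculus. For a measurable function $K$ on $\mathbb{R}$ with $K(u)|u|^{-1/2}\in L^1(\mathbb{R})$, $\mathcal{H}_K$ is the bounded (Hausdorff) operator in $L^2(\mathbb{R})$ given by $(\mathcal{H}_Kf)(x)=\int_{\mathbb{R}}K(u)f(ux)\,du$.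 The Mellin transform is $(\mathcal{M}K)(z)=\int_{(0,+\infty)}K(u)u^{z-1}\,du$. *)

theory Defs
  imports "HOL-Complex_Analysis.Complex_Analysis"
begin

section \<open>The complex Hilbert space \<open>L\<^sup>2(\<real>)\<close>\<close>

text \<open>
  Elements are represented by Borel functions.  Every Lebesgue measurable function is almost everywhere
  equal to a Borel one, so this yields the usual space; kernels below may be Lebesgue measurable.
\<close>

definition sq_integrable :: "(real \<Rightarrow> complex) \<Rightarrow> bool" where
  "sq_integrable f \<longleftrightarrow>
     f \<in> borel_measurable lborel \<and> integrable lborel (\<lambda>x. (norm (f x))\<^sup>2)"

definition L2_eq :: "(real \<Rightarrow> complex) \<Rightarrow> (real \<Rightarrow> complex) \<Rightarrow> bool" where
  "L2_eq f g \<longleftrightarrow> sq_integrable f \<and> sq_integrable g \<and> (AE x in lborel. f x = g x)"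

lemma sq_integrable_measurable [measurable_dest]:
  "sq_integrable f \<Longrightarrow> f \<in> borel_measurable borel"
  by (simp add: sq_integrable_def)

lemma sq_integrable_0: "sq_integrable (\<lambda>x. 0)"
  by (simp add: sq_integrable_def)

lemma sq_integrable_mult: "sq_integrable f \<Longrightarrow> sq_integrable (\<lambda>x. c * f x)"
  by (auto simp: sq_integrable_def norm_mult power_mult_distrib)

lemma sq_integrable_add:
  assumes "sq_integrable f" "sq_integrable g"
  shows "sq_integrable (\<lambda>x. f x + g x)"
proof -
  have "integrable lborel (\<lambda>x. 2 * ((norm (f x))\<^sup>2 + (norm (g x))\<^sup>2))"
    using assms by (auto simp: sq_integrable_def)
  then have "integrable lborel (\<lambda>x. (norm (f x + g x))\<^sup>2)"
  proof (rule Bochner_Integration.integrable_bound)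
    show "(\<lambda>x. (norm (f x + g x))\<^sup>2) \<in> borel_measurable lborel"
      using assms by (auto simp: sq_integrable_def)
    have "(norm (f x + g x))\<^sup>2 \<le> 2 * ((norm (f x))\<^sup>2 + (norm (g x))\<^sup>2)" for x
    proof -
      have "(norm (f x + g x))\<^sup>2 \<le> (norm (f x) + norm (g x))\<^sup>2"
        by (intro power_mono norm_triangle_ineq) auto
      also have "\<dots> \<le> 2 * ((norm (f x))\<^sup>2 + (norm (g x))\<^sup>2)"
        using sum_squares_bound[of "norm (f x)" "norm (g x)"]
        by (simp add: power2_sum)
      finally show ?thesis .
    qed
    then show "AE x in lborel. norm ((norm (f x + g x))\<^sup>2)
        \<le> norm (2 * ((norm (f x))\<^sup>2 + (norm (g x))\<^sup>2))"
      by (intro AE_I2) (smt (verit, best) real_norm_def zero_le_power2)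
  qed
  then show ?thesis
    using assms by (auto simp: sq_integrable_def)
qed

lemma sq_integrable_uminus: "sq_integrable f \<Longrightarrow> sq_integrable (\<lambda>x. - f x)"
  using sq_integrable_mult[of f "-1"] by simp

lemma sq_integrable_diff:
  "sq_integrable f \<Longrightarrow> sq_integrable g \<Longrightarrow> sq_integrable (\<lambda>x. f x - g x)"
  using sq_integrable_add[of f "\<lambda>x. - g x"] sq_integrable_uminus[of g] by simp

lemma sq_integrable_inner:
  assumes "sq_integrable f" "sq_integrable g"
  shows "integrable lborel (\<lambda>x. inner (f x) (g x))"
proof (rule Bochner_Integration.integrable_bound)
  show "integrable lborel (\<lambda>x. (norm (f x))\<^sup>2 + (norm (g x))\<^sup>2)"
    using assms by (auto simp: sq_integrable_def)
  show "(\<lambda>x. inner (f x) (g x)) \<in> borel_measurable lborel"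
    using assms by (auto simp: sq_integrable_def)
  have "\<bar>inner (f x) (g x)\<bar> \<le> (norm (f x))\<^sup>2 + (norm (g x))\<^sup>2" for x
  proof -
    have "\<bar>inner (f x) (g x)\<bar> \<le> norm (f x) * norm (g x)"
      by (rule Cauchy_Schwarz_ineq2)
    also have "\<dots> \<le> (norm (f x))\<^sup>2 + (norm (g x))\<^sup>2"
      using sum_squares_bound[of "norm (f x)" "norm (g x)"]
        mult_nonneg_nonneg[OF norm_ge_zero norm_ge_zero, of "f x" "g x"]
      unfolding mult.assoc by linarith
    finally show ?thesis .
  qed
  then show "AE x in lborel. norm (inner (f x) (g x))
      \<le> norm ((norm (f x))\<^sup>2 + (norm (g x))\<^sup>2)"
    by (intro AE_I2) (simp add: abs_of_nonneg)
qed

lemma L2_eq_part_equivp: "part_equivp L2_eq"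
proof (rule part_equivpI)
  show "\<exists>f. L2_eq f f"
    using sq_integrable_0 by (auto simp: L2_eq_def)
  show "symp L2_eq"
    by (auto simp: symp_def L2_eq_def elim: AE_mp)
  show "transp L2_eq"
    unfolding transp_def L2_eq_def by (auto elim: AE_mp)
qed

quotient_type L2 = "real \<Rightarrow> complex" / partial: L2_eq
  by (rule L2_eq_part_equivp)

instantiation L2 :: real_inner
begin

lift_definition zero_L2 :: L2 is "\<lambda>x. 0"
  by (simp add: L2_eq_def sq_integrable_0)

lift_definition plus_L2 :: "L2 \<Rightarrow> L2 \<Rightarrow> L2" is "\<lambda>f g x. f x + g x"
  unfolding L2_eq_def by (auto intro: sq_integrable_add)

lift_definition uminus_L2 :: "L2 \<Rightarrow> L2" is "\<lambda>f x. - f x"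
  unfolding L2_eq_def by (auto intro: sq_integrable_uminus)

lift_definition minus_L2 :: "L2 \<Rightarrow> L2 \<Rightarrow> L2" is "\<lambda>f g x. f x - g x"
  unfolding L2_eq_def by (auto intro: sq_integrable_diff)

lift_definition scaleR_L2 :: "real \<Rightarrow> L2 \<Rightarrow> L2" is "\<lambda>r f x. of_real r * f x"
  unfolding L2_eq_def by (auto intro: sq_integrable_mult)

lift_definition inner_L2 :: "L2 \<Rightarrow> L2 \<Rightarrow> real" is "\<lambda>f g. LINT x|lborel. inner (f x) (g x)"
proof -
  fix f f' g g' :: "real \<Rightarrow> complex"
  assume "L2_eq f f'" "L2_eq g g'"
  then show "(LINT x|lborel. inner (f x) (g x)) = (LINT x|lborel. inner (f' x) (g' x))"
    unfolding L2_eq_def sq_integrable_def by (intro integral_cong_AE) auto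
qed

definition norm_L2 :: "L2 \<Rightarrow> real" where "norm_L2 f = sqrt (inner f f)"

definition sgn_L2 :: "L2 \<Rightarrow> L2" where "sgn_L2 f = inverse (norm f) *\<^sub>R f"

definition dist_L2 :: "L2 \<Rightarrow> L2 \<Rightarrow> real" where "dist_L2 f g = norm (f - g)"

definition uniformity_L2 :: "(L2 \<times> L2) filter" where
  "uniformity_L2 = (INF e\<in>{0 <..}. principal {(x, y). dist x y < e})"

definition open_L2 :: "L2 set \<Rightarrow> bool" where
  "open_L2 S = (\<forall>x\<in>S. \<forall>\<^sub>F (x', y) in uniformity. x' = x \<longrightarrow> y \<in> S)"

instance
proof
  fix f g h :: L2 and a b :: real
  show "f + g + h = f + (g + h)"
    by transfer (auto simp: L2_eq_def add.assoc intro!: sq_integrable_add)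
  show "f + g = g + f"
    by transfer (auto simp: L2_eq_def add.commute intro!: sq_integrable_add)
  show "0 + f = f"
    by transfer (auto simp: L2_eq_def)
  show "- f + f = 0"
    by transfer (auto simp: L2_eq_def sq_integrable_0)
  show "f - g = f + - g"
    by transfer (auto simp: L2_eq_def intro!: sq_integrable_diff)
  show "a *\<^sub>R (f + g) = a *\<^sub>R f + a *\<^sub>R g"
    by transfer (auto simp: L2_eq_def distrib_left intro!: sq_integrable_add sq_integrable_mult)
  show "(a + b) *\<^sub>R f = a *\<^sub>R f + b *\<^sub>R f"
    by transfer (auto simp: L2_eq_def distrib_right intro!: sq_integrable_add sq_integrable_mult)
  show "a *\<^sub>R b *\<^sub>R f = (a * b) *\<^sub>R f"
    by transfer (auto simp: L2_eq_def mult.assoc intro!: sq_integrable_mult)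
  show "1 *\<^sub>R f = f"
    by transfer (auto simp: L2_eq_def)
  show "sgn f = inverse (norm f) *\<^sub>R f"
    by (rule sgn_L2_def)
  show "dist f g = norm (f - g)"
    by (rule dist_L2_def)
  show "(uniformity :: (L2 \<times> L2) filter) = (INF e\<in>{0 <..}. principal {(x, y). dist x y < e})"
    by (rule uniformity_L2_def)
  show "inner f g = inner g f"
    by transfer (simp add: inner_commute)
  show "inner (f + g) h = inner f h + inner g h"
    by transfer (auto simp: L2_eq_def inner_add_left sq_integrable_inner)
  show "inner (a *\<^sub>R f) g = a * inner f g"
  proof transfer
    fix a :: real and f g :: "real \<Rightarrow> complex"
    have "inner (of_real a * f x) (g x) = a * inner (f x) (g x)" for x
      by (metis inner_scaleR_left scaleR_conv_of_real)
    then show "(LINT x|lborel. inner (of_real a * f x) (g x)) =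
        a * (LINT x|lborel. inner (f x) (g x))"
      by simp
  qed
  show "0 \<le> inner f f"
    by transfer simp
  show "inner f f = 0 \<longleftrightarrow> f = 0"
  proof transfer
    fix f :: "real \<Rightarrow> complex"
    assume "L2_eq f f"
    then have f: "sq_integrable f" by (simp add: L2_eq_def)
    have "(LINT x|lborel. inner (f x) (f x)) = 0 \<longleftrightarrow> (AE x in lborel. inner (f x) (f x) = 0)"
      using sq_integrable_inner[OF f f] by (intro integral_nonneg_eq_0_iff_AE) auto
    then show "(LINT x|lborel. inner (f x) (f x)) = 0 \<longleftrightarrow> L2_eq f (\<lambda>x. 0)"
      using f by (simp add: L2_eq_def sq_integrable_0)
  qed
  show "norm f = sqrt (inner f f)"
    by (rule norm_L2_def)
next
  fix S :: "L2 set"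
  show "open S = (\<forall>x\<in>S. \<forall>\<^sub>F (x', y) in uniformity. x' = x \<longrightarrow> y \<in> S)"
    by (rule open_L2_def)
qed

end

lemma sq_integrable_rep: "sq_integrable (rep_L2 f)"
  using Quotient3_rep_reflp[OF Quotient3_L2, of f] by (simp add: L2_eq_def)

lemma abs_rep_L2 [simp]: "abs_L2 (rep_L2 f) = f"
  by (rule Quotient3_abs_rep[OF Quotient3_L2])

lemma norm_diff_L2:
  assumes "sq_integrable f" "sq_integrable g"
  shows "(\<integral>\<^sup>+x. ennreal ((norm (f x - g x))\<^sup>2) \<partial>lborel) = ennreal ((norm (abs_L2 f - abs_L2 g))\<^sup>2)"
proof -
  have d: "sq_integrable (\<lambda>x. f x - g x)"
    using assms by (rule sq_integrable_diff)
  have "abs_L2 f - abs_L2 g = abs_L2 (\<lambda>x. f x - g x)"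
    using assms by (intro minus_L2.abs_eq) (auto simp: L2_eq_def)
  then have "(norm (abs_L2 f - abs_L2 g))\<^sup>2 = inner (abs_L2 (\<lambda>x. f x - g x)) (abs_L2 (\<lambda>x. f x - g x))"
    by (simp add: power2_norm_eq_inner)
  also have "\<dots> = (LINT x|lborel. (norm (f x - g x))\<^sup>2)"
    using d by (subst inner_L2.abs_eq) (auto simp: L2_eq_def power2_norm_eq_inner)
  finally show ?thesis
    using d by (simp add: nn_integral_eq_integral sq_integrable_def)
qed

instance L2 :: banach
proof
  fix X :: "nat \<Rightarrow> L2"
  assume X: "Cauchy X"
  define f where "f n = rep_L2 (X n)" for n
  have f: "sq_integrable (f n)" for n
    by (simp add: f_def sq_integrable_rep)
  have nn: "(\<integral>\<^sup>+x. ennreal ((norm (f m x - f n x))\<^sup>2) \<partial>lborel) = ennreal ((norm (X m - X n))\<^sup>2)" for m n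
    using norm_diff_L2[OF f f, of m n] by (simp add: f_def)
  have "\<forall>k. \<exists>M. \<forall>m\<ge>M. \<forall>n\<ge>M. norm (X m - X n) < (1/4) ^ k"
    using X unfolding Cauchy_iff by simp
  then obtain N where N: "\<And>k m n. m \<ge> N k \<Longrightarrow> n \<ge> N k \<Longrightarrow> norm (X m - X n) < (1/4) ^ k"
    by metis
  define r where "r k = k + (\<Sum>i\<le>k. N i)" for k
  have rN: "N k \<le> r k" for k
    unfolding r_def by (rule order_trans[OF member_le_sum[of k "{..k}" N]]) auto
  have r_less: "r k \<le> r (Suc k)" and r_ge: "k \<le> r k" for k
    by (auto simp: r_def)
  define d where "d k x = norm (f (r (Suc k)) x - f (r k) x)" for k x
  have [measurable]: "f n \<in> borel_measurable borel" for n
    using f[of n] by (simp add: sq_integrable_def)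
  have [measurable]: "d k \<in> borel_measurable borel" for k
    unfolding d_def by measurable
  have "(\<integral>\<^sup>+x. (\<Sum>k. ennreal (2 ^ k * (d k x)\<^sup>2)) \<partial>lborel)
      = (\<Sum>k. \<integral>\<^sup>+x. ennreal (2 ^ k * (d k x)\<^sup>2) \<partial>lborel)"
    by (rule nn_integral_suminf) simp
  also have "\<dots> \<le> (\<Sum>k. ennreal ((1/8) ^ k))"
  proof (rule suminf_le)
    fix k
    have "(\<integral>\<^sup>+x. ennreal (2 ^ k * (d k x)\<^sup>2) \<partial>lborel)
        = ennreal (2 ^ k) * ennreal ((norm (X (r (Suc k)) - X (r k)))\<^sup>2)"
      unfolding nn[symmetric] d_def by (subst nn_integral_cmult[symmetric]) (auto simp: ennreal_mult)
    also have "\<dots> = ennreal (2 ^ k * (norm (X (r (Suc k)) - X (r k)))\<^sup>2)"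
      by (simp add: ennreal_mult)
    also have "\<dots> \<le> ennreal (2 ^ k * ((1/4) ^ k)\<^sup>2)"
      using less_imp_le[OF N[OF order_trans[OF rN r_less] rN]]
      by (intro ennreal_leI mult_left_mono power_mono) auto
    also have "(2::real) ^ k * ((1/4) ^ k)\<^sup>2 = (1/8) ^ k"
      by (simp add: power2_eq_square flip: power_mult_distrib)
    finally show "(\<integral>\<^sup>+x. ennreal (2 ^ k * (d k x)\<^sup>2) \<partial>lborel) \<le> ennreal ((1/8) ^ k)" .
  qed auto
  also have "\<dots> = ennreal (\<Sum>k. (1/8) ^ k)"
    by (rule suminf_ennreal_eq) (auto intro!: summable_sums summable_geometric)
  also have "\<dots> < \<infinity>"
    by simp
  finally have "(\<integral>\<^sup>+x. (\<Sum>k. ennreal (2 ^ k * (d k x)\<^sup>2)) \<partial>lborel) \<noteq> \<infinity>"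
    by simp
  then have fin: "AE x in lborel. (\<Sum>k. ennreal (2 ^ k * (d k x)\<^sup>2)) \<noteq> \<infinity>"
    by (intro nn_integral_PInf_AE) auto
  define h where "h x = lim (\<lambda>k. f (r k) x)" for x
  have lim: "AE x in lborel. (\<lambda>k. f (r k) x) \<longlonglongrightarrow> h x"
  proof (use fin in eventually_elim)
    fix x :: real
    assume "(\<Sum>k. ennreal (2 ^ k * (d k x)\<^sup>2)) \<noteq> \<infinity>"
    then have "summable (\<lambda>k. 2 ^ k * (d k x)\<^sup>2)"
      by (intro summable_suminf_not_top) auto
    then have "summable (\<lambda>k. 2 ^ k * (d k x)\<^sup>2 + (1/2) ^ k)"
      by (intro summable_add) auto
    then have "summable (\<lambda>k. d k x)"
    proof (rule summable_comparison_test'[of _ 0])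
      fix k :: nat
      have d0: "0 \<le> d k x" by (simp add: d_def)
      have "d k x \<le> 2 ^ k * (d k x)\<^sup>2 + (1/2) ^ k"
      proof (cases "d k x \<le> (1/2) ^ k")
        case True
        then show ?thesis by (simp add: add_increasing)
      next
        case False
        then have "1 \<le> 2 ^ k * d k x"
          by (simp add: field_simps power_one_over)
        then have "1 * d k x \<le> (2 ^ k * d k x) * d k x"
          using d0 by (intro mult_right_mono)
        then show ?thesis
          by (simp add: power2_eq_square mult.assoc add_increasing2)
      qed
      then show "norm (d k x) \<le> 2 ^ k * (d k x)\<^sup>2 + (1/2) ^ k"
        using d0 by simp
    qed
    then have "summable (\<lambda>k. f (r (Suc k)) x - f (r k) x)"
      unfolding d_def by (rule summable_norm_cancel)
    then have "convergent (\<lambda>n. f (r n) x - f (r 0) x)"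
      by (simp add: summable_iff_convergent sum_lessThan_telescope[of "\<lambda>i. f (r i) x"])
    then have "convergent (\<lambda>n. f (r n) x)"
      by (simp add: convergent_diff_const_right_iff)
    then show "(\<lambda>k. f (r k) x) \<longlonglongrightarrow> h x"
      by (simp add: h_def convergent_LIMSEQ_iff)
  qed
  have [measurable]: "h \<in> borel_measurable borel"
    unfolding h_def by measurable
  have bound: "(\<integral>\<^sup>+x. ennreal ((norm (h x - f m x))\<^sup>2) \<partial>lborel) \<le> ennreal (e\<^sup>2)"
    if e: "\<And>m n. m \<ge> M \<Longrightarrow> n \<ge> M \<Longrightarrow> norm (X m - X n) < e" and m: "m \<ge> M" for e M m
  proof -
    have "(\<integral>\<^sup>+x. ennreal ((norm (h x - f m x))\<^sup>2) \<partial>lborel)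
        = (\<integral>\<^sup>+x. liminf (\<lambda>k. ennreal ((norm (f (r k) x - f m x))\<^sup>2)) \<partial>lborel)"
    proof (rule nn_integral_cong_AE, use lim in eventually_elim)
      fix x
      assume "(\<lambda>k. f (r k) x) \<longlonglongrightarrow> h x"
      then have "(\<lambda>k. ennreal ((norm (f (r k) x - f m x))\<^sup>2)) \<longlonglongrightarrow> ennreal ((norm (h x - f m x))\<^sup>2)"
        by (intro tendsto_intros)
      then show "ennreal ((norm (h x - f m x))\<^sup>2) = liminf (\<lambda>k. ennreal ((norm (f (r k) x - f m x))\<^sup>2))"
        by (intro lim_imp_Liminf[symmetric]) auto
    qed
    also have "\<dots> \<le> liminf (\<lambda>k. \<integral>\<^sup>+x. ennreal ((norm (f (r k) x - f m x))\<^sup>2) \<partial>lborel)"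
      by (rule nn_integral_liminf) auto
    also have "\<dots> \<le> ennreal (e\<^sup>2)"
    proof (rule Liminf_le)
      show "\<forall>\<^sub>F k in sequentially. (\<integral>\<^sup>+x. ennreal ((norm (f (r k) x - f m x))\<^sup>2) \<partial>lborel) \<le> ennreal (e\<^sup>2)"
        unfolding nn eventually_sequentially
        by (intro exI[of _ M] allI impI ennreal_leI power_mono
              less_imp_le[OF e[OF order_trans[OF _ r_ge] m]]) auto
    qed simp
    finally show ?thesis .
  qed
  have h: "sq_integrable h"
  proof -
    obtain M where M: "\<And>m n. m \<ge> M \<Longrightarrow> n \<ge> M \<Longrightarrow> norm (X m - X n) < 1"
      using X unfolding Cauchy_iff by (meson zero_less_one)
    have "sq_integrable (\<lambda>x. h x - f M x)"
      unfolding sq_integrable_def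
    proof (intro conjI integrableI_bounded)
      have "(\<integral>\<^sup>+x. ennreal ((norm (h x - f M x))\<^sup>2) \<partial>lborel) < \<infinity>"
        using bound[OF M order_refl] by (rule le_less_trans) simp_all
      then show "(\<integral>\<^sup>+x. ennreal (norm ((norm (h x - f M x))\<^sup>2)) \<partial>lborel) < \<infinity>"
        by simp
    qed auto
    from sq_integrable_add[OF this f[of M]] show ?thesis by simp
  qed
  have "X \<longlonglongrightarrow> abs_L2 h"
  proof (rule LIMSEQ_I)
    fix e :: real
    assume e: "0 < e"
    then obtain M where M: "\<And>m n. m \<ge> M \<Longrightarrow> n \<ge> M \<Longrightarrow> norm (X m - X n) < e / 2"
      using X unfolding Cauchy_iff by (meson half_gt_zero)
    have "norm (X m - abs_L2 h) < e" if m: "m \<ge> M" for m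
    proof -
      have "ennreal ((norm (abs_L2 h - X m))\<^sup>2) \<le> ennreal ((e / 2)\<^sup>2)"
        using bound[OF M m] norm_diff_L2[OF h f[of m]] by (simp add: f_def)
      then have "norm (abs_L2 h - X m) \<le> e / 2"
        using e by (simp add: ennreal_le_iff power2_le_iff_abs_le)
      then show ?thesis
        using e by (simp add: norm_minus_commute)
    qed
    then show "\<exists>M. \<forall>m\<ge>M. norm (X m - abs_L2 h) < e" by blast
  qed
  then show "convergent X" by (auto simp: convergent_def)
qed

lift_definition scaleC_L2 :: "complex \<Rightarrow> L2 \<Rightarrow> L2" is "\<lambda>c f x. c * f x"
  unfolding L2_eq_def by (auto intro: sq_integrable_mult)

lemma norm_scaleC_L2: "norm (scaleC_L2 c f) = norm c * norm f"
proof -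
  have "inner (scaleC_L2 c f) (scaleC_L2 c f) = (norm c)\<^sup>2 * inner f f"
    by transfer (simp add: norm_mult power_mult_distrib flip: power2_norm_eq_inner)
  then show ?thesis
    by (simp add: norm_eq_sqrt_inner real_sqrt_mult)
qed


section \<open>Bounded operators on \<open>L\<^sup>2(\<real>)\<close>\<close>

lift_definition scalar_op :: "complex \<Rightarrow> L2 \<Rightarrow>\<^sub>L L2" is scaleC_L2
proof (rule bounded_linear_intro)
  fix c f g and r :: real
  show "scaleC_L2 c (f + g) = scaleC_L2 c f + scaleC_L2 c g"
    by transfer (auto simp: L2_eq_def distrib_left intro!: sq_integrable_add sq_integrable_mult)
  show "scaleC_L2 c (r *\<^sub>R f) = r *\<^sub>R scaleC_L2 c f"
    by transfer (auto simp: L2_eq_def mult.left_commute intro!: sq_integrable_mult)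
  show "norm (scaleC_L2 c f) \<le> norm f * norm c"
    by (simp add: norm_scaleC_L2 mult.commute)
qed

text \<open>
  The operator given by a formula on functions; meaningful when the formula respects
  almost-everywhere equality and induces a bounded linear map.
\<close>

definition L2_operator :: "((real \<Rightarrow> complex) \<Rightarrow> real \<Rightarrow> complex) \<Rightarrow> L2 \<Rightarrow>\<^sub>L L2" where
  "L2_operator \<Phi> = Blinfun (\<lambda>f. abs_L2 (\<Phi> (rep_L2 f)))"

text \<open>
  The interval integral is oriented, so \<open>x < 0\<close> is covered; the value at \<open>x = 0\<close> is immaterial.
\<close>

definition cesaro :: "L2 \<Rightarrow>\<^sub>L L2" where
  "cesaro = L2_operator (\<lambda>f x. (LBINT t=ereal 0..ereal x. f t) / of_real x)"

definition hausdorff :: "(real \<Rightarrow> complex) \<Rightarrow> L2 \<Rightarrow>\<^sub>L L2" where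
  "hausdorff K = L2_operator (\<lambda>f x. LINT u|lebesgue. K u * f (u * x))"

definition hausdorff_kernel :: "(real \<Rightarrow> complex) \<Rightarrow> bool" where
  "hausdorff_kernel K \<longleftrightarrow> K \<in> borel_measurable lebesgue \<and>
     integrable lebesgue (\<lambda>u. K u * of_real (\<bar>u\<bar> powr (-1/2)))"

definition mellin :: "(real \<Rightarrow> complex) \<Rightarrow> complex \<Rightarrow> complex" where
  "mellin K z = (LINT u:{0<..}|lebesgue. K u * of_real u powr (z - 1))"


section \<open>The holomorphic functional calculus\<close>

text \<open>
  The type of bounded operators only records real linearity.  This does not affect the spectrum of
  a complex-linear \<open>T\<close>: if \<open>z - T\<close> is invertible, its inverse commutes with complex scalars.
\<close>

definition is_resolvent :: "(L2 \<Rightarrow>\<^sub>L L2) \<Rightarrow> complex \<Rightarrow> (L2 \<Rightarrow>\<^sub>L L2) \<Rightarrow> bool" where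
  "is_resolvent T z S \<longleftrightarrow>
     (scalar_op z - T) o\<^sub>L S = id_blinfun \<and> S o\<^sub>L (scalar_op z - T) = id_blinfun"

definition op_spectrum :: "(L2 \<Rightarrow>\<^sub>L L2) \<Rightarrow> complex set" where
  "op_spectrum T = {z. \<nexists>S. is_resolvent T z S}"

definition resolvent :: "(L2 \<Rightarrow>\<^sub>L L2) \<Rightarrow> complex \<Rightarrow> L2 \<Rightarrow>\<^sub>L L2" where
  "resolvent T z = (THE S. is_resolvent T z S)"

text \<open>
  A contour is a finite family of closed paths.  It surrounds \<open>\<sigma>\<close> in \<open>U\<close> if it lies in \<open>U - \<sigma>\<close>
  and has total winding number 1 about the points of \<open>\<sigma>\<close> and 0 about the points outside \<open>U\<close>.
\<close>

definition surrounds :: "(real \<Rightarrow> complex) list \<Rightarrow> complex set \<Rightarrow> complex set \<Rightarrow> bool" where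
  "surrounds \<Gamma> \<sigma> U \<longleftrightarrow>
     (\<forall>\<gamma>\<in>set \<Gamma>. valid_path \<gamma> \<and> pathfinish \<gamma> = pathstart \<gamma> \<and> path_image \<gamma> \<subseteq> U - \<sigma>) \<and>
     (\<forall>z\<in>\<sigma>. (\<Sum>\<gamma>\<leftarrow>\<Gamma>. winding_number \<gamma> z) = 1) \<and>
     (\<forall>z. z \<notin> U \<longrightarrow> (\<Sum>\<gamma>\<leftarrow>\<Gamma>. winding_number \<gamma> z) = 0)"

text \<open>Operator-valued analogue of \<^const>\<open>contour_integral\<close>, as a limit in operator norm.\<close>

definition op_contour_integral ::
    "(real \<Rightarrow> complex) \<Rightarrow> (complex \<Rightarrow> L2 \<Rightarrow>\<^sub>L L2) \<Rightarrow> L2 \<Rightarrow>\<^sub>L L2" where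
  "op_contour_integral \<gamma> G =
     integral {0..1} (\<lambda>t. scalar_op (vector_derivative \<gamma> (at t within {0..1})) o\<^sub>L G (\<gamma> t))"

definition dunford_integral ::
    "(real \<Rightarrow> complex) list \<Rightarrow> (complex \<Rightarrow> complex) \<Rightarrow> (L2 \<Rightarrow>\<^sub>L L2) \<Rightarrow> L2 \<Rightarrow>\<^sub>L L2" where
  "dunford_integral \<Gamma> F T = scalar_op (1 / (2 * of_real pi * \<i>)) o\<^sub>L
     (\<Sum>\<gamma>\<leftarrow>\<Gamma>. op_contour_integral \<gamma> (\<lambda>z. scalar_op (F z) o\<^sub>L resolvent T z))"

text \<open>
  \<open>F(T)\<close> for \<open>F\<close> holomorphic on the open set \<open>U\<close> containing the spectrum of \<open>T\<close>:
  the common value of the Riesz--Dunford integrals over all contours surrounding the spectrum in \<open>U\<close>.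
\<close>

definition holomorphic_calculus ::
    "complex set \<Rightarrow> (complex \<Rightarrow> complex) \<Rightarrow> (L2 \<Rightarrow>\<^sub>L L2) \<Rightarrow> L2 \<Rightarrow>\<^sub>L L2" where
  "holomorphic_calculus U F T =
     (THE A. \<forall>\<Gamma>. surrounds \<Gamma> (op_spectrum T) U \<longrightarrow> A = dunford_integral \<Gamma> F T)"

end

theory Submission
  imports Defs "HOL-Probability.Levy"
begin

text \<open>
  Two facts make the Mellin transform turn Hausdorff operators with kernels on the positive half-line
  into multiplication operators: the composition of two of them has the multiplicative convolution
  of the kernels as its kernel, and the Cesaro operator \<open>C\<close> is the one with kernel \<open>1\<close> on
  \<open>(0,1)\<close>, whose Mellin transform is \<open>1/z\<close>.  On the line \<open>Re z = 1/2\<close>, a function of \<open>C\<close> should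
  therefore have the Mellin symbol \<open>F (1/z)\<close>.  For the resolvent this can be made explicit:
  \<open>1 / (\<lambda> - 1/z) = 1/\<lambda> + 1 / (\<lambda>\<^sup>2 (z - 1/\<lambda>))\<close>, and \<open>1 / (z - w)\<close> is the Mellin transform of \<open>u powr (- w)\<close> on
  \<open>(0,1)\<close> if \<open>Re w < 1/2\<close>, and of \<open>- (u powr (- w))\<close> on \<open>(1,\<infinity>)\<close> if \<open>Re w > 1/2\<close> (\<open>power_kernel w\<close>).  Since
  \<open>Re (1/\<lambda>) = 1/2\<close> describes the unit circle about \<open>1\<close>, this gives the resolvent off that circle
  (\<open>resolvent_cesaro\<close>) and confines the spectrum to it.

  The Riesz--Dunford integral over the boundary of a thin annulus around the circle now becomes
  \<open>F(C) = F(0) I + H\<^sub>K\<close>.  The terms \<open>F(\<lambda>)/\<lambda>\<close> contribute \<open>F(0)\<close> by Cauchy's formula, because \<open>0\<close> is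
  on the circle; the kernel \<open>K\<close> is the contour integral of \<open>F(\<lambda>) / \<lambda>\<^sup>2\<close> times the power kernels.
  It satisfies the integrability condition since \<open>Re (1/\<lambda>)\<close> stays away from \<open>1/2\<close> on each of the two
  boundary circles, and a second use of Cauchy's formula gives its Mellin transform
  \<open>F (1/z) - F(0)\<close> (\<open>cesaro_calculus_kernel\<close>).

  The operator \<open>F(C)\<close> is defined through all contours that surround the spectrum, so the integral has
  to be shown independent of the contour.  Operators are tested against pairs of vectors:
  a coefficient of an operator integral is an ordinary contour integral of a holomorphic function, and
  for these the homology form of Cauchy's theorem for cycles (\<open>Cauchy_theorem_cycle\<close>) applies.

  Uniqueness of the kernel and the second half of the theorem rest on the injectivity of the Mellin
  transform, which is Levy's uniqueness theorem for characteristic functions in the variable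
  \<open>ln u\<close>.  A kernel with constant Mellin transform on the line vanishes on the half-line and the
  constant is \<open>0\<close> (\<open>borel_mellin_constant\<close>).  If \<open>L\<close> has the Mellin transform \<open>F (1/z)\<close>, then
  \<open>L - K\<close> has the constant transform \<open>F(0)\<close>, so that \<open>F(0) = 0\<close> and \<open>L = K\<close>.
\<close>

section \<open>Cauchy's theorem for cycles\<close>

definition cycle_in :: "complex set \<Rightarrow> (real \<Rightarrow> complex) list \<Rightarrow> bool" where
  "cycle_in V \<Gamma> \<longleftrightarrow> (\<forall>\<gamma>\<in>set \<Gamma>. valid_path \<gamma> \<and> pathfinish \<gamma> = pathstart \<gamma> \<and> path_image \<gamma> \<subseteq> V)"

lemma cycle_in_simps [simp]:
  "cycle_in V []"
  "cycle_in V (\<gamma> # \<Gamma>) \<longleftrightarrow>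
     valid_path \<gamma> \<and> pathfinish \<gamma> = pathstart \<gamma> \<and> path_image \<gamma> \<subseteq> V \<and> cycle_in V \<Gamma>"
  "cycle_in V (\<Gamma> @ \<Delta>) \<longleftrightarrow> cycle_in V \<Gamma> \<and> cycle_in V \<Delta>"
  by (auto simp: cycle_in_def)

lemma cycle_in_mono: "cycle_in V \<Gamma> \<Longrightarrow> V \<subseteq> W \<Longrightarrow> cycle_in W \<Gamma>"
  by (auto simp: cycle_in_def)

text \<open>
  In a connected open set the members of a cycle can be strung together: the path that links two of
  them is traversed once in each direction, so it does not contribute to integrals.
\<close>

lemma merge_cycle_connected:
  assumes "open W" "connected W" "cycle_in W \<Gamma>" "\<Gamma> \<noteq> []"
  shows "\<exists>\<gamma>. valid_path \<gamma> \<and> pathfinish \<gamma> = pathstart \<gamma> \<and> path_image \<gamma> \<subseteq> W \<and>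
             (\<forall>f. f holomorphic_on W \<longrightarrow> contour_integral \<gamma> f = (\<Sum>\<delta>\<leftarrow>\<Gamma>. contour_integral \<delta> f))"
  using assms(4,3)
proof (induction \<Gamma> rule: list_nonempty_induct)
  case (single \<gamma>)
  then show ?case by auto
next
  case (cons g \<Gamma>)
  then obtain p where p: "valid_path p" "pathfinish p = pathstart p" "path_image p \<subseteq> W"
    and pint: "\<And>f. f holomorphic_on W \<Longrightarrow> contour_integral p f = (\<Sum>\<delta>\<leftarrow>\<Gamma>. contour_integral \<delta> f)"
    by auto
  have g: "valid_path g" "pathfinish g = pathstart g" "path_image g \<subseteq> W"
    using cons.prems by auto
  have "pathstart g \<in> W" "pathstart p \<in> W"
    using g p pathstart_in_path_image by blast+
  then obtain c where c: "polynomial_function c" "path_image c \<subseteq> W"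
      "pathstart c = pathstart g" "pathfinish c = pathstart p"
    using connected_open_polynomial_connected[OF assms(1,2)] by blast
  then have vc: "valid_path c" by (simp add: valid_path_polynomial_function)
  let ?r = "g +++ c +++ p +++ reversepath c"
  have "contour_integral ?r f = (\<Sum>\<delta>\<leftarrow>g # \<Gamma>. contour_integral \<delta> f)" if f: "f holomorphic_on W" for f
  proof -
    have int: "f contour_integrable_on q" if "valid_path q" "path_image q \<subseteq> W" for q
      using contour_integrable_holomorphic_simple[OF f assms(1)] that by blast
    show ?thesis
      using g p c vc by (simp add: int contour_integral_reversepath pint[OF f]
          contour_integrable_reversepath)
  qed
  moreover have "valid_path ?r" "pathfinish ?r = pathstart ?r" "path_image ?r \<subseteq> W"
    using g p c vc by (simp_all add: path_image_join Un_subset_iff)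
  ultimately show ?case by blast
qed

lemma winding_number_sum_list_constant:
  assumes "cycle_in V \<Gamma>" "connected S" "S \<inter> V = {}" "x \<in> S" "y \<in> S"
  shows "(\<Sum>\<gamma>\<leftarrow>\<Gamma>. winding_number \<gamma> x) = (\<Sum>\<gamma>\<leftarrow>\<Gamma>. winding_number \<gamma> y)"
proof -
  have "winding_number \<gamma> x = winding_number \<gamma> y" if "\<gamma> \<in> set \<Gamma>" for \<gamma>
    using that assms by (intro winding_number_eq[of \<gamma> x S]) (auto simp: cycle_in_def valid_path_imp_path)
  then show ?thesis
    by (metis (mono_tags, lifting) map_cong)
qed

lemma winding_number_sum_list_zero_outside:
  assumes "cycle_in V \<Gamma>" "V \<subseteq> ball 0 r" "x \<notin> ball 0 r"
  shows "(\<Sum>\<gamma>\<leftarrow>\<Gamma>. winding_number \<gamma> x) = 0"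
proof -
  have "winding_number \<gamma> x = 0" if "\<gamma> \<in> set \<Gamma>" for \<gamma>
    using that assms by (intro winding_number_zero_outside[of \<gamma> "ball 0 r"])
       (auto simp: cycle_in_def valid_path_imp_path)
  then show ?thesis
    by (simp add: sum_list_0 cong: map_cong)
qed

lemma cycle_in_bounded:
  assumes "cycle_in V \<Gamma>"
  obtains r where "cycle_in (ball 0 r) \<Gamma>"
proof -
  have "bounded (\<Union>\<gamma>\<in>set \<Gamma>. path_image \<gamma>)"
    using assms by (auto simp: cycle_in_def intro!: compact_imp_bounded compact_valid_path_image)
  then obtain r where "(\<Union>\<gamma>\<in>set \<Gamma>. path_image \<gamma>) \<subseteq> ball 0 r"
    using bounded_subset_ballD by blast
  with assms show ?thesis
    by (intro that[of r]) (auto simp: cycle_in_def)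
qed

text \<open>
  Let \<open>W\<close> be a component of \<open>V\<close> and split a null-homologous cycle of \<open>V\<close> into \<open>\<Gamma>\<close> inside \<open>W\<close> and
  \<open>\<Delta>\<close> outside.  Then \<open>\<Gamma>\<close> is null-homologous in \<open>W\<close>.  The winding number of \<open>\<Delta>\<close> is constant on
  the closure of \<open>W\<close>, and the constant is \<open>0\<close>, as one sees at a point of \<open>W\<close> far away if \<open>W\<close> is
  unbounded, and at a point of the closure of largest modulus otherwise.  A point outside \<open>W\<close> is joined by a segment
  that avoids \<open>W\<close> to the closest point of the closure of \<open>W\<close>.  That point is outside \<open>V\<close>, so the total
  winding number vanishes there, and with it that of \<open>\<Gamma>\<close>.
\<close>

lemma winding_number_zero_component:
  assumes V: "open V" and W: "W \<in> components V"
    and inn: "cycle_in W \<Gamma>" and out: "cycle_in (V - W) \<Delta>"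
    and zero: "\<And>z. z \<notin> V \<Longrightarrow> (\<Sum>\<gamma>\<leftarrow>\<Gamma>. winding_number \<gamma> z) + (\<Sum>\<gamma>\<leftarrow>\<Delta>. winding_number \<gamma> z) = 0"
    and z: "z \<notin> W"
  shows "(\<Sum>\<gamma>\<leftarrow>\<Gamma>. winding_number \<gamma> z) = 0"
proof -
  have W': "open W" "connected W" "W \<noteq> {}" "W \<subseteq> V"
    using V W by (auto simp: open_components in_components_connected in_components_nonempty in_components_subset)
  have "V - W = \<Union> (components V - {W})"
    using W Union_components[of V] components_nonoverlap[of W V] by blast
  then have "open (V - W)"
    using V open_components by (metis DiffD1 open_Union)
  then have clW: "closure W \<inter> (V - W) = {}"
    using open_Int_closure_eq_empty by blast
  have out_const: "(\<Sum>\<gamma>\<leftarrow>\<Delta>. winding_number \<gamma> x) = (\<Sum>\<gamma>\<leftarrow>\<Delta>. winding_number \<gamma> y)"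
    if "x \<in> closure W" "y \<in> closure W" for x y
    using winding_number_sum_list_constant[OF out connected_imp_connected_closure[OF W'(2)] clW that] .
  have "\<exists>p\<in>closure W. (\<Sum>\<gamma>\<leftarrow>\<Delta>. winding_number \<gamma> p) = 0"
  proof (cases "bounded W")
    case False
    obtain r where r: "cycle_in (ball 0 r) \<Delta>"
      using cycle_in_bounded[OF out] .
    \<comment> \<open>far out in \<open>W\<close>, where no member of \<open>\<Delta>\<close> winds\<close>
    obtain p where "p \<in> W" "p \<notin> ball 0 r"
      using False bounded_subset[OF bounded_ball] by blast
    with winding_number_sum_list_zero_outside[OF r order_refl, of p] closure_subset[of W] show ?thesis
      by blast
  next
    case True
    then have "compact (closure W)" "closure W \<noteq> {}"
      using W' by auto
    then obtain p where p: "p \<in> closure W" "\<And>y. y \<in> closure W \<Longrightarrow> norm y \<le> norm p"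
      using continuous_attains_sup[of "closure W" norm] continuous_on_norm_id by blast
    \<comment> \<open>the open set \<open>W\<close> lies in the open disc through \<open>p\<close>, so neither \<open>p \<in> V\<close> nor does \<open>\<Gamma>\<close> wind about \<open>p\<close>\<close>
    have "W \<subseteq> cball 0 (norm p)"
      using p closure_subset[of W] by auto
    then have sub: "W \<subseteq> ball 0 (norm p)"
      using W' interior_maximal interior_cball by metis
    then have "p \<notin> W" by auto
    with clW p have "p \<notin> V" by blast
    from zero[OF this] winding_number_sum_list_zero_outside[OF inn sub, of p] p
    show ?thesis by auto
  qed
  with out_const have out0: "(\<Sum>\<gamma>\<leftarrow>\<Delta>. winding_number \<gamma> x) = 0" if "x \<in> closure W" for x
    using that by metis
  let ?p = "closest_point (closure W) z"
  have p: "?p \<in> closure W"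
    using W' by (intro closest_point_in_set) auto
  have seg: "closed_segment z ?p \<inter> W = {}"
  proof -
    have "y \<notin> W" if y: "y \<in> closed_segment z ?p" for y
    proof
      assume "y \<in> W"
      then have "y \<noteq> z" using z by auto
      obtain e where e: "e > 0" "ball y e \<subseteq> W"
        using \<open>y \<in> W\<close> W'(1) openE by blast
      \<comment> \<open>moving from \<open>y\<close> towards \<open>z\<close> inside \<open>W\<close> brings one strictly closer to \<open>z\<close>\<close>
      define t where "t = min (1/2) (e / (2 * dist z y))"
      have t: "0 < t" "t < 1" "t * dist z y < e"
        using e \<open>y \<noteq> z\<close> by (auto simp: t_def min_def field_simps)
      have "dist y (y + t *\<^sub>R (z - y)) = t * dist z y"
        using t by (simp add: dist_norm norm_minus_commute)
      then have "y + t *\<^sub>R (z - y) \<in> closure W"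
        using e t closure_subset by fastforce
      then have "dist z ?p \<le> dist z (y + t *\<^sub>R (z - y))"
        by (intro closest_point_le) auto
      also have "\<dots> = norm ((1 - t) *\<^sub>R (z - y))"
        by (simp add: dist_norm algebra_simps)
      also have "\<dots> = (1 - t) * dist z y"
        using t by (simp add: dist_norm)
      also have "\<dots> < dist z y"
        using t \<open>y \<noteq> z\<close> by simp
      also have "\<dots> \<le> dist z ?p"
        using y dist_in_closed_segment[of y z ?p] by (simp add: dist_commute)
      finally show False by simp
    qed
    then show ?thesis by blast
  qed
  then have "?p \<notin> W" by auto
  with p clW have "?p \<notin> V" by blast
  with zero[OF this] out0[OF p] have "(\<Sum>\<gamma>\<leftarrow>\<Gamma>. winding_number \<gamma> ?p) = 0" by simp
  with winding_number_sum_list_constant[OF inn connected_segment(1) seg, of z ?p]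
  show ?thesis by auto
qed

lemma sum_list_partition:
  fixes f :: "'a \<Rightarrow> 'b::comm_monoid_add"
  shows "(\<Sum>x\<leftarrow>xs. f x) = (\<Sum>x\<leftarrow>filter P xs. f x) + (\<Sum>x\<leftarrow>filter (\<lambda>x. \<not> P x) xs. f x)"
  by (induction xs) (auto simp: algebra_simps)

text \<open>
  The theorem for a single closed path suffices.  By the previous lemma the part of the cycle in one
  component of \<open>V\<close> is itself null-homologous there, and it can be merged into one path; the
  remaining part is shorter and again null-homologous in \<open>V\<close>.
\<close>

theorem Cauchy_theorem_cycle:
  assumes V: "open V" and f: "f holomorphic_on V" and \<Gamma>: "cycle_in V \<Gamma>"
    and zero: "\<And>z. z \<notin> V \<Longrightarrow> (\<Sum>\<gamma>\<leftarrow>\<Gamma>. winding_number \<gamma> z) = 0"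
  shows "(\<Sum>\<gamma>\<leftarrow>\<Gamma>. contour_integral \<gamma> f) = 0"
  using \<Gamma> zero
proof (induction "length \<Gamma>" arbitrary: \<Gamma> rule: less_induct)
  case less
  show ?case
  proof (cases \<Gamma>)
    case (Cons g \<Gamma>')
    define W where "W = connected_component_set V (pathstart g)"
    have g: "valid_path g" "path_image g \<subseteq> V"
      using less.prems Cons by auto
    have "pathstart g \<in> V"
      using g pathstart_in_path_image by blast
    then have W: "W \<in> components V"
      by (auto simp: W_def components_def)
    then have W': "open W" "connected W" "W \<subseteq> V"
      using V by (auto simp: open_components in_components_connected in_components_subset)
    have dichotomy: "path_image \<gamma> \<subseteq> W \<or> path_image \<gamma> \<subseteq> V - W" if "\<gamma> \<in> set \<Gamma>" for \<gamma>
    proof -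
      have "connected (path_image \<gamma>)" "path_image \<gamma> \<subseteq> V"
        using that less.prems by (auto simp: cycle_in_def connected_valid_path_image)
      then show ?thesis
        using components_maximal[OF W, of "path_image \<gamma>"] by blast
    qed
    define In where "In = filter (\<lambda>\<gamma>. path_image \<gamma> \<subseteq> W) \<Gamma>"
    define Out where "Out = filter (\<lambda>\<gamma>. \<not> path_image \<gamma> \<subseteq> W) \<Gamma>"
    have split: "(\<Sum>\<gamma>\<leftarrow>\<Gamma>. h \<gamma>) = (\<Sum>\<gamma>\<leftarrow>In. h \<gamma>) + (\<Sum>\<gamma>\<leftarrow>Out. h \<gamma>)" for h :: "_ \<Rightarrow> complex"
      unfolding In_def Out_def by (rule sum_list_partition)
    have In: "cycle_in W In" and Out: "cycle_in (V - W) Out"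
      using less.prems(1) dichotomy unfolding cycle_in_def In_def Out_def set_filter by blast+
    have zero_In: "(\<Sum>\<gamma>\<leftarrow>In. winding_number \<gamma> z) = 0" if "z \<notin> W" for z
      using winding_number_zero_component[OF V W In Out _ that] less.prems(2) by (simp add: split)
    have "path_image g \<subseteq> W"
      unfolding W_def using g by (intro connected_component_maximal) 
        (auto simp: connected_valid_path_image)
    then have ne: "In \<noteq> []" and len: "length Out < length \<Gamma>"
      by (auto simp: In_def Out_def Cons less_Suc_eq_le)
    obtain \<gamma> where \<gamma>: "valid_path \<gamma>" "pathfinish \<gamma> = pathstart \<gamma>" "path_image \<gamma> \<subseteq> W"
      and int: "\<And>h. h holomorphic_on W \<Longrightarrow> contour_integral \<gamma> h = (\<Sum>\<delta>\<leftarrow>In. contour_integral \<delta> h)"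
      using merge_cycle_connected[OF W'(1,2) In ne] by blast
    have "winding_number \<gamma> z = 0" if "z \<notin> W" for z
    proof -
      have hol: "(\<lambda>w. 1 / (w - z)) holomorphic_on W"
        using that by (auto intro!: holomorphic_intros)
      have "winding_number \<gamma> z = 1 / (2 * pi * \<i>) * (\<Sum>\<delta>\<leftarrow>In. contour_integral \<delta> (\<lambda>w. 1 / (w - z)))"
        using \<gamma> that by (subst winding_number_valid_path) (auto simp: int[OF hol])
      also have "\<dots> = (\<Sum>\<delta>\<leftarrow>In. 1 / (2 * pi * \<i>) * contour_integral \<delta> (\<lambda>w. 1 / (w - z)))"
        by (rule sum_list_const_mult[symmetric])
      also have "\<dots> = (\<Sum>\<delta>\<leftarrow>In. winding_number \<delta> z)"
        using In that by (intro arg_cong[of _ _ sum_list] map_cong refl winding_number_valid_path[symmetric])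
          (auto simp: cycle_in_def)
      finally show ?thesis using zero_In[OF that] by simp
    qed
    with Cauchy_theorem_global[OF W'(1) holomorphic_on_subset[OF f W'(3)] \<gamma>]
    have "(\<Sum>\<delta>\<leftarrow>In. contour_integral \<delta> f) = 0"
      using int[OF holomorphic_on_subset[OF f W'(3)]] contour_integral_unique by force
    moreover have "(\<Sum>\<delta>\<leftarrow>Out. contour_integral \<delta> f) = 0"
    proof (rule less.hyps[OF len])
      show "cycle_in V Out" using Out cycle_in_mono by blast
      show "(\<Sum>\<gamma>\<leftarrow>Out. winding_number \<gamma> z) = 0" if "z \<notin> V" for z
      proof -
        have "z \<notin> W" using W'(3) that by blast
        then show ?thesis using less.prems(2)[OF that] zero_In[of z] split[of "\<lambda>\<gamma>. winding_number \<gamma> z"] by simp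
      qed
    qed
    ultimately show ?thesis by (simp add: split)
  qed simp
qed

text \<open>
  Cauchy's theorem for the difference quotient of \<open>f\<close> at \<open>w\<close>, whose singularity is removable.
\<close>

theorem Cauchy_integral_formula_cycle:
  assumes V: "open V" and f: "f holomorphic_on V" and \<Gamma>: "cycle_in (V - {w}) \<Gamma>" and w: "w \<in> V"
    and zero: "\<And>z. z \<notin> V \<Longrightarrow> (\<Sum>\<gamma>\<leftarrow>\<Gamma>. winding_number \<gamma> z) = 0"
  shows "(\<Sum>\<gamma>\<leftarrow>\<Gamma>. contour_integral \<gamma> (\<lambda>z. f z / (z - w)))
     = 2 * of_real pi * \<i> * (\<Sum>\<gamma>\<leftarrow>\<Gamma>. winding_number \<gamma> w) * f w"
proof -
  define g where "g = (\<lambda>z. if z = w then deriv f w else f z / (z - w) - f w / (z - w))"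
  have g: "g holomorphic_on V"
    unfolding g_def by (rule pole_theorem_open[OF f V]) auto
  have eq: "contour_integral \<gamma> (\<lambda>z. f z / (z - w)) =
      contour_integral \<gamma> g + 2 * of_real pi * \<i> * winding_number \<gamma> w * f w" if "\<gamma> \<in> set \<Gamma>" for \<gamma>
  proof -
    have \<gamma>: "valid_path \<gamma>" "path_image \<gamma> \<subseteq> V - {w}" 
      using that \<Gamma> by (auto simp: cycle_in_def)
    have op: "open (V - {w})" using V by blast
    have "(\<lambda>z. 1 / (z - w)) holomorphic_on V - {w}"
      by (auto intro!: holomorphic_intros)
    then have "g contour_integrable_on \<gamma>" "(\<lambda>z. 1 / (z - w)) contour_integrable_on \<gamma>"
      using contour_integrable_holomorphic_simple[OF _ op \<gamma>] holomorphic_on_subset[OF g, of "V - {w}"]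
      by auto
    then have "contour_integral \<gamma> g + f w * contour_integral \<gamma> (\<lambda>z. 1 / (z - w))
        = contour_integral \<gamma> (\<lambda>z. g z + f w * (1 / (z - w)))"
      by (simp add: contour_integral_add contour_integral_lmul contour_integrable_lmul del: times_divide_eq_right)
    also have "\<dots> = contour_integral \<gamma> (\<lambda>z. f z / (z - w))"
      using \<gamma> by (intro contour_integral_eq) (auto simp: g_def)
    also have "contour_integral \<gamma> (\<lambda>z. 1 / (z - w)) = 2 * of_real pi * \<i> * winding_number \<gamma> w"
      using \<gamma> by (subst winding_number_valid_path) auto
    finally show ?thesis by (simp add: mult_ac)
  qed
  have "(\<Sum>\<gamma>\<leftarrow>\<Gamma>. contour_integral \<gamma> (\<lambda>z. f z / (z - w))) =
      (\<Sum>\<gamma>\<leftarrow>\<Gamma>. contour_integral \<gamma> g + 2 * of_real pi * \<i> * winding_number \<gamma> w * f w)"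
    using eq by (intro arg_cong[of _ _ sum_list] map_cong) auto
  also have "\<dots> = (\<Sum>\<gamma>\<leftarrow>\<Gamma>. contour_integral \<gamma> g)
      + 2 * of_real pi * \<i> * (\<Sum>\<gamma>\<leftarrow>\<Gamma>. winding_number \<gamma> w) * f w"
    by (simp add: sum_list_addf sum_list_const_mult sum_list_mult_const)
  also have "(\<Sum>\<gamma>\<leftarrow>\<Gamma>. contour_integral \<gamma> g) = 0"
    using cycle_in_mono[OF \<Gamma>] by (intro Cauchy_theorem_cycle[OF V g _ zero]) auto
  finally show ?thesis by simp
qed

section \<open>Complex structure and coefficients of operators\<close>

lemma scaleC_L2_rep: "scaleC_L2 c f = abs_L2 (\<lambda>x. c * rep_L2 f x)"
  using scaleC_L2.abs_eq[of "rep_L2 f" c] by (simp add: L2_eq_def sq_integrable_rep)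

lemma scaleC_L2_simps [simp]:
  "scaleC_L2 c (scaleC_L2 d f) = scaleC_L2 (c * d) f"
  "scaleC_L2 1 f = f"
  "scaleC_L2 0 f = 0"
  by (transfer; auto simp: L2_eq_def mult.assoc sq_integrable_0 intro!: sq_integrable_mult)+

lemma scaleC_L2_add_left: "scaleC_L2 (c + d) f = scaleC_L2 c f + scaleC_L2 d f"
  by transfer (auto simp: L2_eq_def distrib_right intro!: sq_integrable_mult sq_integrable_add)

lemma scaleR_conv_scaleC_L2: "r *\<^sub>R f = scaleC_L2 (of_real r) f"
  by transfer (auto simp: L2_eq_def intro!: sq_integrable_mult)

lemma scalar_op_apply [simp]: "blinfun_apply (scalar_op c) f = scaleC_L2 c f"
  by (simp add: scalar_op.rep_eq)

lemma scaleC_L2_linear_right: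
  "scaleC_L2 c (f + g) = scaleC_L2 c f + scaleC_L2 c g"
  "scaleC_L2 c (f - g) = scaleC_L2 c f - scaleC_L2 c g"
  "scaleC_L2 c 0 = 0"
  using blinfun.add_right[of "scalar_op c" f g] blinfun.diff_right[of "scalar_op c" f g]
    blinfun.zero_right[of "scalar_op c"] by (simp_all only: scalar_op_apply)

lemma scaleC_L2_diff_left: "scaleC_L2 (c - d) f = scaleC_L2 c f - scaleC_L2 d f"
  using scaleC_L2_add_left[of "c - d" d f] by (simp add: algebra_simps)

lemma norm_smult_op: "norm (scalar_op a o\<^sub>L T) \<le> norm a * norm T"
  by (rule norm_blinfun_bound)
     (auto simp: norm_scaleC_L2 mult.assoc intro!: mult_left_mono norm_blinfun)

lemma bounded_bilinear_smult_op: "bounded_bilinear (\<lambda>c (T :: L2 \<Rightarrow>\<^sub>L L2). scalar_op c o\<^sub>L T)"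
proof (rule bounded_bilinear.intro)
  fix a a' :: complex and T T' :: "L2 \<Rightarrow>\<^sub>L L2" and r :: real
  show "scalar_op (a + a') o\<^sub>L T = (scalar_op a o\<^sub>L T) + (scalar_op a' o\<^sub>L T)"
    by (rule blinfun_eqI) (simp add: scaleC_L2_add_left blinfun.add_left)
  show "scalar_op a o\<^sub>L (T + T') = (scalar_op a o\<^sub>L T) + (scalar_op a o\<^sub>L T')"
    by (rule blinfun_eqI) (simp add: scaleC_L2_linear_right blinfun.add_left)
  show "scalar_op (r *\<^sub>R a) o\<^sub>L T = r *\<^sub>R (scalar_op a o\<^sub>L T)"
    by (rule blinfun_eqI) (simp add: scaleR_conv_scaleC_L2 blinfun.scaleR_left scaleR_conv_of_real)
  show "scalar_op a o\<^sub>L (r *\<^sub>R T) = r *\<^sub>R (scalar_op a o\<^sub>L T)"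
    by (rule blinfun_eqI) (simp add: scaleR_conv_scaleC_L2 blinfun.scaleR_left mult.commute)
  show "\<exists>K. \<forall>a (T :: L2 \<Rightarrow>\<^sub>L L2). norm (scalar_op a o\<^sub>L T) \<le> norm a * norm T * K"
    using norm_smult_op by (intro exI[of _ 1]) auto
qed

text \<open>
  The complex inner product, linear in the first argument.  Built from the real one, it inherits
  boundedness; operators are compared through the coefficients \<open>cinner (T f) g\<close>.
\<close>

definition cinner :: "L2 \<Rightarrow> L2 \<Rightarrow> complex" where
  "cinner f g = Complex (inner f g) (inner f (scaleC_L2 \<i> g))"

lemma cinner_integral:
  assumes "sq_integrable f" "sq_integrable g"
  shows "integrable lborel (\<lambda>x. f x * cnj (g x))"
    and "cinner (abs_L2 f) (abs_L2 g) = (LINT x|lborel. f x * cnj (g x))"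
proof -
  have ig: "sq_integrable (\<lambda>x. \<i> * g x)" by (rule sq_integrable_mult) fact
  have *: "f x * cnj (g x) = Complex (inner (f x) (g x)) (inner (f x) (\<i> * g x))" for x
    by (simp add: complex_eq_iff inner_complex_def algebra_simps)
  have int: "integrable lborel (\<lambda>x. inner (f x) (g x))" "integrable lborel (\<lambda>x. inner (f x) (\<i> * g x))"
    using assms ig by (auto intro: sq_integrable_inner)
  show "integrable lborel (\<lambda>x. f x * cnj (g x))"
    unfolding * Complex_eq using int by auto
  have "cinner (abs_L2 f) (abs_L2 g) =
     Complex (LINT x|lborel. inner (f x) (g x)) (LINT x|lborel. inner (f x) (\<i> * g x))"
    unfolding cinner_def using assms ig
    by (subst scaleC_L2.abs_eq, simp add: L2_eq_def, subst (1 2) inner_L2.abs_eq) (auto simp: L2_eq_def)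
  also have "\<dots> = (LINT x|lborel. f x * cnj (g x))"
    unfolding * Complex_eq using int by simp
  finally show "cinner (abs_L2 f) (abs_L2 g) = (LINT x|lborel. f x * cnj (g x))" .
qed

lemma bounded_linear_cinner_left: "bounded_linear (\<lambda>f. cinner f g)"
proof -
  have "bounded_linear (\<lambda>f. of_real (inner f g) + \<i> * of_real (inner f (scaleC_L2 \<i> g)) :: complex)"
    by (intro bounded_linear_add bounded_linear_const_mult
        bounded_linear_compose[OF bounded_linear_of_real bounded_linear_inner_left])
  then show ?thesis by (simp add: cinner_def Complex_eq)
qed

lemmas cinner_simps = 
  linear_simps(1-3)[OF bounded_linear_cinner_left]

lemma cinner_rep: "cinner f g = (LINT x|lborel. rep_L2 f x * cnj (rep_L2 g x))"
  using cinner_integral(2)[OF sq_integrable_rep sq_integrable_rep, of f g] by simp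

lemma cinner_scaleC_left [simp]: "cinner (scaleC_L2 c f) g = c * cinner f g"
proof -
  have "cinner (scaleC_L2 c f) g = (LINT x|lborel. c * rep_L2 f x * cnj (rep_L2 g x))"
    using cinner_integral(2)[OF sq_integrable_mult[OF sq_integrable_rep] sq_integrable_rep, of c f g]
    by (simp add: scaleC_L2_rep)
  then show ?thesis
    by (simp add: cinner_rep mult.assoc)
qed

lemma L2_eqI: "(\<And>g. cinner f g = cinner f' g) \<Longrightarrow> f = f'"
proof -
  assume "\<And>g. cinner f g = cinner f' g"
  then have "cinner (f - f') (f - f') = 0" by (simp add: cinner_simps)
  then have "inner (f - f') (f - f') = 0" by (simp add: cinner_def complex_eq_iff)
  then show ?thesis by simp
qed

lemma op_eqI: "(\<And>f g. cinner (blinfun_apply T f) g = cinner (blinfun_apply T' f) g) \<Longrightarrow> T = T'"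
  by (intro blinfun_eqI L2_eqI)

lemma bounded_linear_op_coefficient: "bounded_linear (\<lambda>T. cinner (blinfun_apply T f) g)"
  by (rule bounded_linear_compose[OF bounded_linear_cinner_left blinfun.bounded_linear_left])

section \<open>Resolvents\<close>

text \<open>
  The type of bounded operators records only real linearity, while coefficients of the resolvent are
  holomorphic only if the operator commutes with complex scalars.
\<close>

definition complex_linear :: "(L2 \<Rightarrow>\<^sub>L L2) \<Rightarrow> bool" where
  "complex_linear T \<longleftrightarrow> (\<forall>c f. blinfun_apply T (scaleC_L2 c f) = scaleC_L2 c (blinfun_apply T f))"

lemma is_resolvent_iff:
  "is_resolvent T z S \<longleftrightarrow> (\<forall>f. scaleC_L2 z (S f) - T (S f) = f) \<and> (\<forall>f. S (scaleC_L2 z f - T f) = f)"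
  unfolding is_resolvent_def by (auto simp: fun_eq_iff blinfun.diff_left simp flip: blinfun_apply_inject)

lemma is_resolvent_unique: "is_resolvent T z S \<Longrightarrow> is_resolvent T z S' \<Longrightarrow> S = S'"
  by (rule blinfun_eqI) (metis is_resolvent_iff)

lemma resolvent_eq: "is_resolvent T z S \<Longrightarrow> resolvent T z = S"
  unfolding resolvent_def by (rule the_equality) (auto intro: is_resolvent_unique)

lemma is_resolvent_resolvent: "z \<notin> op_spectrum T \<Longrightarrow> is_resolvent T z (resolvent T z)"
  by (auto simp: op_spectrum_def resolvent_eq)

lemma resolvent_complex_linear:
  assumes T: "complex_linear T" and S: "is_resolvent T z S"
  shows "complex_linear S"
  unfolding complex_linear_def
proof safe
  fix c f
  have "scaleC_L2 z (scaleC_L2 c (S f)) - T (scaleC_L2 c (S f))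
      = scaleC_L2 c (scaleC_L2 z (S f) - T (S f))"
    using T by (simp add: complex_linear_def scaleC_L2_linear_right mult.commute)
  also have "\<dots> = scaleC_L2 c f"
    using S by (simp add: is_resolvent_iff)
  finally show "S (scaleC_L2 c f) = scaleC_L2 c (S f)"
    using S by (metis is_resolvent_iff)
qed

text \<open>
  For each \<open>y\<close>, the solution \<open>x\<close> of \<open>x + X x = y\<close> is the fixed point of a contraction.
\<close>

lemma invertible_id_plus_small:
  fixes X :: "'a::banach \<Rightarrow>\<^sub>L 'a"
  assumes X: "norm X < 1"
  obtains Y :: "'a \<Rightarrow>\<^sub>L 'a" where "\<And>x. Y x + X (Y x) = x" "\<And>x. Y (x + X x) = x"
proof -
  have "\<exists>!x. y - X x = x" for y
  proof (rule banach_fix_type[of "norm X" "\<lambda>x. y - X x"])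
    have "dist (y - X a) (y - X b) \<le> norm X * dist a b" for a b
      using norm_blinfun[of X "a - b"] by (simp add: dist_norm blinfun.diff_right norm_minus_commute)
    then show "\<forall>a b. dist (y - X a) (y - X b) \<le> norm X * dist a b" by blast
  qed (use X in auto)
  then have ex1: "\<exists>!x. x + X x = y" for y
    by (metis add_diff_cancel_right' diff_add_cancel)
  then obtain Y where Y: "\<And>y. Y y + X (Y y) = y"
    by metis
  have Y': "Y y = x" if "x + X x = y" for x y
    using ex1[of y] Y[of y] that by auto
  have "bounded_linear Y"
  proof (rule bounded_linear_intro[where K = "1 / (1 - norm X)"])
    show "Y (x + y) = Y x + Y y" for x y
      using Y[of x] Y[of y] by (intro Y') (simp add: blinfun.add_right algebra_simps)
    show "Y (r *\<^sub>R x) = r *\<^sub>R Y x" for r x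
      using Y[of x] by (intro Y') (metis blinfun.scaleR_right scaleR_add_right)
    show "norm (Y x) \<le> norm x * (1 / (1 - norm X))" for x
    proof -
      have "norm (Y x) \<le> norm (Y x + X (Y x)) + norm (X (Y x))"
        by (metis add_diff_cancel_right' norm_triangle_ineq4)
      also have "\<dots> \<le> norm x + norm X * norm (Y x)"
        using Y[of x] norm_blinfun[of X "Y x"] by simp
      finally show ?thesis using X by (simp add: field_simps)
    qed
  qed
  then show ?thesis
    by (intro that[of "Blinfun Y"]) (auto simp: bounded_linear_Blinfun_apply Y Y')
qed

text \<open>
  If \<open>R\<close> is the resolvent at \<open>z\<close>, then \<open>w - T = (1 + (w - z) R) (z - T)\<close>, and the first factor is
  invertible for \<open>w\<close> close to \<open>z\<close>.
\<close>

lemma closed_op_spectrum: "closed (op_spectrum T)"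
proof -
  have "open (- op_spectrum T)"
  proof (rule openI)
    fix z assume "z \<in> - op_spectrum T"
    then obtain R where R: "is_resolvent T z R" by (auto simp: op_spectrum_def)
    have "w \<in> - op_spectrum T" if w: "dist z w < 1 / (norm R + 1)" for w
    proof -
      have pos: "0 < norm R + 1" by (simp add: add_nonneg_pos)
      have "norm (scalar_op (w - z) o\<^sub>L R) \<le> norm (w - z) * norm R"
        by (rule norm_smult_op)
      also have "\<dots> \<le> norm (w - z) * (norm R + 1)"
        by (simp add: mult_left_mono)
      also have "\<dots> < 1"
        using w pos by (simp add: field_simps dist_norm norm_minus_commute)
      finally have "norm (scalar_op (w - z) o\<^sub>L R) < 1" .
      then obtain Y :: "L2 \<Rightarrow>\<^sub>L L2" where Y: "\<And>x. Y x + scaleC_L2 (w - z) (R (Y x)) = x"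
          "\<And>x. Y (x + scaleC_L2 (w - z) (R x)) = x"
        using invertible_id_plus_small[of "scalar_op (w - z) o\<^sub>L R"] by auto
      have fact: "scaleC_L2 w f - T f = (scaleC_L2 z f - T f) + scaleC_L2 (w - z) (R (scaleC_L2 z f - T f))" for f
        using R by (simp add: is_resolvent_iff scaleC_L2_diff_left)
      have "is_resolvent T w (R o\<^sub>L Y)"
        unfolding is_resolvent_iff
      proof safe
        fix f
        show "scaleC_L2 w ((R o\<^sub>L Y) f) - T ((R o\<^sub>L Y) f) = f"
          unfolding fact using R Y(1)[of f] by (simp add: is_resolvent_iff)
        show "(R o\<^sub>L Y) (scaleC_L2 w f - T f) = f"
          unfolding fact using R Y(2)[of "scaleC_L2 z f - T f"] by (simp add: is_resolvent_iff)
      qed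
      then show ?thesis by (auto simp: op_spectrum_def)
    qed
    then show "\<exists>e>0. ball z e \<subseteq> - op_spectrum T"
      by (intro exI[of _ "1 / (norm R + 1)"]) (auto simp: add_nonneg_pos)
  qed
  then show ?thesis by (simp add: open_closed)
qed

lemma resolvent_identity:
  assumes "z \<notin> op_spectrum T" "w \<notin> op_spectrum T"
  shows "resolvent T z - resolvent T w = resolvent T z o\<^sub>L (scalar_op (w - z) o\<^sub>L resolvent T w)"
proof (rule blinfun_eqI)
  fix f
  let ?Rz = "resolvent T z" and ?Rw = "resolvent T w"
  have z: "is_resolvent T z ?Rz" and w: "is_resolvent T w ?Rw"
    using assms by (auto intro: is_resolvent_resolvent)
  have "?Rz f - ?Rw f = ?Rz (scaleC_L2 w (?Rw f) - T (?Rw f)) - ?Rz (scaleC_L2 z (?Rw f) - T (?Rw f))"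
    using z w by (simp add: is_resolvent_iff)
  also have "\<dots> = ?Rz (scaleC_L2 (w - z) (?Rw f))"
    by (simp add: scaleC_L2_diff_left flip: blinfun.diff_right)
  finally show "(?Rz - ?Rw) f = (?Rz o\<^sub>L (scalar_op (w - z) o\<^sub>L ?Rw)) f"
    by (simp add: blinfun.diff_left)
qed

text \<open>
  By the resolvent identity, resolvents near \<open>w\<close> are bounded by twice the bound at \<open>w\<close>, which makes
  the identity a Lipschitz estimate.
\<close>

lemma continuous_on_resolvent: "continuous_on (- op_spectrum T) (resolvent T)"
proof -
  have "isCont (resolvent T) w" if w: "w \<notin> op_spectrum T" for w
  proof -
    let ?R = "resolvent T"
    define M where "M = norm (?R w) + 1"
    have M: "M > 0" "norm (?R w) \<le> M" by (auto simp: M_def add_nonneg_pos)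
    have "\<forall>\<^sub>F z in at w. z \<in> - op_spectrum T"
      using w closed_op_spectrum[of T] by (intro eventually_at_in_open') auto
    moreover have "\<forall>\<^sub>F z in at w. dist z w < 1 / (2 * M)"
      using M unfolding eventually_at by (intro exI[of _ "1 / (2 * M)"]) auto
    ultimately have ev: "\<forall>\<^sub>F z in at w. norm (?R z - ?R w) \<le> 2 * M\<^sup>2 * norm (z - w)"
    proof eventually_elim
      fix z assume z: "z \<in> - op_spectrum T" and d: "dist z w < 1 / (2 * M)"
      have "?R z - ?R w = ?R z o\<^sub>L (scalar_op (w - z) o\<^sub>L ?R w)"
        using z w by (intro resolvent_identity) auto
      then have "norm (?R z - ?R w) \<le> norm (?R z) * norm (scalar_op (w - z) o\<^sub>L ?R w)"
        by (simp add: norm_blinfun_compose)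
      also have "\<dots> \<le> norm (?R z) * (norm (z - w) * M)"
      proof (intro mult_left_mono norm_ge_zero)
        have "norm (scalar_op (w - z) o\<^sub>L ?R w) \<le> norm (z - w) * norm (?R w)"
          using norm_smult_op[of "w - z" "?R w"] by (simp add: norm_minus_commute)
        also have "\<dots> \<le> norm (z - w) * M"
          using M by (intro mult_left_mono) auto
        finally show "norm (scalar_op (w - z) o\<^sub>L ?R w) \<le> norm (z - w) * M" .
      qed
      finally have 1: "norm (?R z - ?R w) \<le> norm (?R z) * (norm (z - w) * M)" .
      have "norm (z - w) * M \<le> 1 / 2"
        using d M by (simp add: dist_norm field_simps)
      then have "norm (?R z) * (norm (z - w) * M) \<le> norm (?R z) * (1/2)"
        by (intro mult_left_mono) auto
      with 1 have "norm (?R z) \<le> 2 * M"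
        using M norm_triangle_sub[of "?R z" "?R w"] by linarith
      then have "norm (?R z) * (norm (z - w) * M) \<le> 2 * M * (norm (z - w) * M)"
        using M by (intro mult_right_mono) auto
      with 1 show "norm (?R z - ?R w) \<le> 2 * M\<^sup>2 * norm (z - w)"
        by (simp add: power2_eq_square mult_ac)
    qed
    have "((\<lambda>z. 2 * M\<^sup>2 * norm (z - w)) \<longlongrightarrow> 0) (at w)"
      by (auto intro!: tendsto_eq_intros)
    from Lim_null_comparison[OF ev this] have "((\<lambda>z. ?R z - ?R w) \<longlongrightarrow> 0) (at w)" .
    then show ?thesis
      by (simp add: isCont_def LIM_zero_iff)
  qed
  then show ?thesis
    by (auto intro!: continuous_at_imp_continuous_on)
qed

lemma holomorphic_resolvent_coefficient:
  assumes T: "complex_linear T"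
  shows "(\<lambda>z. cinner (resolvent T z f) g) holomorphic_on - op_spectrum T"
proof -
  let ?R = "resolvent T"
  have op: "open (- op_spectrum T)" using closed_op_spectrum[of T] by blast
  have "((\<lambda>z. cinner (?R z f) g) has_field_derivative - cinner (?R w (?R w f)) g) (at w)"
    if w: "w \<notin> op_spectrum T" for w
  proof -
    have "isCont ?R w"
      using continuous_on_resolvent[of T] w op by (simp add: continuous_on_eq_continuous_at)
    then have "((\<lambda>z. - cinner (?R z (?R w f)) g) \<longlongrightarrow> - cinner (?R w (?R w f)) g) (at w)"
      unfolding isCont_def
      by (intro tendsto_minus bounded_linear.tendsto[OF bounded_linear_op_coefficient])
    moreover have "\<forall>\<^sub>F z in at w. - cinner (?R z (?R w f)) g
        = (cinner (?R z f) g - cinner (?R w f) g) / (z - w)"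
    proof -
      have "\<forall>\<^sub>F z in at w. z \<in> - op_spectrum T - {w}"
        using w op by (intro eventually_at_in_open) auto
      then show ?thesis
      proof eventually_elim
        fix z assume z: "z \<in> - op_spectrum T - {w}"
        then have lin: "complex_linear (?R z)"
          using resolvent_complex_linear[OF T is_resolvent_resolvent] by blast
        have "?R z f - ?R w f = (?R z - ?R w) f"
          by (simp add: blinfun.diff_left)
        also have "\<dots> = scaleC_L2 (w - z) (?R z (?R w f))"
          using lin z by (subst resolvent_identity) (auto simp: w complex_linear_def)
        finally have "cinner (?R z f) g - cinner (?R w f) g = (w - z) * cinner (?R z (?R w f)) g"
          by (metis cinner_simps(2) cinner_scaleC_left)
        then show "- cinner (?R z (?R w f)) g = (cinner (?R z f) g - cinner (?R w f) g) / (z - w)"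
          using z by (simp add: field_simps)
      qed
    qed
    ultimately show ?thesis
      unfolding has_field_derivative_iff by (rule Lim_transform_eventually)
  qed
  then show ?thesis
    using op by (auto simp: holomorphic_on_open)
qed

section \<open>Operator-valued contour integrals\<close>

lemma cinner_smult_op [simp]: "cinner ((scalar_op c o\<^sub>L T) f) g = c * cinner (blinfun_apply T f) g"
  by simp

text \<open>
  Holomorphic coefficients make integrals around triangles vanish; norm continuity then makes the
  primitive differentiable in norm.
\<close>

definition weakly_holomorphic_on :: "(complex \<Rightarrow> L2 \<Rightarrow>\<^sub>L L2) \<Rightarrow> complex set \<Rightarrow> bool" where
  "weakly_holomorphic_on G V \<longleftrightarrow>
     continuous_on V G \<and> (\<forall>f g. (\<lambda>z. cinner (blinfun_apply (G z) f) g) holomorphic_on V)"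

text \<open>
  The integrand is continuous on a compact interval, so the operator integral over a segment exists and its coefficients
  are scalar contour integrals.
\<close>

lemma op_line_integral:
  assumes G: "weakly_holomorphic_on G D" and sub: "closed_segment x y \<subseteq> D"
  defines "I \<equiv> integral {0..1} (\<lambda>t. scalar_op (y - x) o\<^sub>L G (linepath x y t))"
  shows "continuous_on {0..1} (\<lambda>t. scalar_op (y - x) o\<^sub>L G (linepath x y t))"
    and "cinner (blinfun_apply I f) g = contour_integral (linepath x y) (\<lambda>z. cinner (blinfun_apply (G z) f) g)"
proof -
  have "continuous_on {0..1} (\<lambda>t. G (linepath x y t))"
    using G sub unfolding weakly_holomorphic_on_def
    by (intro continuous_on_compose2[of D G _ "linepath x y"] continuous_on_linepath)
      (auto dest!: linepath_in_path)
  then show c: "continuous_on {0..1} (\<lambda>t. scalar_op (y - x) o\<^sub>L G (linepath x y t))"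
    by (intro bounded_bilinear.continuous_on[OF bounded_bilinear_smult_op] continuous_intros)
  have "cinner (blinfun_apply I f) g =
      integral {0..1} ((\<lambda>T. cinner (blinfun_apply T f) g) \<circ> (\<lambda>t. scalar_op (y - x) o\<^sub>L G (linepath x y t)))"
    unfolding I_def using integral_linear[OF integrable_continuous_real[OF c] bounded_linear_op_coefficient, of f g]
    by simp
  also have "\<dots> = contour_integral (linepath x y) (\<lambda>z. cinner (blinfun_apply (G z) f) g)"
    by (simp add: contour_integral_integral o_def mult.commute)
  finally show "cinner (blinfun_apply I f) g = contour_integral (linepath x y) (\<lambda>z. cinner (blinfun_apply (G z) f) g)" .
qed

text \<open>
  Integrate along segments from a base point.  Additivity around triangles may be checked on
  coefficients, where it holds since these have primitives; the derivative then comes from norm continuity.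
\<close>

lemma op_primitive_convex:
  assumes G: "weakly_holomorphic_on G D" and D: "convex D" "open D"
  shows "\<exists>P. \<forall>z\<in>D. (P has_derivative (\<lambda>h. scalar_op h o\<^sub>L G z)) (at z)"
proof (cases "D = {}")
  case False
  then obtain a where a: "a \<in> D" by blast
  define I where "I x y = integral {0..1} (\<lambda>t. scalar_op (y - x) o\<^sub>L G (linepath x y t))" for x y
  have seg: "closed_segment x y \<subseteq> D" if "x \<in> D" "y \<in> D" for x y
    using D that by (simp add: closed_segment_subset)
  have add: "I a w - I a z = I z w" if z: "z \<in> D" and w: "w \<in> D" for z w
  proof (rule op_eqI)
    fix f g
    have hol: "(\<lambda>z. cinner (G z f) g) holomorphic_on D"
      using G by (simp add: weakly_holomorphic_on_def)
    obtain H where H: "\<And>x. x \<in> D \<Longrightarrow> (H has_field_derivative cinner (G x f) g) (at x within D)"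
      using holomorphic_convex_primitive'[OF D(1,2) hol] by blast
    have I: "cinner (I x y f) g = H y - H x" if "x \<in> D" "y \<in> D" for x y
      unfolding I_def op_line_integral(2)[OF G seg[OF that]]
      using contour_integral_primitive[where S = D and g = "linepath x y", OF H] seg[OF that]
      by (intro contour_integral_unique) auto
    show "cinner ((I a w - I a z) f) g = cinner (I z w f) g"
      using a z w by (simp add: blinfun.diff_left cinner_simps I)
  qed
  have "((I a) has_derivative (\<lambda>h. scalar_op h o\<^sub>L G z)) (at z)" if z: "z \<in> D" for z
    unfolding has_derivative_at_alt
  proof (intro conjI allI impI)
    show "bounded_linear (\<lambda>h. scalar_op h o\<^sub>L G z)"
      by (rule bounded_bilinear.bounded_linear_left[OF bounded_bilinear_smult_op])
    fix e :: real assume "e > 0"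
    moreover have "isCont G z"
      using G z D by (simp add: weakly_holomorphic_on_def continuous_on_eq_continuous_at)
    ultimately obtain d1 where d1: "d1 > 0" "\<And>w. dist w z < d1 \<Longrightarrow> dist (G w) (G z) < e"
      unfolding continuous_at_eps_delta by blast
    obtain d2 where d2: "d2 > 0" "ball z d2 \<subseteq> D"
      using D z openE by blast
    have "norm (I a w - I a z - (scalar_op (w - z) o\<^sub>L G z)) \<le> e * norm (w - z)"
      if w: "norm (w - z) < min d1 d2" for w
    proof -
      have wD: "w \<in> D" using w d2 by (auto simp: dist_norm norm_minus_commute subset_iff)
      have c: "continuous_on {0..1} (\<lambda>t. scalar_op (w - z) o\<^sub>L G (linepath z w t))"
        by (rule op_line_integral(1)[OF G seg[OF z wD]])
      have "I a w - I a z - (scalar_op (w - z) o\<^sub>L G z) =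
          integral {0..1} (\<lambda>t. (scalar_op (w - z) o\<^sub>L G (linepath z w t)) - (scalar_op (w - z) o\<^sub>L G z))"
        unfolding add[OF z wD]
        using integral_diff[OF integrable_continuous_real[OF c] integrable_const_ivl, of "scalar_op (w - z) o\<^sub>L G z"]
        by (simp add: I_def)
      also have "norm \<dots> \<le> e * norm (w - z) * (1 - 0)"
      proof (rule integral_bound)
        show "continuous_on {0..1} (\<lambda>t. (scalar_op (w - z) o\<^sub>L G (linepath z w t)) - (scalar_op (w - z) o\<^sub>L G z))"
          by (intro continuous_intros c)
        fix t :: real assume t: "t \<in> {0..1}"
        have "norm (linepath z w t - z) = t * norm (w - z)"
        proof -
          have "linepath z w t - z = t *\<^sub>R (w - z)"
            by (simp add: linepath_def algebra_simps)
          then show ?thesis using t by simp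
        qed
        also have "\<dots> \<le> norm (w - z)"
          using t by (intro mult_left_le_one_le) auto
        finally have "dist (linepath z w t) z < d1"
          using w by (simp add: dist_norm)
        then have le: "norm (G (linepath z w t) - G z) \<le> e"
          using d1(2) by (simp add: dist_norm less_imp_le)
        have "norm ((scalar_op (w - z) o\<^sub>L G (linepath z w t)) - (scalar_op (w - z) o\<^sub>L G z))
            = norm (scalar_op (w - z) o\<^sub>L (G (linepath z w t) - G z))"
          by (simp add: bounded_bilinear.diff_right[OF bounded_bilinear_smult_op])
        also have "\<dots> \<le> norm (w - z) * norm (G (linepath z w t) - G z)"
          by (rule norm_smult_op)
        also have "\<dots> \<le> norm (w - z) * e"
          using le by (intro mult_left_mono) auto
        finally show "norm ((scalar_op (w - z) o\<^sub>L G (linepath z w t)) - (scalar_op (w - z) o\<^sub>L G z)) \<le> e * norm (w - z)"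
          by (simp add: mult.commute)
      qed simp
      finally show ?thesis by simp
    qed
    then show "\<exists>d>0. \<forall>y. norm (y - z) < d \<longrightarrow>
        norm (I a y - I a z - (scalar_op (y - z) o\<^sub>L G z)) \<le> e * norm (y - z)"
      using d1 d2 by (intro exI[of _ "min d1 d2"]) auto
  qed
  then show ?thesis by blast
qed auto

text \<open>
  The derivative of a valid path may be unbounded near finitely many parameters, so continuity of the
  integrand is not available.  Local primitives are: along a short piece of the path the integrand is
  a derivative off a finite set, and the gauge integral of such a function exists.
\<close>

lemma op_contour_integrable:
  assumes G: "weakly_holomorphic_on G V" and V: "open V"
    and \<gamma>: "valid_path \<gamma>" "path_image \<gamma> \<subseteq> V"
  shows "(\<lambda>t. scalar_op (vector_derivative \<gamma> (at t within {0..1})) o\<^sub>L G (\<gamma> t)) integrable_on {0..1}"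
proof -
  let ?h = "\<lambda>t. scalar_op (vector_derivative \<gamma> (at t within {0..1})) o\<^sub>L G (\<gamma> t)"
  obtain S where S: "finite S" "\<gamma> C1_differentiable_on ({0..1} - S)" and con: "continuous_on {0..1} \<gamma>"
    using \<gamma> unfolding valid_path_def piecewise_C1_differentiable_on_def by blast
  have "\<exists>d>0. \<forall>u v. x \<in> cbox u v \<and> cbox u v \<subseteq> ball x d \<and> cbox u v \<subseteq> cbox 0 1 \<longrightarrow> ?h integrable_on cbox u v"
    if x: "x \<in> {0..1}" for x
  proof -
    have "\<gamma> x \<in> V" using \<gamma> x by (auto simp: path_image_def)
    then obtain r where r: "r > 0" "ball (\<gamma> x) r \<subseteq> V" using V openE by blast
    have "weakly_holomorphic_on G (ball (\<gamma> x) r)"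
      using G r unfolding weakly_holomorphic_on_def
      by (meson continuous_on_subset holomorphic_on_subset)
    then obtain P where P: "\<And>z. z \<in> ball (\<gamma> x) r \<Longrightarrow> (P has_derivative (\<lambda>h. scalar_op h o\<^sub>L G z)) (at z)"
      using op_primitive_convex by blast
    obtain d where d: "d > 0" "\<And>t. t \<in> {0..1} \<Longrightarrow> dist t x < d \<Longrightarrow> dist (\<gamma> t) (\<gamma> x) < r"
      using con x r unfolding continuous_on_iff by blast
    have "?h integrable_on {u..v}" if uv: "u \<le> v" "{u..v} \<subseteq> ball x d" "{u..v} \<subseteq> {0..1}" for u v
    proof -
      have ball: "\<gamma> t \<in> ball (\<gamma> x) r" if "t \<in> {u..v}" for t
        using d(2)[of t] uv that by (auto simp: dist_commute subset_iff)
      have "((\<lambda>t. P (\<gamma> t)) has_vector_derivative ?h t) (at t)" if t: "t \<in> {u<..<v} - S" for t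
      proof -
        have t01: "t \<in> {0<..<1}"
        proof -
          have "0 \<le> u" "v \<le> 1" using uv t by auto
          then show ?thesis using t by auto
        qed
        then have "\<gamma> differentiable at t"
          using S t unfolding C1_differentiable_on_eq by auto
        then have "(\<gamma> has_vector_derivative vector_derivative \<gamma> (at t)) (at t)"
          by (simp add: vector_derivative_works)
        moreover have "at t within {0..1} = at t"
          using t01 by (intro at_within_interior) auto
        ultimately have "(\<gamma> has_derivative (\<lambda>h. h *\<^sub>R vector_derivative \<gamma> (at t within {0..1}))) (at t)"
          by (simp add: has_vector_derivative_def)
        from diff_chain_at[OF this P[OF ball]] t 
        have "((P \<circ> \<gamma>) has_derivative ((\<lambda>h. scalar_op h o\<^sub>L G (\<gamma> t)) \<circ> (\<lambda>h. h *\<^sub>R vector_derivative \<gamma> (at t within {0..1})))) (at t)"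
          by auto
        then show ?thesis
          by (simp add: has_vector_derivative_def o_def
              bounded_bilinear.scaleR_left[OF bounded_bilinear_smult_op])
      qed
      moreover have "continuous_on {u..v} (\<lambda>t. P (\<gamma> t))"
      proof (rule continuous_on_compose2[of "ball (\<gamma> x) r" P])
        show "continuous_on (ball (\<gamma> x) r) P"
          using P has_derivative_continuous by (blast intro: continuous_at_imp_continuous_on)
        show "continuous_on {u..v} \<gamma>" using con uv continuous_on_subset by blast
      qed (use ball in auto)
      ultimately show ?thesis
        using fundamental_theorem_of_calculus_interior_strong[OF S(1) uv(1), of "\<lambda>t. P (\<gamma> t)" ?h]
        by blast
    qed
    then show ?thesis
      using d(1) by (intro exI[of _ d]) (auto simp: cbox_interval simp del: atLeastatMost_subset_iff)
  qed
  then show ?thesis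
    using integrable_on_little_subintervals[of 0 1 ?h] by (simp add: cbox_interval)
qed

lemma cinner_op_contour_integral:
  assumes "weakly_holomorphic_on G V" "open V" "valid_path \<gamma>" "path_image \<gamma> \<subseteq> V"
  shows "cinner (op_contour_integral \<gamma> G f) g = contour_integral \<gamma> (\<lambda>z. cinner (blinfun_apply (G z) f) g)"
proof -
  let ?h = "\<lambda>t. scalar_op (vector_derivative \<gamma> (at t within {0..1})) o\<^sub>L G (\<gamma> t)"
  have "(((\<lambda>T. cinner (blinfun_apply T f) g) \<circ> ?h) has_integral cinner (integral {0..1} ?h f) g) {0..1}"
    by (rule has_integral_linear[OF integrable_integral[OF op_contour_integrable[OF assms]]
          bounded_linear_op_coefficient])
  then have "((\<lambda>z. cinner (blinfun_apply (G z) f) g) has_contour_integral cinner (integral {0..1} ?h f) g) \<gamma>"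
    by (simp add: has_contour_integral_def o_def mult.commute)
  then show ?thesis
    by (simp add: op_contour_integral_def contour_integral_unique)
qed


section \<open>Independence of the Riesz--Dunford integral of the contour\<close>

lemma cinner_sum_list: "cinner (blinfun_apply (\<Sum>x\<leftarrow>xs. T x) f) g = (\<Sum>x\<leftarrow>xs. cinner (blinfun_apply (T x) f) g)"
  by (induction xs) (simp_all add: blinfun.add_left cinner_simps)

lemma sum_list_uminus: "(\<Sum>x\<leftarrow>xs. - f x) = - (\<Sum>x\<leftarrow>xs. f x :: 'a::ab_group_add)"
  by (induction xs) simp_all

lemma weakly_holomorphic_resolvent:
  assumes "complex_linear T" "F holomorphic_on U"
  shows "weakly_holomorphic_on (\<lambda>z. scalar_op (F z) o\<^sub>L resolvent T z) (U - op_spectrum T)"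
  unfolding weakly_holomorphic_on_def
proof (intro conjI allI)
  have F: "F holomorphic_on U - op_spectrum T"
    by (rule holomorphic_on_subset[OF assms(2)]) auto
  show "continuous_on (U - op_spectrum T) (\<lambda>z. scalar_op (F z) o\<^sub>L resolvent T z)"
    using holomorphic_on_imp_continuous_on[OF F] continuous_on_subset[OF continuous_on_resolvent[of T]]
    by (intro bounded_bilinear.continuous_on[OF bounded_bilinear_smult_op]) auto
  show "(\<lambda>z. cinner ((scalar_op (F z) o\<^sub>L resolvent T z) f) g) holomorphic_on U - op_spectrum T" for f g
    unfolding cinner_smult_op
    by (intro holomorphic_on_mult F holomorphic_on_subset[OF holomorphic_resolvent_coefficient[OF assms(1)]]) auto
qed

lemma surrounds_imp_cycle_in: "surrounds \<Gamma> \<sigma> U \<Longrightarrow> cycle_in (U - \<sigma>) \<Gamma>"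
  by (auto simp: surrounds_def cycle_in_def)

lemma cinner_dunford_integral:
  assumes T: "complex_linear T" and U: "open U" and F: "F holomorphic_on U"
    and \<Gamma>: "surrounds \<Gamma> (op_spectrum T) U"
  shows "cinner (dunford_integral \<Gamma> F T f) g =
    1 / (2 * of_real pi * \<i>) * (\<Sum>\<gamma>\<leftarrow>\<Gamma>. contour_integral \<gamma> (\<lambda>z. F z * cinner (resolvent T z f) g))"
proof -
  have op: "open (U - op_spectrum T)"
    using U closed_op_spectrum by (rule open_Diff)
  have "cinner (op_contour_integral \<gamma> (\<lambda>z. scalar_op (F z) o\<^sub>L resolvent T z) f) g =
      contour_integral \<gamma> (\<lambda>z. F z * cinner (resolvent T z f) g)" if "\<gamma> \<in> set \<Gamma>" for \<gamma>
    using surrounds_imp_cycle_in[OF \<Gamma>] that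
    by (subst cinner_op_contour_integral[OF weakly_holomorphic_resolvent[OF T F] op])
       (auto simp: cycle_in_def)
  then show ?thesis
    unfolding dunford_integral_def cinner_smult_op cinner_sum_list by (simp cong: map_cong)
qed

text \<open>
  The difference of two contours surrounding the spectrum in \<open>U\<close> has winding number \<open>1 - 1\<close> about the
  spectrum and \<open>0\<close> outside \<open>U\<close>, so it is null-homologous where the coefficients of the integrand
  are holomorphic.
\<close>

lemma dunford_integral_cong_contour:
  assumes T: "complex_linear T" and U: "open U" and F: "F holomorphic_on U"
    and \<Gamma>: "surrounds \<Gamma> (op_spectrum T) U" and \<Delta>: "surrounds \<Delta> (op_spectrum T) U"
  shows "dunford_integral \<Gamma> F T = dunford_integral \<Delta> F T"
proof (rule op_eqI)
  fix f g
  let ?h = "\<lambda>z. F z * cinner (resolvent T z f) g" and ?V = "U - op_spectrum T"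
  have V: "open ?V"
    using U closed_op_spectrum by (rule open_Diff)
  have h: "?h holomorphic_on ?V"
    using weakly_holomorphic_resolvent[OF T F] by (simp add: weakly_holomorphic_on_def)
  have \<Gamma>': "cycle_in ?V \<Gamma>" and \<Delta>': "cycle_in ?V \<Delta>"
    using \<Gamma> \<Delta> by (auto intro: surrounds_imp_cycle_in)
  have rev: "map (\<lambda>\<gamma>. contour_integral (reversepath \<gamma>) ?h) \<Delta> = map (\<lambda>\<gamma>. - contour_integral \<gamma> ?h) \<Delta>"
    using \<Delta>' by (auto simp: cycle_in_def contour_integral_reversepath)
  have "(\<Sum>\<gamma>\<leftarrow>\<Gamma> @ map reversepath \<Delta>. contour_integral \<gamma> ?h) = 0"
  proof (rule Cauchy_theorem_cycle[OF V h])
    show "cycle_in ?V (\<Gamma> @ map reversepath \<Delta>)"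
      using \<Gamma>' \<Delta>' by (simp add: cycle_in_def ball_Un)
    fix z assume z: "z \<notin> ?V"
    have wn: "map (\<lambda>\<gamma>. winding_number (reversepath \<gamma>) z) \<Delta> = map (\<lambda>\<gamma>. - winding_number \<gamma> z) \<Delta>"
      using \<Delta>' z by (intro map_cong refl winding_number_reversepath)
        (auto simp: cycle_in_def valid_path_imp_path)
    have "(\<Sum>\<gamma>\<leftarrow>\<Gamma> @ map reversepath \<Delta>. winding_number \<gamma> z)
        = (\<Sum>\<gamma>\<leftarrow>\<Gamma>. winding_number \<gamma> z) - (\<Sum>\<gamma>\<leftarrow>\<Delta>. winding_number \<gamma> z)"
      by (simp add: o_def wn sum_list_uminus)
    also have "\<dots> = 0"
      using z \<Gamma> \<Delta> unfolding surrounds_def by (cases "z \<in> op_spectrum T") auto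
    finally show "(\<Sum>\<gamma>\<leftarrow>\<Gamma> @ map reversepath \<Delta>. winding_number \<gamma> z) = 0" .
  qed
  then show "cinner (dunford_integral \<Gamma> F T f) g = cinner (dunford_integral \<Delta> F T f) g"
    unfolding cinner_dunford_integral[OF T U F \<Gamma>] cinner_dunford_integral[OF T U F \<Delta>]
    by (simp add: o_def rev sum_list_uminus)
qed

text \<open>
  One surrounding contour therefore determines the functional calculus.
\<close>

theorem holomorphic_calculus_eq_dunford_integral:
  assumes "complex_linear T" "open U" "F holomorphic_on U" "surrounds \<Gamma> (op_spectrum T) U"
  shows "holomorphic_calculus U F T = dunford_integral \<Gamma> F T"
  unfolding holomorphic_calculus_def
  using dunford_integral_cong_contour[OF assms(1-3)] assms(4) by (intro the_equality) blast+

section \<open>Hausdorff operators\<close>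

lemma lborel_Fubini:
  fixes f :: "real \<Rightarrow> real \<Rightarrow> complex"
  assumes [measurable]: "(\<lambda>(x, y). f x y) \<in> borel_measurable (borel \<Otimes>\<^sub>M borel)"
    and fin: "(\<integral>\<^sup>+x. \<integral>\<^sup>+y. norm (f x y) \<partial>lborel \<partial>lborel) < \<infinity>"
  shows "(LINT x|lborel. LINT y|lborel. f x y) = (LINT y|lborel. LINT x|lborel. f x y)"
    and "integrable lborel (\<lambda>x. LINT y|lborel. f x y)"
    and "AE x in lborel. integrable lborel (f x)"
proof -
  have "(\<integral>\<^sup>+z. norm (case z of (x, y) \<Rightarrow> f x y) \<partial>(lborel \<Otimes>\<^sub>M lborel))
      = (\<integral>\<^sup>+x. \<integral>\<^sup>+y. norm (f x y) \<partial>lborel \<partial>lborel)"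
    by (subst lborel.nn_integral_fst[symmetric]) auto
  then have int: "integrable (lborel \<Otimes>\<^sub>M lborel) (case_prod f)"
    using fin by (intro integrableI_bounded) auto
  from lborel_pair.Fubini_integral[OF this]
  show "(LINT x|lborel. LINT y|lborel. f x y) = (LINT y|lborel. LINT x|lborel. f x y)" by simp
  show "integrable lborel (\<lambda>x. LINT y|lborel. f x y)" "AE x in lborel. integrable lborel (f x)"
    using lborel_pair.integrable_fst'[OF int] lborel_pair.AE_integrable_fst'[OF int] by auto
qed

lemma measurable_cnj [measurable]: "cnj \<in> borel_measurable borel"
  by (intro borel_measurable_continuous_onI continuous_intros)

lemma ennreal_le_of_square_le: "a\<^sup>2 \<le> ennreal (c\<^sup>2) \<Longrightarrow> 0 \<le> c \<Longrightarrow> a \<le> ennreal c"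
  by (cases a) (auto simp: ennreal_power ennreal_le_iff power_eq_top_ennreal top_unique intro: power2_le_imp_le)

lemma ennreal_mult_assoc: "0 \<le> a \<Longrightarrow> 0 \<le> b \<Longrightarrow> ennreal a * (ennreal b * c) = ennreal (a * b) * c"
  by (simp add: ennreal_mult mult.assoc)

lemma L2_eq_rep_abs: "sq_integrable f \<Longrightarrow> L2_eq (rep_L2 (abs_L2 f)) f"
  by (subst Quotient3_rel[OF Quotient3_L2, symmetric]) (auto simp: L2_eq_def sq_integrable_rep)

lemma abs_L2_eqI: "L2_eq f g \<Longrightarrow> abs_L2 f = abs_L2 g"
  using Quotient3_rel[OF Quotient3_L2, of f g] by blast

lemma nn_integral_norm_abs_L2:
  assumes "sq_integrable f"
  shows "(\<integral>\<^sup>+x. ennreal ((norm (f x))\<^sup>2) \<partial>lborel) = ennreal ((norm (abs_L2 f))\<^sup>2)"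
  using norm_diff_L2[OF assms sq_integrable_0] by (simp add: zero_L2_def[symmetric])

lemma abs_L2_linear:
  "sq_integrable f \<Longrightarrow> sq_integrable g \<Longrightarrow> abs_L2 (\<lambda>x. f x + g x) = abs_L2 f + abs_L2 g"
  "sq_integrable f \<Longrightarrow> abs_L2 (\<lambda>x. c * f x) = scaleC_L2 c (abs_L2 f)"
  by (simp_all add: plus_L2.abs_eq scaleC_L2.abs_eq L2_eq_def)

lemma L2_cases: obtains f' where "sq_integrable f'" "f = abs_L2 f'"
  using sq_integrable_rep abs_rep_L2 by metis

text \<open>
  Kernels may be Lebesgue measurable, which is awkward for product measures.  Each agrees almost
  everywhere with a Borel kernel, and the analysis is done for the latter.
\<close>

definition borel_kernel :: "(real \<Rightarrow> complex) \<Rightarrow> bool" where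
  "borel_kernel K \<longleftrightarrow> K \<in> borel_measurable borel \<and>
     integrable lborel (\<lambda>u. K u * of_real (\<bar>u\<bar> powr (-1/2)))"

lemma borel_kernel_measurable [measurable_dest]: "borel_kernel K \<Longrightarrow> K \<in> borel_measurable borel"
  by (simp add: borel_kernel_def)

lemma borel_kernel_imp_hausdorff_kernel: "borel_kernel K \<Longrightarrow> hausdorff_kernel K"
  unfolding borel_kernel_def hausdorff_kernel_def
  by (auto intro!: measurable_completion simp: integrable_completion)

lemma ex_borel_version_complex:
  fixes K :: "real \<Rightarrow> complex"
  assumes "K \<in> borel_measurable lebesgue"
  obtains K' where "K' \<in> borel_measurable borel" "AE u in lebesgue. K u = K' u"
proof -
  have "(\<lambda>u. Re (K u)) \<in> borel_measurable lebesgue" "(\<lambda>u. Im (K u)) \<in> borel_measurable lebesgue"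
    using assms by auto
  from this[THEN completion_ex_borel_measurable_real]
  obtain R I where "R \<in> borel_measurable lborel" "I \<in> borel_measurable lborel"
      "AE u in lborel. Re (K u) = R u" "AE u in lborel. Im (K u) = I u"
    by blast
  then show ?thesis
    by (intro that[of "\<lambda>u. Complex (R u) (I u)"] AE_completion)
       (auto simp: Complex_eq complex_eq_iff)
qed

lemma hausdorff_kernel_borel:
  assumes "hausdorff_kernel K"
  obtains K' where "borel_kernel K'" "AE u in lebesgue. K u = K' u"
proof -
  have K: "K \<in> borel_measurable lebesgue"
    using assms by (simp add: hausdorff_kernel_def)
  then obtain K' where K': "K' \<in> borel_measurable borel" "AE u in lebesgue. K u = K' u"
    by (rule ex_borel_version_complex)
  have w: "(\<lambda>u. of_real (\<bar>u\<bar> powr (-1/2)) :: complex) \<in> borel_measurable lebesgue"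
    "K' \<in> borel_measurable lebesgue"
    using K'(1) by (auto intro!: measurable_completion)
  have "integrable lebesgue (\<lambda>u. K u * of_real (\<bar>u\<bar> powr (-1/2)))"
    using assms by (simp add: hausdorff_kernel_def)
  also have "?this \<longleftrightarrow> integrable lebesgue (\<lambda>u. K' u * of_real (\<bar>u\<bar> powr (-1/2)))"
    by (intro Bochner_Integration.integrable_cong_AE borel_measurable_times K w, use K'(2) in auto)
  finally have "borel_kernel K'"
    using K'(1) by (auto simp: borel_kernel_def integrable_completion)
  with K' that show ?thesis by blast
qed

lemma hausdorff_cong_AE:
  assumes K: "K \<in> borel_measurable lebesgue" "K' \<in> borel_measurable lebesgue"
    and eq: "AE u in lebesgue. K u = K' u"
  shows "hausdorff K = hausdorff K'"
proof -
  have "(LINT u|lebesgue. K u * rep_L2 f (u * x)) = (LINT u|lebesgue. K' u * rep_L2 f (u * x))" for f x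
  proof (rule Bochner_Integration.integral_cong_AE)
    have [measurable]: "rep_L2 f \<in> borel_measurable borel"
      using sq_integrable_rep by (rule sq_integrable_measurable)
    have "(\<lambda>u. rep_L2 f (u * x)) \<in> borel_measurable lebesgue"
      by (intro measurable_completion) simp
    then show "(\<lambda>u. K u * rep_L2 f (u * x)) \<in> borel_measurable lebesgue"
      "(\<lambda>u. K' u * rep_L2 f (u * x)) \<in> borel_measurable lebesgue"
      using K by auto
  qed (use eq in auto)
  then show ?thesis by (simp add: hausdorff_def L2_operator_def)
qed

text \<open>
  The action of the operator on representatives; an honest function for every \<open>f\<close>, since a divergent
  integral has the value \<open>0\<close>.
\<close>

definition hausdorff_fun :: "(real \<Rightarrow> complex) \<Rightarrow> (real \<Rightarrow> complex) \<Rightarrow> real \<Rightarrow> complex" where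
  "hausdorff_fun K f x = (LINT u|lborel. K u * f (u * x))"

text \<open>
  The norm of \<open>K\<close> in the weighted \<open>L\<^sup>1\<close> space; it bounds the operator norm.
\<close>

definition kernel_norm :: "(real \<Rightarrow> complex) \<Rightarrow> real" where
  "kernel_norm K = (LINT u|lborel. norm (K u * of_real (\<bar>u\<bar> powr (-1/2))))"

lemma kernel_norm_nonneg: "0 \<le> kernel_norm K"
  by (simp add: kernel_norm_def)

lemma nn_integral_kernel:
  assumes "borel_kernel K"
  shows "(\<integral>\<^sup>+u. ennreal (norm (K u) * \<bar>u\<bar> powr (-1/2)) \<partial>lborel) = ennreal (kernel_norm K)"
proof -
  have "integrable lborel (\<lambda>u. norm (K u * of_real (\<bar>u\<bar> powr (-1/2))))"
    using assms unfolding borel_kernel_def by (intro integrable_norm) simp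
  from nn_integral_eq_integral[OF this] show ?thesis
    by (simp add: kernel_norm_def norm_mult)
qed

lemma nn_integral_dilate:
  assumes [measurable]: "f \<in> borel_measurable borel" and "u \<noteq> 0"
  shows "(\<integral>\<^sup>+x. f (u * x) \<partial>lborel) = ennreal (1 / \<bar>u\<bar>) * (\<integral>\<^sup>+x. f x \<partial>lborel)"
proof -
  have "(\<integral>\<^sup>+x. f x \<partial>lborel) = ennreal \<bar>u\<bar> * (\<integral>\<^sup>+x. f (u * x) \<partial>lborel)"
    using nn_integral_real_affine[OF assms, of 0] by simp
  then show ?thesis
    using assms(2) by (simp add: mult.assoc[symmetric] ennreal_mult[symmetric])
qed

lemma sq_integrable_iff_nn_integral:
  "sq_integrable f \<longleftrightarrow> f \<in> borel_measurable borel \<and> (\<integral>\<^sup>+x. ennreal ((norm (f x))\<^sup>2) \<partial>lborel) < \<infinity>"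
  by (auto simp: sq_integrable_def integrable_iff_bounded)

lemma sq_integrable_dilate:
  assumes f: "sq_integrable f" and "u \<noteq> 0"
  shows "sq_integrable (\<lambda>x. f (u * x))"
proof -
  note [measurable] = sq_integrable_measurable[OF f]
  show ?thesis
    using f nn_integral_dilate[of "\<lambda>x. ennreal ((norm (f x))\<^sup>2)", OF _ assms(2)]
    by (auto simp: sq_integrable_iff_nn_integral ennreal_mult_less_top)
qed

text \<open>
  Schur's test.  Dilation by \<open>u\<close> has norm \<open>\<bar>u\<bar> powr (-1/2)\<close> on \<open>L\<^sup>2\<close>, so the Cauchy--Schwarz
  inequality is applied to \<open>\<bar>K\<bar>\<close> split into weights \<open>\<bar>u\<bar> powr (-1/2)\<close> and \<open>\<bar>u\<bar> powr (1/2)\<close>: the first factor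
  integrates to the norm of \<open>K\<close>, the second, integrated in \<open>x\<close>, loses \<open>\<bar>u\<bar>\<close> and gives the same norm again.
\<close>

lemma hausdorff_fun_bound:
  assumes K: "borel_kernel K" and f: "sq_integrable f"
  shows "(\<integral>\<^sup>+x. (\<integral>\<^sup>+u. ennreal (norm (K u) * norm (f (u * x))) \<partial>lborel)\<^sup>2 \<partial>lborel)
     \<le> ennreal ((kernel_norm K * norm (abs_L2 f))\<^sup>2)"
proof -
  note [measurable] = borel_kernel_measurable[OF K] sq_integrable_measurable[OF f]
  let ?A = "ennreal (kernel_norm K)"
  have "(\<integral>\<^sup>+u. ennreal (norm (K u) * norm (f (u * x))) \<partial>lborel)\<^sup>2 \<le>
      ?A * (\<integral>\<^sup>+u. ennreal (norm (K u) * \<bar>u\<bar> powr (1/2) * (norm (f (u * x)))\<^sup>2) \<partial>lborel)" for x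
  proof -
    define F where "F u = sqrt (norm (K u) * \<bar>u\<bar> powr (-1/2))" for u
    define G where "G u = sqrt (norm (K u) * \<bar>u\<bar> powr (1/2)) * norm (f (u * x))" for u
    have FG: "norm (K u) * norm (f (u * x)) = F u * G u" if "u \<noteq> 0" for u
    proof -
      have "(norm (K u) * \<bar>u\<bar> powr (-1/2)) * (norm (K u) * \<bar>u\<bar> powr (1/2)) = (norm (K u))\<^sup>2"
        using that by (simp add: power2_eq_square powr_minus field_simps)
      then have "sqrt (norm (K u) * \<bar>u\<bar> powr (-1/2)) * sqrt (norm (K u) * \<bar>u\<bar> powr (1/2)) = norm (K u)"
        by (metis real_sqrt_mult real_sqrt_abs abs_norm_cancel)
      then show ?thesis by (simp add: F_def G_def mult.assoc[symmetric])
    qed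
    have "AE u in lborel. u \<noteq> (0::real)" by (rule AE_lborel_singleton)
    then have "(\<integral>\<^sup>+u. ennreal (norm (K u) * norm (f (u * x))) \<partial>lborel) =
        (\<integral>\<^sup>+u. ennreal (F u) * ennreal (G u) \<partial>lborel)"
      by (intro nn_integral_cong_AE, eventually_elim)
         (simp add: FG ennreal_mult F_def G_def)
    also have "\<dots>\<^sup>2 \<le> (\<integral>\<^sup>+u. ennreal (F u) ^ 2 \<partial>lborel) * (\<integral>\<^sup>+u. ennreal (G u) ^ 2 \<partial>lborel)"
      by (rule Cauchy_Schwarz_nn_integral) (simp_all add: F_def G_def)
    also have "(\<integral>\<^sup>+u. ennreal (F u) ^ 2 \<partial>lborel) = ?A"
      unfolding nn_integral_kernel[OF K, symmetric] by (simp add: F_def ennreal_power)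
    also have "(\<integral>\<^sup>+u. ennreal (G u) ^ 2 \<partial>lborel) =
        (\<integral>\<^sup>+u. ennreal (norm (K u) * \<bar>u\<bar> powr (1/2) * (norm (f (u * x)))\<^sup>2) \<partial>lborel)"
      by (simp add: G_def ennreal_power power_mult_distrib)
    finally show ?thesis .
  qed
  then have "(\<integral>\<^sup>+x. (\<integral>\<^sup>+u. ennreal (norm (K u) * norm (f (u * x))) \<partial>lborel)\<^sup>2 \<partial>lborel) \<le>
      (\<integral>\<^sup>+x. ?A * (\<integral>\<^sup>+u. ennreal (norm (K u) * \<bar>u\<bar> powr (1/2) * (norm (f (u * x)))\<^sup>2) \<partial>lborel) \<partial>lborel)"
    by (intro nn_integral_mono)
  also have "\<dots> = ?A * (\<integral>\<^sup>+x. \<integral>\<^sup>+u. ennreal (norm (K u) * \<bar>u\<bar> powr (1/2) * (norm (f (u * x)))\<^sup>2) \<partial>lborel \<partial>lborel)"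
    by (rule nn_integral_cmult) simp
  also have "\<dots> = ?A * (\<integral>\<^sup>+u. \<integral>\<^sup>+x. ennreal (norm (K u) * \<bar>u\<bar> powr (1/2) * (norm (f (u * x)))\<^sup>2) \<partial>lborel \<partial>lborel)"
    by (subst lborel_pair.Fubini') auto
  also have "(\<integral>\<^sup>+u. \<integral>\<^sup>+x. ennreal (norm (K u) * \<bar>u\<bar> powr (1/2) * (norm (f (u * x)))\<^sup>2) \<partial>lborel \<partial>lborel) =
      (\<integral>\<^sup>+u. ennreal (norm (K u) * \<bar>u\<bar> powr (-1/2)) * ennreal ((norm (abs_L2 f))\<^sup>2) \<partial>lborel)"
  proof (rule nn_integral_cong_AE)
    have "AE u in lborel. u \<noteq> (0::real)" by (rule AE_lborel_singleton)
    then show "AE u in lborel. (\<integral>\<^sup>+x. ennreal (norm (K u) * \<bar>u\<bar> powr (1/2) * (norm (f (u * x)))\<^sup>2) \<partial>lborel)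
        = ennreal (norm (K u) * \<bar>u\<bar> powr (-1/2)) * ennreal ((norm (abs_L2 f))\<^sup>2)"
    proof eventually_elim
      fix u :: real assume u: "u \<noteq> 0"
      have "(\<integral>\<^sup>+x. ennreal (norm (K u) * \<bar>u\<bar> powr (1/2) * (norm (f (u * x)))\<^sup>2) \<partial>lborel)
          = ennreal (norm (K u) * \<bar>u\<bar> powr (1/2)) * (\<integral>\<^sup>+x. ennreal ((norm (f (u * x)))\<^sup>2) \<partial>lborel)"
        by (subst nn_integral_cmult[symmetric]) (auto simp: ennreal_mult)
      also have "\<dots> = ennreal (norm (K u) * \<bar>u\<bar> powr (1/2)) *
          (ennreal (1 / \<bar>u\<bar>) * ennreal ((norm (abs_L2 f))\<^sup>2))"
        using nn_integral_dilate[of "\<lambda>x. ennreal ((norm (f x))\<^sup>2)", OF _ u]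
        by (simp add: nn_integral_norm_abs_L2[OF f])
      also have "\<dots> = ennreal (norm (K u) * \<bar>u\<bar> powr (1/2) * (1 / \<bar>u\<bar>)) * ennreal ((norm (abs_L2 f))\<^sup>2)"
        by (simp only: ennreal_mult_assoc mult_nonneg_nonneg norm_ge_zero powr_ge_zero zero_le_divide_1_iff abs_ge_zero)
      also have "norm (K u) * \<bar>u\<bar> powr (1/2) * (1 / \<bar>u\<bar>) = norm (K u) * \<bar>u\<bar> powr (-1/2)"
        using u powr_diff[of "\<bar>u\<bar>" "1/2" 1] by simp
      finally show "(\<integral>\<^sup>+x. ennreal (norm (K u) * \<bar>u\<bar> powr (1/2) * (norm (f (u * x)))\<^sup>2) \<partial>lborel)
        = ennreal (norm (K u) * \<bar>u\<bar> powr (-1/2)) * ennreal ((norm (abs_L2 f))\<^sup>2)" .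
    qed
  qed
  also have "\<dots> = ?A * ennreal ((norm (abs_L2 f))\<^sup>2)"
    by (subst nn_integral_multc) (auto simp: nn_integral_kernel[OF K, simplified])
  also have "?A * \<dots> = ennreal ((kernel_norm K * norm (abs_L2 f))\<^sup>2)"
    using kernel_norm_nonneg[of K]
    by (simp add: power_mult_distrib ennreal_mult power2_eq_square mult_ac)
  finally show ?thesis .
qed

lemma hausdorff_fun_integrable:
  assumes K: "borel_kernel K" and f: "sq_integrable f"
  shows "AE x in lborel. integrable lborel (\<lambda>u. K u * f (u * x))"
proof -
  note [measurable] = borel_kernel_measurable[OF K] sq_integrable_measurable[OF f]
  have "(\<integral>\<^sup>+x. (\<integral>\<^sup>+u. ennreal (norm (K u) * norm (f (u * x))) \<partial>lborel)\<^sup>2 \<partial>lborel) \<noteq> \<infinity>"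
    using hausdorff_fun_bound[OF assms] by (auto simp: top_unique)
  then have "AE x in lborel. (\<integral>\<^sup>+u. ennreal (norm (K u) * norm (f (u * x))) \<partial>lborel)\<^sup>2 \<noteq> \<infinity>"
    by (intro nn_integral_PInf_AE) auto
  then show ?thesis
  proof eventually_elim
    fix x assume "(\<integral>\<^sup>+u. ennreal (norm (K u) * norm (f (u * x))) \<partial>lborel)\<^sup>2 \<noteq> \<infinity>"
    then show "integrable lborel (\<lambda>u. K u * f (u * x))"
      by (auto simp: integrable_iff_bounded norm_mult less_top power_eq_top_ennreal)
  qed
qed

lemma hausdorff_fun_sq_integrable:
  assumes K: "borel_kernel K" and f: "sq_integrable f"
  shows "sq_integrable (hausdorff_fun K f)"
    and "norm (abs_L2 (hausdorff_fun K f)) \<le> kernel_norm K * norm (abs_L2 f)"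
proof -
  note [measurable] = borel_kernel_measurable[OF K] sq_integrable_measurable[OF f]
  have meas: "hausdorff_fun K f \<in> borel_measurable borel"
    unfolding hausdorff_fun_def by simp
  have "ennreal ((norm (hausdorff_fun K f x))\<^sup>2) \<le>
      (\<integral>\<^sup>+u. ennreal (norm (K u) * norm (f (u * x))) \<partial>lborel)\<^sup>2" for x
  proof -
    have "ennreal (norm (hausdorff_fun K f x)) \<le> (\<integral>\<^sup>+u. ennreal (norm (K u * f (u * x))) \<partial>lborel)"
      unfolding hausdorff_fun_def
      by (cases "integrable lborel (\<lambda>u. K u * f (u * x))")
         (auto simp: not_integrable_integral_eq intro!: integral_norm_bound_ennreal)
    from power_mono[OF this, of 2] show ?thesis
      by (simp add: ennreal_power norm_mult)
  qed
  then have "(\<integral>\<^sup>+x. ennreal ((norm (hausdorff_fun K f x))\<^sup>2) \<partial>lborel) \<le>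
      (\<integral>\<^sup>+x. (\<integral>\<^sup>+u. ennreal (norm (K u) * norm (f (u * x))) \<partial>lborel)\<^sup>2 \<partial>lborel)"
    by (intro nn_integral_mono)
  also note hausdorff_fun_bound[OF assms]
  finally have le: "(\<integral>\<^sup>+x. ennreal ((norm (hausdorff_fun K f x))\<^sup>2) \<partial>lborel) \<le>
      ennreal ((kernel_norm K * norm (abs_L2 f))\<^sup>2)" .
  then show sq: "sq_integrable (hausdorff_fun K f)"
    using meas by (auto simp: sq_integrable_iff_nn_integral intro: le_less_trans)
  show "norm (abs_L2 (hausdorff_fun K f)) \<le> kernel_norm K * norm (abs_L2 f)"
    using le kernel_norm_nonneg[of K] unfolding nn_integral_norm_abs_L2[OF sq]
    by (simp add: power2_le_iff_abs_le)
qed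


text \<open>
  For \<open>x \<noteq> 0\<close> the map \<open>u \<mapsto> u x\<close> preserves null sets, so the two functions differ at most at \<open>0\<close>.
\<close>

lemma hausdorff_fun_cong:
  assumes K: "borel_kernel K" and fg: "L2_eq f g"
  shows "L2_eq (hausdorff_fun K f) (hausdorff_fun K g)"
proof -
  have f: "sq_integrable f" and g: "sq_integrable g" and eq: "AE x in lborel. f x = g x"
    using fg by (auto simp: L2_eq_def)
  note [measurable] = borel_kernel_measurable[OF K] sq_integrable_measurable[OF f] sq_integrable_measurable[OF g]
  have "hausdorff_fun K f x = hausdorff_fun K g x" if "x \<noteq> 0" for x
    unfolding hausdorff_fun_def
  proof (rule Bochner_Integration.integral_cong_AE)
    have "AE u in lborel. f (0 + x * u) = g (0 + x * u)"
      by (rule AE_borel_affine[OF that _ eq]) simp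
    then show "AE u in lborel. K u * f (u * x) = K u * g (u * x)"
      by (auto simp: mult.commute)
  qed auto
  then have "AE x in lborel. hausdorff_fun K f x = hausdorff_fun K g x"
    using AE_lborel_singleton[of 0] by (auto elim: eventually_mono)
  then show ?thesis
    using f g K by (simp add: L2_eq_def hausdorff_fun_sq_integrable)
qed

lemma hausdorff_fun_add:
  assumes K: "borel_kernel K" and f: "sq_integrable f" and g: "sq_integrable g"
  shows "L2_eq (hausdorff_fun K (\<lambda>x. f x + g x)) (\<lambda>x. hausdorff_fun K f x + hausdorff_fun K g x)"
proof -
  have "AE x in lborel. hausdorff_fun K (\<lambda>x. f x + g x) x = hausdorff_fun K f x + hausdorff_fun K g x"
    using hausdorff_fun_integrable[OF K f] hausdorff_fun_integrable[OF K g]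
    by eventually_elim (simp add: hausdorff_fun_def distrib_left)
  with assms show ?thesis
    by (auto simp: L2_eq_def intro!: hausdorff_fun_sq_integrable sq_integrable_add)
qed

lemma
  assumes K: "borel_kernel K"
  shows hausdorff_abs: "\<And>f. sq_integrable f \<Longrightarrow> hausdorff K (abs_L2 f) = abs_L2 (hausdorff_fun K f)"
    and complex_linear_hausdorff: "complex_linear (hausdorff K)"
proof -
  define \<Psi> where "\<Psi> f = abs_L2 (hausdorff_fun K (rep_L2 f))" for f
  have abs: "\<Psi> (abs_L2 f) = abs_L2 (hausdorff_fun K f)" if "sq_integrable f" for f
    unfolding \<Psi>_def by (intro abs_L2_eqI hausdorff_fun_cong[OF K] L2_eq_rep_abs that)
  have scaleC: "\<Psi> (scaleC_L2 c f) = scaleC_L2 c (\<Psi> f)" for c f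
  proof -
    obtain f' where f: "sq_integrable f'" "f = abs_L2 f'" by (rule L2_cases)
    have "hausdorff_fun K (\<lambda>x. c * f' x) = (\<lambda>x. c * hausdorff_fun K f' x)"
      by (simp add: hausdorff_fun_def fun_eq_iff mult.left_commute)
    then show ?thesis
      using f K by (simp add: abs sq_integrable_mult hausdorff_fun_sq_integrable flip: abs_L2_linear(2))
  qed
  have lin: "bounded_linear \<Psi>"
  proof (rule bounded_linear_intro)
    show "\<Psi> (f + g) = \<Psi> f + \<Psi> g" for f g
    proof -
      obtain f' where f: "sq_integrable f'" "f = abs_L2 f'" by (rule L2_cases)
      obtain g' where g: "sq_integrable g'" "g = abs_L2 g'" by (rule L2_cases)
      show ?thesis
        using f g abs_L2_eqI[OF hausdorff_fun_add[OF K f(1) g(1)]] K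
        by (simp add: abs sq_integrable_add hausdorff_fun_sq_integrable flip: abs_L2_linear(1))
    qed
    show "\<Psi> (r *\<^sub>R f) = r *\<^sub>R \<Psi> f" for r f
      by (simp add: scaleR_conv_scaleC_L2 scaleC)
    show "norm (\<Psi> f) \<le> norm f * kernel_norm K" for f
      using hausdorff_fun_sq_integrable(2)[OF K sq_integrable_rep, of f]
      by (simp add: \<Psi>_def mult.commute)
  qed
  have "(LINT u|lebesgue. K u * rep_L2 f (u * x)) = hausdorff_fun K (rep_L2 f) x" for f x
  proof -
    note [measurable] = borel_kernel_measurable[OF K] sq_integrable_measurable[OF sq_integrable_rep]
    show ?thesis unfolding hausdorff_fun_def by (rule integral_completion) simp
  qed
  then have "hausdorff K = Blinfun \<Psi>"
    by (simp add: hausdorff_def L2_operator_def \<Psi>_def[abs_def])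
  with lin have app: "blinfun_apply (hausdorff K) = \<Psi>"
    by (simp add: bounded_linear_Blinfun_apply)
  show "hausdorff K (abs_L2 f) = abs_L2 (hausdorff_fun K f)" if "sq_integrable f" for f
    using that by (simp add: app abs)
  show "complex_linear (hausdorff K)"
    by (simp add: complex_linear_def app scaleC)
qed

section \<open>Matrix coefficients\<close>

text \<open>
  The coefficient of the dilation \<open>f \<mapsto> f (u \<cdot>)\<close> between \<open>f\<close> and \<open>g\<close>.
\<close>

definition dilation_coeff :: "(real \<Rightarrow> complex) \<Rightarrow> (real \<Rightarrow> complex) \<Rightarrow> real \<Rightarrow> complex" where
  "dilation_coeff f g u = (LINT x|lborel. f (u * x) * cnj (g x))"

text \<open>
  Functions that can be integrated against every kernel.  They include the coefficients of
  dilations and the powers in the Mellin transform on the line \<open>Re z = 1/2\<close>, so that statements about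
  operators and about Mellin transforms are instances of one formula.
\<close>

definition kernel_weight :: "(real \<Rightarrow> complex) \<Rightarrow> bool" where
  "kernel_weight \<phi> \<longleftrightarrow> \<phi> \<in> borel_measurable borel \<and>
     (\<exists>C. \<forall>u. u \<noteq> 0 \<longrightarrow> norm (\<phi> u) \<le> C * \<bar>u\<bar> powr (-1/2))"

lemma kernel_weightE:
  assumes "kernel_weight \<phi>"
  obtains C where "C \<ge> 0" "\<And>u. u \<noteq> 0 \<Longrightarrow> norm (\<phi> u) \<le> C * \<bar>u\<bar> powr (-1/2)"
proof -
  obtain C where C: "\<And>u. u \<noteq> 0 \<Longrightarrow> norm (\<phi> u) \<le> C * \<bar>u\<bar> powr (-1/2)"
    using assms by (auto simp: kernel_weight_def)
  from C[of 1] have "C \<ge> 0" by (simp add: order_trans[OF norm_ge_zero])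
  with C show ?thesis using that by blast
qed

lemma kernel_weight_measurable [measurable_dest]: "kernel_weight \<phi> \<Longrightarrow> \<phi> \<in> borel_measurable borel"
  by (simp add: kernel_weight_def)

lemma integrable_kernel_weight:
  assumes K: "borel_kernel K" and \<phi>: "kernel_weight \<phi>"
  shows "integrable lborel (\<lambda>u. K u * \<phi> u)"
proof -
  obtain C where C: "C \<ge> 0" "\<And>u. u \<noteq> 0 \<Longrightarrow> norm (\<phi> u) \<le> C * \<bar>u\<bar> powr (-1/2)"
    using kernel_weightE[OF \<phi>] by blast
  note [measurable] = borel_kernel_measurable[OF K] kernel_weight_measurable[OF \<phi>]
  show ?thesis
  proof (rule Bochner_Integration.integrable_bound)
    show "integrable lborel (\<lambda>u. of_real C * (K u * of_real (\<bar>u\<bar> powr (-1/2))))"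
      using K by (intro integrable_mult_right) (simp add: borel_kernel_def)
    show "AE u in lborel. norm (K u * \<phi> u) \<le> norm (of_real C * (K u * of_real (\<bar>u\<bar> powr (-1/2))))"
      using AE_lborel_singleton[of 0]
    proof eventually_elim
      fix u :: real assume "u \<noteq> 0"
      then have "norm (K u) * norm (\<phi> u) \<le> norm (K u) * (C * \<bar>u\<bar> powr (-1/2))"
        using C by (intro mult_left_mono) auto
      then show "norm (K u * \<phi> u) \<le> norm (of_real C * (K u * of_real (\<bar>u\<bar> powr (-1/2))))"
        using C by (simp add: norm_mult mult_ac)
    qed
  qed simp
qed

lemma nn_integral_dilation_coeff:
  assumes f: "sq_integrable f" and g: "sq_integrable g" and u: "u \<noteq> 0"
  shows "(\<integral>\<^sup>+x. ennreal (norm (f (u * x)) * norm (g x)) \<partial>lborel)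
    \<le> ennreal (norm (abs_L2 f) * norm (abs_L2 g) * \<bar>u\<bar> powr (-1/2))"
proof -
  note [measurable] = sq_integrable_measurable[OF f] sq_integrable_measurable[OF g]
  let ?c = "norm (abs_L2 f) * norm (abs_L2 g) * \<bar>u\<bar> powr (-1/2)"
  have pw: "(\<bar>u\<bar> powr (-1/2))\<^sup>2 = 1 / \<bar>u\<bar>"
    using u by (simp add: power2_eq_square powr_add[symmetric] powr_minus_divide)
  have "(\<integral>\<^sup>+x. ennreal (norm (f (u * x)) * norm (g x)) \<partial>lborel)\<^sup>2
      = (\<integral>\<^sup>+x. ennreal (norm (f (u * x))) * ennreal (norm (g x)) \<partial>lborel)\<^sup>2"
    by (simp add: ennreal_mult)
  also have "\<dots> \<le> (\<integral>\<^sup>+x. ennreal (norm (f (u * x))) ^ 2 \<partial>lborel) * (\<integral>\<^sup>+x. ennreal (norm (g x)) ^ 2 \<partial>lborel)"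
    by (rule Cauchy_Schwarz_nn_integral) auto
  also have "\<dots> = ennreal (1 / \<bar>u\<bar>) * ennreal ((norm (abs_L2 f))\<^sup>2) * ennreal ((norm (abs_L2 g))\<^sup>2)"
    using nn_integral_dilate[of "\<lambda>x. ennreal ((norm (f x))\<^sup>2)", OF _ u]
    by (simp add: ennreal_power nn_integral_norm_abs_L2 f g)
  also have "\<dots> = ennreal (1 / \<bar>u\<bar> * (norm (abs_L2 f))\<^sup>2 * (norm (abs_L2 g))\<^sup>2)"
    by (simp only: ennreal_mult[symmetric] zero_le_power2 zero_le_divide_1_iff abs_ge_zero mult_nonneg_nonneg)
  also have "1 / \<bar>u\<bar> * (norm (abs_L2 f))\<^sup>2 * (norm (abs_L2 g))\<^sup>2 = ?c\<^sup>2"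
    unfolding power_mult_distrib pw by (simp add: mult_ac)
  finally show ?thesis
    by (rule ennreal_le_of_square_le) simp
qed

lemma kernel_weight_dilation_coeff:
  assumes f: "sq_integrable f" and g: "sq_integrable g"
  shows "kernel_weight (dilation_coeff f g)"
proof -
  note [measurable] = sq_integrable_measurable[OF f] sq_integrable_measurable[OF g]
  have "norm (dilation_coeff f g u) \<le> norm (abs_L2 f) * norm (abs_L2 g) * \<bar>u\<bar> powr (-1/2)" if u: "u \<noteq> 0" for u
  proof -
    have "ennreal (norm (dilation_coeff f g u)) \<le> (\<integral>\<^sup>+x. ennreal (norm (f (u * x) * cnj (g x))) \<partial>lborel)"
      unfolding dilation_coeff_def
      using cinner_integral(1)[OF sq_integrable_dilate[OF f u] g] by (intro integral_norm_bound_ennreal)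
    also have "\<dots> = (\<integral>\<^sup>+x. ennreal (norm (f (u * x)) * norm (g x)) \<partial>lborel)"
      by (simp add: norm_mult)
    also note nn_integral_dilation_coeff[OF f g u]
    finally show ?thesis by (simp add: ennreal_le_iff)
  qed
  moreover have "dilation_coeff f g \<in> borel_measurable borel"
    unfolding dilation_coeff_def by simp
  ultimately show ?thesis by (auto simp: kernel_weight_def)
qed

text \<open>
  A Hausdorff operator is the superposition of dilations weighted by its kernel.
\<close>

lemma cinner_hausdorff:
  assumes K: "borel_kernel K" and f: "sq_integrable f" and g: "sq_integrable g"
  shows "cinner (hausdorff K (abs_L2 f)) (abs_L2 g) = (LINT u|lborel. K u * dilation_coeff f g u)"
proof -
  note [measurable] = borel_kernel_measurable[OF K] sq_integrable_measurable[OF f] sq_integrable_measurable[OF g]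
  let ?c = "norm (abs_L2 f) * norm (abs_L2 g)"
  have "(\<integral>\<^sup>+u. \<integral>\<^sup>+x. norm (K u * (f (u * x) * cnj (g x))) \<partial>lborel \<partial>lborel) \<le>
      (\<integral>\<^sup>+u. ennreal ?c * ennreal (norm (K u) * \<bar>u\<bar> powr (-1/2)) \<partial>lborel)"
  proof (rule nn_integral_mono_AE)
    show "AE u in lborel. (\<integral>\<^sup>+x. norm (K u * (f (u * x) * cnj (g x))) \<partial>lborel) \<le>
        ennreal ?c * ennreal (norm (K u) * \<bar>u\<bar> powr (-1/2))"
      using AE_lborel_singleton[of 0]
    proof eventually_elim
      fix u :: real assume u: "u \<noteq> 0"
      have "(\<integral>\<^sup>+x. norm (K u * (f (u * x) * cnj (g x))) \<partial>lborel) =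
          ennreal (norm (K u)) * (\<integral>\<^sup>+x. ennreal (norm (f (u * x)) * norm (g x)) \<partial>lborel)"
        by (subst nn_integral_cmult[symmetric]) (auto simp: norm_mult ennreal_mult)
      also have "\<dots> \<le> ennreal (norm (K u)) * ennreal (?c * \<bar>u\<bar> powr (-1/2))"
        by (intro mult_left_mono nn_integral_dilation_coeff f g u) auto
      also have "\<dots> = ennreal ?c * ennreal (norm (K u) * \<bar>u\<bar> powr (-1/2))"
        by (simp add: ennreal_mult mult_ac)
      finally show "(\<integral>\<^sup>+x. norm (K u * (f (u * x) * cnj (g x))) \<partial>lborel) \<le>
        ennreal ?c * ennreal (norm (K u) * \<bar>u\<bar> powr (-1/2))" .
    qed
  qed
  also have "\<dots> = ennreal ?c * ennreal (kernel_norm K)"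
    by (subst nn_integral_cmult) (auto simp: nn_integral_kernel[OF K, simplified])
  also have "\<dots> < \<infinity>"
    by (simp add: ennreal_mult_less_top)
  finally have fin: "(\<integral>\<^sup>+u. \<integral>\<^sup>+x. norm (K u * (f (u * x) * cnj (g x))) \<partial>lborel \<partial>lborel) < \<infinity>" .
  have "cinner (hausdorff K (abs_L2 f)) (abs_L2 g) = (LINT x|lborel. hausdorff_fun K f x * cnj (g x))"
    using K f g by (simp add: hausdorff_abs cinner_integral hausdorff_fun_sq_integrable)
  also have "\<dots> = (LINT x|lborel. LINT u|lborel. K u * (f (u * x) * cnj (g x)))"
    by (simp add: hausdorff_fun_def mult.assoc[symmetric])
  also have "\<dots> = (LINT u|lborel. LINT x|lborel. K u * (f (u * x) * cnj (g x)))"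
    using lborel_Fubini(1)[OF _ fin] by simp
  also have "\<dots> = (LINT u|lborel. K u * dilation_coeff f g u)"
    by (simp add: dilation_coeff_def)
  finally show ?thesis .
qed

lemma cinner_hausdorff_hausdorff:
  assumes K: "borel_kernel K" and L: "borel_kernel L" and f: "sq_integrable f" and g: "sq_integrable g"
  shows "cinner (hausdorff K (hausdorff L (abs_L2 f))) (abs_L2 g) =
    (LINT u|lborel. K u * (LINT v|lborel. L v * dilation_coeff f g (u * v)))"
proof -
  have Lf: "sq_integrable (hausdorff_fun L f)"
    by (rule hausdorff_fun_sq_integrable[OF L f])
  have Lf_coeff: "dilation_coeff (hausdorff_fun L f) g u = (LINT v|lborel. L v * dilation_coeff f g (u * v))"
    if u: "u \<noteq> 0" for u
  proof -
    have "hausdorff_fun L (\<lambda>x. f (u * x)) x = hausdorff_fun L f (u * x)" for x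
      by (simp add: hausdorff_fun_def mult.left_commute)
    then have "dilation_coeff (hausdorff_fun L f) g u = cinner (hausdorff L (abs_L2 (\<lambda>x. f (u * x)))) (abs_L2 g)"
      using L f g u by (simp add: hausdorff_abs sq_integrable_dilate cinner_integral
          hausdorff_fun_sq_integrable dilation_coeff_def)
    also have "\<dots> = (LINT v|lborel. L v * dilation_coeff f g (u * v))"
      by (subst cinner_hausdorff[OF L sq_integrable_dilate[OF f u] g])
         (simp add: dilation_coeff_def mult.assoc)
    finally show ?thesis .
  qed
  note [measurable] = borel_kernel_measurable[OF K] borel_kernel_measurable[OF L]
    kernel_weight_measurable[OF kernel_weight_dilation_coeff[OF f g]]
    kernel_weight_measurable[OF kernel_weight_dilation_coeff[OF Lf g]]
  have "cinner (hausdorff K (hausdorff L (abs_L2 f))) (abs_L2 g) =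
      (LINT u|lborel. K u * dilation_coeff (hausdorff_fun L f) g u)"
    by (simp add: hausdorff_abs[OF L f] cinner_hausdorff[OF K Lf g])
  also have "\<dots> = (LINT u|lborel. K u * (LINT v|lborel. L v * dilation_coeff f g (u * v)))"
    using AE_lborel_singleton[of 0] by (intro Bochner_Integration.integral_cong_AE) (auto simp: Lf_coeff elim: eventually_mono)
  finally show ?thesis .
qed

lemma nn_integral_double_kernel:
  assumes K: "borel_kernel K" and L: "borel_kernel L" and \<phi>: "kernel_weight \<phi>"
  shows "(\<integral>\<^sup>+u. \<integral>\<^sup>+v. norm (K u * (L v * \<phi> (u * v))) \<partial>lborel \<partial>lborel) < \<infinity>"
proof -
  obtain C where C: "C \<ge> 0" "\<And>u. u \<noteq> 0 \<Longrightarrow> norm (\<phi> u) \<le> C * \<bar>u\<bar> powr (-1/2)"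
    using kernel_weightE[OF \<phi>] by blast
  note [measurable] = borel_kernel_measurable[OF K] borel_kernel_measurable[OF L] kernel_weight_measurable[OF \<phi>]
  let ?k = "\<lambda>u. norm (K u) * \<bar>u\<bar> powr (-1/2)" and ?l = "\<lambda>v. norm (L v) * \<bar>v\<bar> powr (-1/2)"
  have "(\<integral>\<^sup>+u. \<integral>\<^sup>+v. norm (K u * (L v * \<phi> (u * v))) \<partial>lborel \<partial>lborel) \<le>
      (\<integral>\<^sup>+u. \<integral>\<^sup>+v. (ennreal C * ennreal (?k u)) * ennreal (?l v) \<partial>lborel \<partial>lborel)"
  proof (rule nn_integral_mono_AE, use AE_lborel_singleton[of "0::real"] in eventually_elim)
    fix u :: real assume u: "u \<noteq> 0"
    show "(\<integral>\<^sup>+v. norm (K u * (L v * \<phi> (u * v))) \<partial>lborel) \<le>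
      (\<integral>\<^sup>+v. (ennreal C * ennreal (?k u)) * ennreal (?l v) \<partial>lborel)"
    proof (rule nn_integral_mono_AE, use AE_lborel_singleton[of "0::real"] in eventually_elim)
      fix v :: real assume v: "v \<noteq> 0"
      have "norm (K u * (L v * \<phi> (u * v))) \<le> norm (K u) * (norm (L v) * (C * \<bar>u * v\<bar> powr (-1/2)))"
        unfolding norm_mult using C(2)[of "u * v"] u v by (intro mult_left_mono) auto
      also have "\<dots> = C * ?k u * ?l v"
        by (simp add: abs_mult powr_mult)
      finally show "ennreal (norm (K u * (L v * \<phi> (u * v)))) \<le> ennreal C * ennreal (?k u) * ennreal (?l v)"
        using C(1) by (simp add: ennreal_mult[symmetric] ennreal_leI)
    qed
  qed
  also have "\<dots> = (\<integral>\<^sup>+u. ennreal C * ennreal (?k u) * ennreal (kernel_norm L) \<partial>lborel)"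
    by (subst nn_integral_cmult) (auto simp: nn_integral_kernel[OF L, simplified])
  also have "\<dots> = ennreal C * ennreal (kernel_norm K) * ennreal (kernel_norm L)"
    by (subst nn_integral_multc, simp, subst nn_integral_cmult) (auto simp: nn_integral_kernel[OF K, simplified])
  also have "\<dots> < \<infinity>"
    by (simp add: ennreal_mult_less_top)
  finally show ?thesis .
qed

text \<open>
  The double integral of \<open>K u * L v * \<phi> (u v)\<close> is symmetric in the two kernels.
\<close>

lemma hausdorff_commute:
  assumes K: "borel_kernel K" and L: "borel_kernel L"
  shows "hausdorff K (hausdorff L f) = hausdorff L (hausdorff K f)"
proof (rule L2_eqI)
  fix g
  obtain f' where f: "sq_integrable f'" "f = abs_L2 f'" by (rule L2_cases)
  obtain g' where g: "sq_integrable g'" "g = abs_L2 g'" by (rule L2_cases)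
  let ?\<phi> = "dilation_coeff f' g'"
  have \<phi>: "kernel_weight ?\<phi>" by (rule kernel_weight_dilation_coeff[OF f(1) g(1)])
  note [measurable] = borel_kernel_measurable[OF K] borel_kernel_measurable[OF L] kernel_weight_measurable[OF \<phi>]
  have "(LINT u|lborel. K u * (LINT v|lborel. L v * ?\<phi> (u * v))) =
      (LINT u|lborel. LINT v|lborel. K u * (L v * ?\<phi> (u * v)))"
    by simp
  also have "\<dots> = (LINT v|lborel. LINT u|lborel. K u * (L v * ?\<phi> (u * v)))"
    by (rule lborel_Fubini(1)[OF _ nn_integral_double_kernel[OF K L \<phi>]]) simp
  also have "\<dots> = (LINT v|lborel. L v * (LINT u|lborel. K u * ?\<phi> (v * u)))"
    by (simp add: mult.left_commute[of "K _"] mult.commute[of _ "_ :: real"] flip: integral_mult_right_zero)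
  finally show "cinner (hausdorff K (hausdorff L f)) g = cinner (hausdorff L (hausdorff K f)) g"
    unfolding f g cinner_hausdorff_hausdorff[OF K L f(1) g(1)] cinner_hausdorff_hausdorff[OF L K f(1) g(1)] .
qed

text \<open>
  Composition is multiplicative convolution of kernels.
\<close>

lemma hausdorff_compose:
  assumes K: "borel_kernel K" and L: "borel_kernel L" and M: "borel_kernel M"
    and conv: "AE s in lborel. M s = (LINT u|lborel. K u * (L (s / u) / of_real \<bar>u\<bar>))"
  shows "hausdorff K (hausdorff L f) = hausdorff M f"
proof (rule L2_eqI)
  fix g
  obtain f' where f: "sq_integrable f'" "f = abs_L2 f'" by (rule L2_cases)
  obtain g' where g: "sq_integrable g'" "g = abs_L2 g'" by (rule L2_cases)
  let ?\<phi> = "dilation_coeff f' g'"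
  have \<phi>: "kernel_weight ?\<phi>" by (rule kernel_weight_dilation_coeff[OF f(1) g(1)])
  note [measurable] = borel_kernel_measurable[OF K] borel_kernel_measurable[OF L]
    borel_kernel_measurable[OF M] kernel_weight_measurable[OF \<phi>]
  let ?h = "\<lambda>u s. K u * (L (s / u) / of_real \<bar>u\<bar> * ?\<phi> s)"
  \<comment> \<open>the substitution \<open>s = u v\<close> in the inner integral\<close>
  have nn: "(\<integral>\<^sup>+s. norm (?h u s) \<partial>lborel) = (\<integral>\<^sup>+v. norm (K u * (L v * ?\<phi> (u * v))) \<partial>lborel)" if u: "u \<noteq> 0" for u
  proof -
    have "(\<integral>\<^sup>+s. norm (?h u s) \<partial>lborel) = ennreal \<bar>u\<bar> * (\<integral>\<^sup>+v. norm (?h u (0 + u * v)) \<partial>lborel)"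
      by (rule nn_integral_real_affine) (use u in auto)
    also have "\<dots> = (\<integral>\<^sup>+v. ennreal \<bar>u\<bar> * norm (?h u (0 + u * v)) \<partial>lborel)"
      by (rule nn_integral_cmult[symmetric]) simp
    also have "\<dots> = (\<integral>\<^sup>+v. norm (K u * (L v * ?\<phi> (u * v))) \<partial>lborel)"
      using u by (intro nn_integral_cong) (simp add: ennreal_mult[symmetric] norm_mult norm_divide)
    finally show ?thesis .
  qed
  have int: "(LINT s|lborel. ?h u s) = K u * (LINT v|lborel. L v * ?\<phi> (u * v))" if u: "u \<noteq> 0" for u
  proof -
    have "(LINT s|lborel. ?h u s) = \<bar>u\<bar> *\<^sub>R (LINT v|lborel. ?h u (0 + u * v))"
      by (rule lborel_integral_real_affine[OF u])
    also have "\<dots> = (LINT v|lborel. K u * (L v * ?\<phi> (u * v)))"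
      unfolding integral_scaleR_right[symmetric]
      using u by (intro Bochner_Integration.integral_cong) (auto simp: scaleR_conv_of_real)
    finally show ?thesis by simp
  qed
  have "(\<integral>\<^sup>+u. \<integral>\<^sup>+s. norm (?h u s) \<partial>lborel \<partial>lborel) =
      (\<integral>\<^sup>+u. \<integral>\<^sup>+v. norm (K u * (L v * ?\<phi> (u * v))) \<partial>lborel \<partial>lborel)"
    by (rule nn_integral_cong_AE, use AE_lborel_singleton[of "0::real"] in eventually_elim) (rule nn)
  with nn_integral_double_kernel[OF K L \<phi>]
  have fin: "(\<integral>\<^sup>+u. \<integral>\<^sup>+s. norm (?h u s) \<partial>lborel \<partial>lborel) < \<infinity>" by simp
  have "(LINT u|lborel. K u * (LINT v|lborel. L v * ?\<phi> (u * v))) = (LINT u|lborel. LINT s|lborel. ?h u s)"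
  proof (rule Bochner_Integration.integral_cong_AE)
    show "AE u in lborel. K u * (LINT v|lborel. L v * ?\<phi> (u * v)) = (LINT s|lborel. ?h u s)"
      using AE_lborel_singleton[of "0::real"] by eventually_elim (rule int[symmetric])
  qed simp_all
  also have "\<dots> = (LINT s|lborel. LINT u|lborel. ?h u s)"
    by (rule lborel_Fubini(1)[OF _ fin]) simp
  also have "\<dots> = (LINT s|lborel. M s * ?\<phi> s)"
  proof (rule Bochner_Integration.integral_cong_AE)
    show "AE s in lborel. (LINT u|lborel. ?h u s) = M s * ?\<phi> s"
      using conv
    proof eventually_elim
      fix s assume "M s = (LINT u|lborel. K u * (L (s / u) / of_real \<bar>u\<bar>))"
      then show "(LINT u|lborel. ?h u s) = M s * ?\<phi> s"
        by (simp only: mult.assoc[symmetric] integral_mult_left_zero)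
    qed
  qed auto
  finally show "cinner (hausdorff K (hausdorff L f)) g = cinner (hausdorff M f) g"
    unfolding f g cinner_hausdorff_hausdorff[OF K L f(1) g(1)] cinner_hausdorff[OF M f(1) g(1)] .
qed

section \<open>Power kernels\<close>

text \<open>
  Complex powers of positive reals, written so that the laws of exponents hold for all arguments and
  joint measurability in base and exponent is immediate.
\<close>

definition cpow :: "real \<Rightarrow> complex \<Rightarrow> complex" where
  "cpow u p = exp (p * of_real (ln u))"

lemma cpow_simps [simp]: "cpow u 0 = 1" "cpow 1 p = 1" "cpow u p \<noteq> 0"
  by (simp_all add: cpow_def)

lemma cpow_add: "cpow u (p + q) = cpow u p * cpow u q"
  by (simp add: cpow_def distrib_right exp_add)

lemma cpow_minus: "cpow u (- p) = 1 / cpow u p"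
  by (simp add: cpow_def exp_minus field_simps)

lemma cpow_minus_one: "u > 0 \<Longrightarrow> cpow u (p - 1) = cpow u p / of_real u"
  by (simp add: cpow_def left_diff_distrib exp_diff exp_of_real)

lemma cpow_divide: "s > 0 \<Longrightarrow> u > 0 \<Longrightarrow> cpow (s / u) p = cpow s p / cpow u p"
  by (simp add: cpow_def ln_div right_diff_distrib exp_diff)

lemma norm_cpow: "u > 0 \<Longrightarrow> norm (cpow u p) = u powr Re p"
  by (simp add: cpow_def powr_def)

lemma cpow_of_real: "u > 0 \<Longrightarrow> cpow u (of_real r) = of_real (u powr r)"
  using exp_of_real[of "r * ln u", where 'a = complex] by (simp add: cpow_def powr_def)

lemma cpow_conv_powr: "u > 0 \<Longrightarrow> cpow u p = of_real u powr p"
  by (simp add: cpow_def powr_def Ln_of_real)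

lemma measurable_cpow [measurable]:
  assumes [measurable]: "f \<in> borel_measurable M" "g \<in> borel_measurable M"
  shows "(\<lambda>x. cpow (f x) (g x)) \<in> borel_measurable M"
  unfolding cpow_def by measurable

lemma has_vector_derivative_cpow:
  assumes "u > 0" "p \<noteq> 0"
  shows "((\<lambda>u. cpow u p / p) has_vector_derivative cpow u (p - 1)) (at u)"
proof -
  have "((\<lambda>u. of_real (ln u) :: complex) has_vector_derivative of_real (1 / u)) (at u)"
    using assms(1) by (intro has_vector_derivative_of_real) (auto intro!: derivative_eq_intros)
  moreover have "((\<lambda>z. exp (p * z) / p) has_field_derivative exp (p * of_real (ln u))) (at (of_real (ln u)))"
    using assms(2) by (auto intro!: derivative_eq_intros)
  ultimately have "((\<lambda>z. exp (p * z) / p) \<circ> (\<lambda>u. of_real (ln u)) has_vector_derivative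
      of_real (1 / u) * exp (p * of_real (ln u))) (at u)"
    by (rule field_vector_diff_chain_at)
  then show ?thesis
    using assms(1) by (simp add: o_def cpow_minus_one) (simp add: cpow_def)
qed

lemma isCont_cpow: "u > 0 \<Longrightarrow> isCont (\<lambda>u. cpow u p) u"
  unfolding cpow_def by (intro continuous_intros) auto

lemma cpow_integral_interior:
  assumes "0 < c" "c \<le> d" "p \<noteq> 0"
  shows "(LINT u:{c<..<d}|lborel. cpow u (p - 1)) = cpow d p / p - cpow c p / p"
proof -
  have "(LBINT u=ereal c..ereal d. cpow u (p - 1)) = cpow d p / p - cpow c p / p"
  proof (rule interval_integral_FTC_finite)
    show "continuous_on {min c d..max c d} (\<lambda>u. cpow u (p - 1))"
      using assms by (intro continuous_at_imp_continuous_on ballI isCont_cpow) auto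
    show "((\<lambda>u. cpow u p / p) has_vector_derivative cpow u (p - 1)) (at u within {min c d..max c d})"
      if "min c d \<le> u" "u \<le> max c d" for u
      using assms that by (intro has_vector_derivative_at_within[OF has_vector_derivative_cpow]) auto
  qed
  then show ?thesis
    using assms by (simp add: interval_lebesgue_integral_def)
qed

lemma cpow_integral_einterval:
  fixes a b :: ereal
  assumes ab: "0 \<le> a" "a < b" and p: "Re p \<noteq> 0"
    and A: "(((\<lambda>u. cpow u p) \<circ> real_of_ereal) \<longlongrightarrow> A) (at_right a)"
    and B: "(((\<lambda>u. cpow u p) \<circ> real_of_ereal) \<longlongrightarrow> B) (at_left b)"
  shows "set_integrable lborel (einterval a b) (\<lambda>u. cpow u (p - 1))"
    and "(LBINT u=a..b. cpow u (p - 1)) = B / p - A / p"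
proof -
  have pos: "u > 0" if "a < ereal u" for u
    using ab(1) that by (metis ereal_less(2) order_le_less_trans)
  have ev: "\<forall>\<^sub>F x in at_right a. a < x \<and> x < b" "\<forall>\<^sub>F x in at_left b. a < x \<and> x < b"
    using eventually_at_right_real ab(2) 
    by (auto simp: eventually_at_right_field eventually_at_left_field intro: eventually_at_rightI eventually_at_leftI)
  have pos': "0 < real_of_ereal x" if "a < x \<and> x < b" for x
    using that ab(1) pos by (cases x) auto
  have real_lim: "(((\<lambda>u. u powr Re p / Re p) \<circ> real_of_ereal) \<longlongrightarrow> norm C / Re p) G"
    if "(((\<lambda>u. cpow u p) \<circ> real_of_ereal) \<longlongrightarrow> C) G" "\<forall>\<^sub>F x in G. a < x \<and> x < b" for C G
  proof -
    have "((\<lambda>x. norm (((\<lambda>u. cpow u p) \<circ> real_of_ereal) x) / Re p) \<longlongrightarrow> norm C / Re p) G"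
      using that(1) p by (intro tendsto_intros)
    then show ?thesis
      by (rule Lim_transform_eventually)
         (use that(2) in eventually_elim, use pos' in \<open>simp add: norm_cpow\<close>)
  qed
  have "set_integrable lborel (einterval a b) (\<lambda>u. u powr (Re p - 1))"
  proof (rule interval_integral_FTC_nonneg(1)[OF ab(2) _ _ _ real_lim[OF A ev(1)] real_lim[OF B ev(2)]])
    fix u assume "a < ereal u"
    then have u: "u > 0" by (rule pos)
    show "((\<lambda>u. u powr Re p / Re p) has_real_derivative u powr (Re p - 1)) (at u)"
      using u p by (auto intro!: derivative_eq_intros)
    show "isCont (\<lambda>u. u powr (Re p - 1)) u"
      using u by (intro continuous_intros) auto
  qed auto
  then show int: "set_integrable lborel (einterval a b) (\<lambda>u. cpow u (p - 1))"
    unfolding set_integrable_def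
    by (rule Bochner_Integration.integrable_bound)
       (auto simp: indicator_def einterval_def norm_cpow pos)
  have "(((\<lambda>u. cpow u p / p) \<circ> real_of_ereal) \<longlongrightarrow> A / p) (at_right a)"
    "(((\<lambda>u. cpow u p / p) \<circ> real_of_ereal) \<longlongrightarrow> B / p) (at_left b)"
    using A B p unfolding o_def by (auto intro!: tendsto_divide)
  moreover have "p \<noteq> 0" using p by auto
  ultimately show "(LBINT u=a..b. cpow u (p - 1)) = B / p - A / p"
    by (intro interval_integral_FTC_integrable[OF ab(2) _ _ int])
       (auto intro!: has_vector_derivative_cpow isCont_cpow pos)
qed

lemma cpow_integral_near_0:
  assumes "Re p > 0" "c > 0"
  shows "set_integrable lborel {0<..<c} (\<lambda>u. cpow u (p - 1))"
    and "(LINT u:{0<..<c}|lborel. cpow u (p - 1)) = cpow c p / p"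
proof -
  have "((\<lambda>u. inverse u powr - Re p) \<longlongrightarrow> 0) (at_right 0)"
    using assms(1) by (intro tendsto_neg_powr filterlim_inverse_at_top_right) auto
  moreover have "\<forall>\<^sub>F u in at_right 0. inverse u powr - Re p = norm (cpow u p)"
    by (rule eventually_mono[OF eventually_at_right_less])
       (auto simp: norm_cpow powr_minus inverse_powr)
  ultimately have "((\<lambda>u. norm (cpow u p)) \<longlongrightarrow> 0) (at_right 0)"
    by (rule Lim_transform_eventually)
  then have A: "(((\<lambda>u. cpow u p) \<circ> real_of_ereal) \<longlongrightarrow> 0) (at_right (ereal 0))"
    unfolding ereal_tendsto_simps by (rule tendsto_norm_zero_cancel)
  have B: "(((\<lambda>u. cpow u p) \<circ> real_of_ereal) \<longlongrightarrow> cpow c p) (at_left (ereal c))"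
    unfolding ereal_tendsto_simps using isCont_cpow[OF assms(2), of p]
    by (auto simp: isCont_def intro: filterlim_mono at_le)
  show "set_integrable lborel {0<..<c} (\<lambda>u. cpow u (p - 1))"
    using cpow_integral_einterval(1)[OF _ _ _ A B] assms by simp
  show "(LINT u:{0<..<c}|lborel. cpow u (p - 1)) = cpow c p / p"
    using cpow_integral_einterval(2)[OF _ _ _ A B] assms by (simp add: interval_lebesgue_integral_def)
qed

lemma cpow_integral_near_infinity:
  assumes "Re p < 0" "c > 0"
  shows "set_integrable lborel {c<..} (\<lambda>u. cpow u (p - 1))"
    and "(LINT u:{c<..}|lborel. cpow u (p - 1)) = - cpow c p / p"
proof -
  have "((\<lambda>u. u powr Re p) \<longlongrightarrow> 0) at_top"
    using assms(1) by (intro tendsto_neg_powr filterlim_ident) auto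
  moreover have "\<forall>\<^sub>F u in at_top. u powr Re p = norm (cpow u p)"
    by (rule eventually_mono[OF eventually_gt_at_top[of 0]]) (auto simp: norm_cpow)
  ultimately have "((\<lambda>u. norm (cpow u p)) \<longlongrightarrow> 0) at_top"
    by (rule Lim_transform_eventually)
  then have B: "(((\<lambda>u. cpow u p) \<circ> real_of_ereal) \<longlongrightarrow> 0) (at_left \<infinity>)"
    unfolding ereal_tendsto_simps by (rule tendsto_norm_zero_cancel)
  have A: "(((\<lambda>u. cpow u p) \<circ> real_of_ereal) \<longlongrightarrow> cpow c p) (at_right (ereal c))"
    unfolding ereal_tendsto_simps using isCont_cpow[OF assms(2), of p]
    by (auto simp: isCont_def intro: filterlim_mono at_le)
  show "set_integrable lborel {c<..} (\<lambda>u. cpow u (p - 1))"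
    using cpow_integral_einterval(1)[OF _ _ _ A B] assms by simp
  show "(LINT u:{c<..}|lborel. cpow u (p - 1)) = - cpow c p / p"
    using cpow_integral_einterval(2)[OF _ _ _ A B] assms by (simp add: interval_lebesgue_integral_def)
qed

text \<open>
  On the line \<open>Re z = 1/2\<close> the Mellin transform of \<open>power_kernel w\<close> is \<open>1 / (z - w)\<close>; which of the
  intervals \<open>(0,1)\<close> and \<open>(1,\<infinity>)\<close> carries the kernel is decided by convergence.  The value \<open>w = 0\<close> gives the indicator of \<open>(0,1)\<close>.
\<close>

definition power_kernel :: "complex \<Rightarrow> real \<Rightarrow> complex" where
  "power_kernel w u =
     (if Re w < 1/2 then (if 0 < u \<and> u < 1 then cpow u (-w) else 0)
      else (if 1 < u then - cpow u (-w) else 0))"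

lemma measurable_power_kernel [measurable]:
  assumes [measurable]: "f \<in> borel_measurable M" "g \<in> borel_measurable M"
  shows "(\<lambda>x. power_kernel (f x) (g x)) \<in> borel_measurable M"
  unfolding power_kernel_def by measurable

lemma power_kernel_neg: "u \<le> 0 \<Longrightarrow> power_kernel w u = 0"
  by (simp add: power_kernel_def)

lemma norm_power_kernel:
  "norm (power_kernel w u) = (if Re w < 1/2 then (if 0 < u \<and> u < 1 then u powr (- Re w) else 0)
      else (if 1 < u then u powr (- Re w) else 0))"
  by (simp add: power_kernel_def norm_cpow)

lemma
  assumes "Re w \<noteq> 1/2" "Re z = 1/2"
  shows integrable_power_kernel: "integrable lborel (\<lambda>u. power_kernel w u * cpow u (z - 1))"
    and mellin_power_kernel: "(LINT u|lborel. power_kernel w u * cpow u (z - 1)) = 1 / (z - w)"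
proof -
  have *: "cpow u (- w) * cpow u (z - 1) = cpow u ((z - w) - 1)" for u
    by (simp add: algebra_simps flip: cpow_add)
  have "integrable lborel (\<lambda>u. power_kernel w u * cpow u (z - 1)) \<and>
      (LINT u|lborel. power_kernel w u * cpow u (z - 1)) = 1 / (z - w)"
  proof (cases "Re w < 1/2")
    case True
    have "(\<lambda>u. power_kernel w u * cpow u (z - 1)) = (\<lambda>u. indicator {0<..<1} u *\<^sub>R cpow u ((z - w) - 1))"
      using True by (auto simp: fun_eq_iff power_kernel_def indicator_def *)
    then show ?thesis
      using cpow_integral_near_0[of "z - w" 1] True assms
      by (simp add: set_integrable_def set_lebesgue_integral_def)
  next
    case False
    have "(\<lambda>u. power_kernel w u * cpow u (z - 1)) = (\<lambda>u. - (indicator {1<..} u *\<^sub>R cpow u ((z - w) - 1)))"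
      using False by (auto simp: fun_eq_iff power_kernel_def indicator_def *)
    then show ?thesis
      using cpow_integral_near_infinity[of "z - w" 1] False assms
      by (simp add: set_integrable_def set_lebesgue_integral_def)
  qed
  then show "integrable lborel (\<lambda>u. power_kernel w u * cpow u (z - 1))"
    "(LINT u|lborel. power_kernel w u * cpow u (z - 1)) = 1 / (z - w)" by auto
qed

lemma borel_kernel_power_kernel:
  assumes "Re w \<noteq> 1/2"
  shows "borel_kernel (power_kernel w)"
  unfolding borel_kernel_def
proof
  have eq: "power_kernel w u * cpow u (1/2 - 1) = power_kernel w u * of_real (\<bar>u\<bar> powr (-1/2))" for u
    using cpow_of_real[of u "-1/2"] by (cases "u > 0") (simp_all add: power_kernel_neg)
  show "integrable lborel (\<lambda>u. power_kernel w u * of_real (\<bar>u\<bar> powr (-1/2)))"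
    unfolding eq[symmetric] using assms by (intro integrable_power_kernel) simp_all
qed (use measurable_power_kernel[of "\<lambda>_. w" borel "\<lambda>u. u"] in simp)

text \<open>
  In terms of Mellin transforms this is the partial fraction
  \<open>(1 / z) * (1 / (z - w)) = (1 / (z - w) - 1 / z) / w\<close>.  The point \<open>s = 1\<close> is a jump of the power kernels.
\<close>

lemma power_kernel_convolution:
  assumes w: "Re w \<noteq> 1/2" "w \<noteq> 0" and s: "s \<noteq> 0" "s \<noteq> 1"
  shows "(LINT u|lborel. power_kernel 0 u * (power_kernel w (s / u) / of_real \<bar>u\<bar>))
    = (power_kernel w s - power_kernel 0 s) / w"
proof (cases "s > 0")
  case False
  have "power_kernel 0 u * (power_kernel w (s / u) / of_real \<bar>u\<bar>) = 0" for u
    using False by (cases "u > 0") (auto simp: power_kernel_neg divide_nonpos_pos)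
  then have "(\<lambda>u. power_kernel 0 u * (power_kernel w (s / u) / of_real \<bar>u\<bar>)) = (\<lambda>u. 0)" by blast
  with False show ?thesis by (simp only: power_kernel_neg) simp
next
  case pos: True
  have cp: "cpow (s / u) (- w) / of_real u = cpow s (- w) * cpow u (w - 1)" if "u > 0" for u
    using that pos by (simp add: cpow_divide cpow_minus cpow_minus_one)
  show ?thesis
  proof (cases "Re w < 1/2")
    case True
    show ?thesis
    proof (cases "s < 1")
      case s1: True
      have "(LINT u|lborel. power_kernel 0 u * (power_kernel w (s / u) / of_real \<bar>u\<bar>)) =
          (LINT u:{s<..<1}|lborel. cpow s (- w) * cpow u (w - 1))"
        unfolding set_lebesgue_integral_def
      proof (rule Bochner_Integration.integral_cong)
        fix u :: real
        show "power_kernel 0 u * (power_kernel w (s / u) / of_real \<bar>u\<bar>) =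
            indicator {s<..<1} u *\<^sub>R (cpow s (- w) * cpow u (w - 1))"
          using True pos s1 cp[of u] by (auto simp: power_kernel_def indicator_def field_simps)
      qed simp
      also have "\<dots> = cpow s (- w) * (1 / w - cpow s w / w)"
        using cpow_integral_interior[of s 1 w] pos s1 w by simp
      also have "\<dots> = (power_kernel w s - power_kernel 0 s) / w"
        using True pos s1 by (simp add: power_kernel_def cpow_minus right_diff_distrib diff_divide_distrib)
      finally show ?thesis .
    next
      case s1: False
      have "power_kernel 0 u * (power_kernel w (s / u) / of_real \<bar>u\<bar>) = 0" for u
        using True s1 by (auto simp: power_kernel_def divide_less_eq_1_pos)
      then have "(\<lambda>u. power_kernel 0 u * (power_kernel w (s / u) / of_real \<bar>u\<bar>)) = (\<lambda>u. 0)" by blast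
      moreover have "power_kernel w s = 0" "power_kernel 0 s = 0"
        using True s1 by (simp_all add: power_kernel_def)
      ultimately show ?thesis by simp
    qed
  next
    case False
    let ?m = "min 1 s"
    have "(LINT u|lborel. power_kernel 0 u * (power_kernel w (s / u) / of_real \<bar>u\<bar>)) =
        (LINT u:{0<..<?m}|lborel. - cpow s (- w) * cpow u (w - 1))"
      unfolding set_lebesgue_integral_def
    proof (rule Bochner_Integration.integral_cong)
      fix u :: real
      show "power_kernel 0 u * (power_kernel w (s / u) / of_real \<bar>u\<bar>) =
          indicator {0<..<?m} u *\<^sub>R (- cpow s (- w) * cpow u (w - 1))"
      proof (cases "0 < u \<and> u < 1")
        case True
        with False pos cp[of u] show ?thesis
          by (auto simp: power_kernel_def less_divide_eq_1_pos)
      qed (auto simp: power_kernel_def)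
    qed simp
    also have "\<dots> = - cpow s (- w) * (cpow ?m w / w)"
      using cpow_integral_near_0(2)[of w ?m] pos False by (subst set_integral_mult_right) simp
    also have "\<dots> = (power_kernel w s - power_kernel 0 s) / w"
      using False pos s by (cases "s < 1") (auto simp: power_kernel_def cpow_minus)
    finally show ?thesis .
  qed
qed

section \<open>The resolvent of the Cesaro operator\<close>

text \<open>
  The substitution \<open>t = u x\<close>.  The orientation of the interval integral makes it valid for \<open>x < 0\<close> too, and
  \<open>x = 0\<close> is a null set.
\<close>

lemma cesaro_eq_hausdorff: "cesaro = hausdorff (power_kernel 0)"
proof -
  have K: "borel_kernel (power_kernel 0)"
    by (rule borel_kernel_power_kernel) simp
  have formula: "(LBINT t=ereal 0..ereal x. f t) / of_real x = hausdorff_fun (power_kernel 0) f x"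
    if x: "x \<noteq> 0" for f :: "real \<Rightarrow> complex" and x
  proof -
    have *: "(LINT t:S|lborel. f t) = of_real \<bar>x\<bar> * hausdorff_fun (power_kernel 0) f x"
      if S: "\<And>u. u * x \<in> S \<longleftrightarrow> 0 < u \<and> u < 1" for S
      unfolding set_lebesgue_integral_def hausdorff_fun_def
      by (subst lborel_integral_real_affine[OF x, of _ 0])
         (auto simp: S indicator_def power_kernel_def scaleR_conv_of_real mult.commute
           intro!: arg_cong[of _ _ "\<lambda>y. _ * y"] Bochner_Integration.integral_cong)
    show ?thesis
    proof (cases "x > 0")
      case True
      have "(LINT t:{0<..<x}|lborel. f t) = of_real \<bar>x\<bar> * hausdorff_fun (power_kernel 0) f x"
        using True by (intro *) (auto simp: zero_less_mult_iff)
      then show ?thesis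
        using True by (simp add: interval_lebesgue_integral_def)
    next
      case False
      have "(LINT t:{x<..<0}|lborel. f t) = of_real \<bar>x\<bar> * hausdorff_fun (power_kernel 0) f x"
        using False x by (intro *) (auto simp: mult_less_0_iff)
      then show ?thesis
        using False x by (simp add: interval_lebesgue_integral_def)
    qed
  qed
  have "abs_L2 (\<lambda>x. (LBINT t=ereal 0..ereal x. rep_L2 f t) / of_real x) =
      abs_L2 (hausdorff_fun (power_kernel 0) (rep_L2 f))" (is "abs_L2 ?c = abs_L2 ?h") for f
  proof (rule abs_L2_eqI)
    have sq: "sq_integrable ?h"
      by (rule hausdorff_fun_sq_integrable[OF K sq_integrable_rep])
    have c: "?c = (\<lambda>x. if x = 0 then 0 else ?h x)"
    proof (rule ext)
      show "?c x = (if x = 0 then 0 else ?h x)" for x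
        using formula[of x "rep_L2 f"] by (cases "x = 0") simp_all
    qed
    define h where "h = ?h"
    have h: "sq_integrable h" and [measurable]: "h \<in> borel_measurable borel"
      using sq by (simp_all add: h_def sq_integrable_measurable)
    have ae: "AE x in lborel. (if x = 0 then 0 else h x) = h x"
      using AE_lborel_singleton[of "0::real"] by eventually_elim simp
    have "integrable lborel (\<lambda>x. (norm (if x = 0 then 0 else h x))\<^sup>2) \<longleftrightarrow> integrable lborel (\<lambda>x. (norm (h x))\<^sup>2)"
    proof (rule Bochner_Integration.integrable_cong_AE)
      show "AE x in lborel. (norm (if x = 0 then 0 else h x))\<^sup>2 = (norm (h x))\<^sup>2"
        using ae by eventually_elim simp
    qed measurable
    then have "sq_integrable (\<lambda>x. if x = 0 then 0 else h x)"
      using h by (simp add: sq_integrable_def)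
    with h ae show "L2_eq ?c ?h"
      unfolding c L2_eq_def h_def[symmetric] by blast
  qed
  moreover have "(LINT u|lebesgue. power_kernel 0 u * rep_L2 f (u * x)) = hausdorff_fun (power_kernel 0) (rep_L2 f) x" for f x
  proof -
    note [measurable] = sq_integrable_measurable[OF sq_integrable_rep]
    show ?thesis unfolding hausdorff_fun_def by (rule integral_completion) simp
  qed
  ultimately show ?thesis
    by (simp add: cesaro_def hausdorff_def L2_operator_def)
qed

lemma complex_linear_cesaro: "complex_linear cesaro"
  unfolding cesaro_eq_hausdorff by (intro complex_linear_hausdorff borel_kernel_power_kernel) simp

lemma cesaro_power_kernel:
  assumes w: "Re w \<noteq> 1/2" "w \<noteq> 0"
  shows "cesaro (hausdorff (power_kernel w) f) = scaleC_L2 (1 / w) (hausdorff (power_kernel w) f - cesaro f)"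
proof -
  define M where "M u = (power_kernel w u - power_kernel 0 u) / w" for u
  have Kw: "borel_kernel (power_kernel w)" and K0: "borel_kernel (power_kernel 0)"
    using w by (auto intro: borel_kernel_power_kernel)
  have "integrable lborel (\<lambda>u. (power_kernel w u * of_real (\<bar>u\<bar> powr (-1/2)) - power_kernel 0 u * of_real (\<bar>u\<bar> powr (-1/2))) / w)"
    using Kw K0 unfolding borel_kernel_def
    by (intro integrable_divide_zero Bochner_Integration.integrable_diff) auto
  then have M: "borel_kernel M"
    unfolding borel_kernel_def M_def by (simp add: left_diff_distrib)
  have "AE s in lborel. s \<noteq> 0 \<and> s \<noteq> (1::real)"
    using AE_lborel_singleton[of 0] AE_lborel_singleton[of 1] by eventually_elim simp
  then have "AE s in lborel. M s = (LINT u|lborel. power_kernel 0 u * (power_kernel w (s / u) / of_real \<bar>u\<bar>))"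
    by eventually_elim (subst power_kernel_convolution[OF w], simp_all add: M_def)
  from hausdorff_compose[OF K0 Kw M this]
  have "cesaro (hausdorff (power_kernel w) f) = hausdorff M f"
    by (simp add: cesaro_eq_hausdorff)
  also have "\<dots> = scaleC_L2 (1 / w) (hausdorff (power_kernel w) f - hausdorff (power_kernel 0) f)"
  proof (rule L2_eqI)
    fix g
    obtain f' where f: "sq_integrable f'" "f = abs_L2 f'" by (rule L2_cases)
    obtain g' where g: "sq_integrable g'" "g = abs_L2 g'" by (rule L2_cases)
    note \<phi> = kernel_weight_dilation_coeff[OF f(1) g(1)]
    have "(LINT u|lborel. M u * dilation_coeff f' g' u) =
      (LINT u|lborel. (power_kernel w u * dilation_coeff f' g' u - power_kernel 0 u * dilation_coeff f' g' u) / w)"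
      by (simp add: M_def left_diff_distrib)
    also have "\<dots> = ((LINT u|lborel. power_kernel w u * dilation_coeff f' g' u) -
        (LINT u|lborel. power_kernel 0 u * dilation_coeff f' g' u)) / w"
      using integrable_kernel_weight[OF Kw \<phi>] integrable_kernel_weight[OF K0 \<phi>] by simp
    finally show "cinner (hausdorff M f) g =
        cinner (scaleC_L2 (1 / w) (hausdorff (power_kernel w) f - hausdorff (power_kernel 0) f)) g"
      by (simp add: f g cinner_hausdorff M Kw K0 cinner_simps)
  qed
  finally show ?thesis by (simp add: cesaro_eq_hausdorff)
qed

text \<open>
  Inversion maps the unit circle about \<open>1\<close> to the line \<open>Re w = 1/2\<close>.
\<close>

lemma Re_inverse_half_iff:
  assumes "z \<noteq> 0"
  shows "norm (z - 1) < 1 \<longleftrightarrow> 1/2 < Re (1 / z)" "1 < norm (z - 1) \<longleftrightarrow> Re (1 / z) < 1/2"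
proof -
  define S where "S = (Re z)\<^sup>2 + (Im z)\<^sup>2"
  have S: "S > 0"
    using assms complex_neq_0[of z] by (simp add: S_def)
  have n: "(norm (z - 1))\<^sup>2 = S - 2 * Re z + 1"
    unfolding cmod_power2 S_def by (simp add: power2_eq_square algebra_simps)
  have r: "Re (1 / z) = Re z / S"
    by (simp add: Re_divide S_def)
  have "norm (z - 1) < 1 \<longleftrightarrow> (norm (z - 1))\<^sup>2 < 1"
    using abs_square_less_1[of "norm (z - 1)"] by simp
  also have "\<dots> \<longleftrightarrow> 1/2 * S < Re z"
    unfolding n by linarith
  also have "\<dots> \<longleftrightarrow> 1/2 < Re (1 / z)"
    unfolding r by (rule pos_less_divide_eq[OF S, symmetric])
  finally show "norm (z - 1) < 1 \<longleftrightarrow> 1/2 < Re (1 / z)" .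
  have "1 < norm (z - 1) \<longleftrightarrow> \<not> (norm (z - 1))\<^sup>2 \<le> 1"
    using abs_square_le_1[of "norm (z - 1)"] by auto
  also have "\<dots> \<longleftrightarrow> Re z < 1/2 * S"
    unfolding n by linarith
  also have "\<dots> \<longleftrightarrow> Re (1 / z) < 1/2"
    unfolding r by (rule pos_divide_less_eq[OF S, symmetric])
  finally show "1 < norm (z - 1) \<longleftrightarrow> Re (1 / z) < 1/2" .
qed

text \<open>
  Expanding the products leaves exactly the relation \<open>cesaro_power_kernel\<close> at \<open>w = 1 / z\<close>, and its
  mirror image, which holds because Hausdorff operators commute.
\<close>

lemma is_resolvent_cesaro:
  assumes z: "z \<noteq> 0" "norm (z - 1) \<noteq> 1"
  shows "is_resolvent cesaro z
    (scalar_op (1 / z) + (scalar_op (1 / z\<^sup>2) o\<^sub>L hausdorff (power_kernel (1 / z))))"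
proof -
  let ?H = "hausdorff (power_kernel (1 / z))"
  have w: "Re (1 / z) \<noteq> 1/2" "1 / z \<noteq> 0"
    using Re_inverse_half_iff[OF z(1)] z by auto
  have C: "cesaro (scaleC_L2 c f) = scaleC_L2 c (cesaro f)" "?H (scaleC_L2 c f) = scaleC_L2 c (?H f)" for c f
    using complex_linear_cesaro complex_linear_hausdorff[OF borel_kernel_power_kernel[OF w(1)]]
    by (auto simp: complex_linear_def)
  have CH: "cesaro (?H f) = scaleC_L2 z (?H f) - scaleC_L2 z (cesaro f)" for f
    using cesaro_power_kernel[OF w, of f] by (simp add: scaleC_L2_linear_right)
  have HC: "?H (cesaro f) = scaleC_L2 z (?H f) - scaleC_L2 z (cesaro f)" for f
    using CH[of f] hausdorff_commute[OF borel_kernel_power_kernel[OF w(1)] borel_kernel_power_kernel, of 0 f]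
    by (simp add: cesaro_eq_hausdorff)
  have zz: "z / z\<^sup>2 = 1 / z"
    using z by (auto simp: power2_eq_square)
  show ?thesis
    unfolding is_resolvent_iff using z
    by (simp add: blinfun.add_left blinfun.add_right blinfun.diff_right C CH HC scaleC_L2_linear_right zz)
qed

text \<open>
  Off the circle, which passes through \<open>0\<close>, the explicit resolvent is available.
\<close>

lemma op_spectrum_cesaro: "op_spectrum cesaro \<subseteq> sphere 1 1"
proof
  fix z assume z: "z \<in> op_spectrum cesaro"
  show "z \<in> sphere 1 1"
  proof (cases "z = 0")
    case False
    have "norm (z - 1) = 1"
    proof (rule ccontr)
      assume "norm (z - 1) \<noteq> 1"
      from is_resolvent_cesaro[OF False this] z show False
        unfolding op_spectrum_def by blast
    qed
    then show ?thesis by (simp add: dist_norm norm_minus_commute)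
  qed simp
qed

lemma resolvent_cesaro:
  assumes "z \<noteq> 0" "norm (z - 1) \<noteq> 1"
  shows "resolvent cesaro z = scalar_op (1 / z) + (scalar_op (1 / z\<^sup>2) o\<^sub>L hausdorff (power_kernel (1 / z)))"
  by (rule resolvent_eq[OF is_resolvent_cesaro[OF assms]])

section \<open>Injectivity of the Mellin transform\<close>

text \<open>
  The positive and negative parts of \<open>r\<close> have equal mass (\<open>t = 0\<close>).  Unless the mass vanishes, normalise
  them to probability densities and push these forward by \<open>ln\<close>: the images have equal characteristic
  functions, hence coincide by Levy's theorem, and pulling back by \<open>exp\<close> shows that the two parts agree.
\<close>

lemma real_log_Fourier_injective:
  fixes r :: "real \<Rightarrow> real"
  assumes r: "integrable lborel r" and supp: "\<And>u. u \<le> 0 \<Longrightarrow> r u = 0"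
    and zero: "\<And>t. (LINT u|lborel. of_real (r u) * iexp (t * ln u)) = 0"
  shows "AE u in lborel. r u = 0"
proof -
  define rp where "rp u = max (r u) 0" for u
  define rn where "rn u = max (- r u) 0" for u
  have [measurable]: "r \<in> borel_measurable borel"
    using borel_measurable_integrable[OF r] by simp
  have meas [measurable]: "rp \<in> borel_measurable borel" "rn \<in> borel_measurable borel"
    unfolding rp_def rn_def by measurable
  have int: "integrable lborel rp" "integrable lborel rn"
    unfolding rp_def rn_def using r by auto
  have diff: "r u = rp u - rn u" and nonneg: "0 \<le> rp u" "0 \<le> rn u" for u
    by (auto simp: rp_def rn_def)
  have iexp: "integrable lborel (\<lambda>u. of_real (q u) * iexp (t * ln u))" if "integrable lborel q" for t and q :: "real \<Rightarrow> real"
    by (rule Bochner_Integration.integrable_bound[OF integrable_norm[OF that]])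
       (use borel_measurable_integrable[OF that] in \<open>auto simp: norm_mult\<close>)
  have eq: "(LINT u|lborel. of_real (rp u) * iexp (t * ln u)) = (LINT u|lborel. of_real (rn u) * iexp (t * ln u))" for t
    using zero[of t] iexp[OF int(1), of t] iexp[OF int(2), of t]
    by (simp add: diff left_diff_distrib)
  define m where "m = (LINT u|lborel. rp u)"
  have mn: "m = (LINT u|lborel. rn u)"
  proof -
    have "complex_of_real (LINT u|lborel. rp u) = of_real (LINT u|lborel. rn u)"
      using eq[of 0] by (simp add: integral_complex_of_real)
    then show ?thesis by (simp add: m_def)
  qed
  show ?thesis
  proof (cases "m = 0")
    case True
    then have "AE u in lborel. rp u = 0" "AE u in lborel. rn u = 0"
      using integral_nonneg_eq_0_iff_AE[OF int(1)] integral_nonneg_eq_0_iff_AE[OF int(2)] nonneg mn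
      by (auto simp: m_def)
    then show ?thesis by eventually_elim (simp add: diff)
  next
    case False
    then have m: "m > 0"
      using nonneg by (simp add: m_def order_less_le)
    define P where "P q = density lborel (\<lambda>u. ennreal (q u / m))" for q :: "real \<Rightarrow> real"
    have P: "real_distribution (distr (P q) borel ln)"
      "char (distr (P q) borel ln) t = (LINT u|lborel. of_real (q u) * iexp (t * ln u)) / m"
      "distr (distr (P q) borel ln) borel exp = P q"
      if q: "integrable lborel q" "\<And>u. 0 \<le> q u" "(LINT u|lborel. q u) = m" "\<And>u. u \<le> 0 \<Longrightarrow> q u = 0" for q t
    proof -
      have [measurable]: "q \<in> borel_measurable borel"
        using borel_measurable_integrable[OF q(1)] by simp
      have "emeasure (P q) (space (P q)) = (\<integral>\<^sup>+u. ennreal (q u / m) \<partial>lborel)"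
        by (simp add: P_def emeasure_density)
      also have "\<dots> = ennreal (LINT u|lborel. q u / m)"
        using q m by (intro nn_integral_eq_integral) auto
      also have "\<dots> = 1"
        using q m by simp
      finally interpret P: prob_space "P q" by (rule prob_spaceI)
      have [measurable_cong]: "sets (P q) = sets borel" by (simp add: P_def)
      show "real_distribution (distr (P q) borel ln)"
        by (intro real_distribution.intro P.prob_space_distr real_distribution_axioms.intro) auto
      show "char (distr (P q) borel ln) t = (LINT u|lborel. of_real (q u) * iexp (t * ln u)) / m"
      proof -
        have "char (distr (P q) borel ln) t = (LINT u|P q. iexp (t * ln u))"
          unfolding char_def by (subst integral_distr) auto
        also have "\<dots> = (LINT u|lborel. (q u / m) *\<^sub>R iexp (t * ln u))"
          unfolding P_def using q m by (subst integral_density) auto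
        also have "\<dots> = (LINT u|lborel. of_real (q u) * iexp (t * ln u) / m)"
          by (simp add: scaleR_conv_of_real)
        finally show ?thesis by simp
      qed
      show "distr (distr (P q) borel ln) borel exp = P q"
      proof -
        have "AE u in P q. u > 0"
        proof -
          have "u > 0" if "0 < ennreal (q u / m)" for u
            using q(4)[of u] that by (cases "u \<le> 0") auto
          then have "AE u in lborel. 0 < ennreal (q u / m) \<longrightarrow> u > 0" by (intro AE_I2) blast
          then show ?thesis unfolding P_def by (subst AE_density) simp_all
        qed
        then have "AE u in P q. (exp \<circ> ln) u = u" by eventually_elim simp
        then have "distr (P q) borel (exp \<circ> ln) = distr (P q) borel (\<lambda>u. u)"
          by (intro distr_cong_AE) auto
        then show ?thesis
          by (simp add: distr_distr distr_id2 P_def)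
      qed
    qed
    have rp: "integrable lborel rp" "\<And>u. 0 \<le> rp u" "(LINT u|lborel. rp u) = m" "\<And>u. u \<le> 0 \<Longrightarrow> rp u = 0"
      and rn: "integrable lborel rn" "\<And>u. 0 \<le> rn u" "(LINT u|lborel. rn u) = m" "\<And>u. u \<le> 0 \<Longrightarrow> rn u = 0"
      using int nonneg mn[symmetric] supp by (simp_all add: m_def[symmetric]) (simp_all add: rp_def rn_def)
    have "distr (P rp) borel ln = distr (P rn) borel ln"
      using P(1)[OF rp] P(1)[OF rn]
    proof (rule Levy_uniqueness)
      show "char (distr (P rp) borel ln) = char (distr (P rn) borel ln)"
        by (rule ext) (simp only: P(2)[OF rp] P(2)[OF rn] eq)
    qed
    then have "P rp = P rn"
      using P(3)[OF rp, symmetric] P(3)[OF rn] by simp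
    then have "AE u in lborel. ennreal (rp u / m) = ennreal (rn u / m)"
      unfolding P_def by (intro sigma_finite_measure.density_unique[OF sigma_finite_lborel]) auto
    then show ?thesis
      using m nonneg by (auto elim!: eventually_mono simp: diff)
  qed
qed

text \<open>
  The Mellin transform over the positive half-line, written so that on the line \<open>Re z = 1/2\<close> it is
  an integral against a kernel weight.
\<close>

definition borel_mellin :: "(real \<Rightarrow> complex) \<Rightarrow> complex \<Rightarrow> complex" where
  "borel_mellin K z = (LINT u|lborel. K u * (if u > 0 then cpow u (z - 1) else 0))"

lemma kernel_weight_cpow:
  assumes "Re z = 1/2"
  shows "kernel_weight (\<lambda>u. if u > 0 then cpow u (z - 1) else 0)"
proof -
  have "norm (cpow u (z - 1)) = u powr (-1/2)" if "u > 0" for u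
    by (simp add: norm_cpow assms that)
  then show ?thesis
    unfolding kernel_weight_def by (auto intro!: exI[of _ 1])
qed

text \<open>
  The real and imaginary parts of \<open>J u * u powr (-1/2)\<close> satisfy the previous lemma: conjugation reflects
  \<open>t\<close>, so vanishing for all \<open>t\<close> passes to each of them.
\<close>

lemma borel_mellin_injective:
  assumes J: "borel_kernel J" and zero: "\<And>z. Re z = 1/2 \<Longrightarrow> borel_mellin J z = 0"
  shows "AE u in lborel. u > 0 \<longrightarrow> J u = 0"
proof -
  note [measurable] = borel_kernel_measurable[OF J]
  define q where "q u = (if u > 0 then J u * of_real (u powr (-1/2)) else 0)" for u
  have q_cpow: "q u * iexp (t * ln u) = J u * (if u > 0 then cpow u (Complex (1/2) t - 1) else 0)" for u t
  proof (cases "u > 0")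
    case True
    have "Complex (1/2) t - 1 = of_real (-1/2) + \<i> * of_real t"
      by (simp add: complex_eq_iff)
    then have "cpow u (Complex (1/2) t - 1) = of_real (u powr (-1/2)) * iexp (t * ln u)"
      using cpow_of_real[OF True, of "-1/2"] by (simp only: cpow_add) (simp add: cpow_def mult_ac)
    with True show ?thesis by (simp add: q_def)
  qed (simp add: q_def)
  have q: "integrable lborel q"
    unfolding q_def
    by (rule Bochner_Integration.integrable_bound[of _ "\<lambda>u. J u * of_real (\<bar>u\<bar> powr (-1/2))"])
       (use J in \<open>auto simp: borel_kernel_def norm_mult\<close>)
  have iexp: "integrable lborel (\<lambda>u. h u * iexp (t * ln u))" if "integrable lborel h" for t and h :: "real \<Rightarrow> complex"
    by (rule Bochner_Integration.integrable_bound[OF integrable_norm[OF that]])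
       (use borel_measurable_integrable[OF that] in \<open>auto simp: norm_mult\<close>)
  have cq: "integrable lborel (\<lambda>u. cnj (q u))"
    using q by simp
  have q0: "(LINT u|lborel. q u * iexp (t * ln u)) = 0" for t
    unfolding q_cpow using zero[of "Complex (1/2) t"] by (simp add: borel_mellin_def)
  have cq0: "(LINT u|lborel. cnj (q u) * iexp (t * ln u)) = 0" for t
  proof -
    have "(LINT u|lborel. cnj (q u) * iexp (t * ln u)) = (LINT u|lborel. cnj (q u * iexp ((- t) * ln u)))"
      by (intro Bochner_Integration.integral_cong) (auto simp: exp_cnj)
    also have "\<dots> = cnj (LINT u|lborel. q u * iexp ((- t) * ln u))"
      by (rule Bochner_Integration.integral_cnj)
    finally show ?thesis using q0[of "- t"] by simp
  qed
  have "AE u in lborel. Re (q u) = 0"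
  proof (rule real_log_Fourier_injective)
    show "(LINT u|lborel. of_real (Re (q u)) * iexp (t * ln u)) = 0" for t
    proof -
      have e: "of_real (Re (q u)) = (q u + cnj (q u)) / 2" for u
        by (simp add: complex_eq_iff)
      have "(LINT u|lborel. of_real (Re (q u)) * iexp (t * ln u)) =
          (LINT u|lborel. (q u * iexp (t * ln u) + cnj (q u) * iexp (t * ln u)) / 2)"
        by (intro Bochner_Integration.integral_cong refl) (simp only: e, simp add: distrib_right)
      then show ?thesis
        using iexp[OF q, of t] iexp[OF cq, of t] q0[of t] cq0[of t] by simp
    qed
    show "integrable lborel (\<lambda>u. Re (q u))" using q by simp
  qed (simp add: q_def)
  moreover have "AE u in lborel. Im (q u) = 0"
  proof (rule real_log_Fourier_injective)
    show "(LINT u|lborel. of_real (Im (q u)) * iexp (t * ln u)) = 0" for t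
    proof -
      have e: "of_real (Im (q u)) = (q u - cnj (q u)) / (2 * \<i>)" for u
        by (simp add: complex_eq_iff)
      have "(LINT u|lborel. of_real (Im (q u)) * iexp (t * ln u)) =
          (LINT u|lborel. (q u * iexp (t * ln u) - cnj (q u) * iexp (t * ln u)) / (2 * \<i>))"
        by (intro Bochner_Integration.integral_cong refl) (simp only: e, simp add: left_diff_distrib)
      then show ?thesis
        using iexp[OF q, of t] iexp[OF cq, of t] q0[of t] cq0[of t] by simp
    qed
    show "integrable lborel (\<lambda>u. Im (q u))" using q by simp
  qed (simp add: q_def)
  ultimately show ?thesis
    by eventually_elim (auto simp: q_def complex_eq_iff[of _ 0])
qed

text \<open>
  Multiplying \<open>J\<close> by \<open>u powr \<i>\<close> shifts the Mellin transform along the line and leaves a constant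
  unchanged.  Hence \<open>J * (u powr \<i> - 1)\<close> has transform \<open>0\<close> and vanishes; the second factor is zero
  only for \<open>ln u\<close> in \<open>2 * pi * \<int>\<close>, a null set.
\<close>

lemma borel_mellin_constant:
  assumes J: "borel_kernel J" and const: "\<And>z. Re z = 1/2 \<Longrightarrow> borel_mellin J z = c"
  shows "c = 0" and "AE u in lborel. u > 0 \<longrightarrow> J u = 0"
proof -
  note [measurable] = borel_kernel_measurable[OF J]
  define L where "L u = J u * (cpow u \<i> - 1) * indicator {0<..} u" for u
  have L: "borel_kernel L"
    unfolding borel_kernel_def
  proof
    show "integrable lborel (\<lambda>u. L u * of_real (\<bar>u\<bar> powr (-1/2)))"
    proof (rule Bochner_Integration.integrable_bound)
      show "integrable lborel (\<lambda>u. 2 * (J u * of_real (\<bar>u\<bar> powr (-1/2))))"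
        using J by (intro integrable_mult_right) (simp add: borel_kernel_def)
      have "norm (L u) \<le> 2 * norm (J u)" for u
      proof (cases "u > 0")
        case True
        have "norm (cpow u \<i> - 1) \<le> norm (cpow u \<i>) + norm (1 :: complex)" by (rule norm_triangle_ineq4)
        also have "\<dots> = 2" using True by (simp add: norm_cpow)
        finally have "norm (J u) * norm (cpow u \<i> - 1) \<le> norm (J u) * 2"
          by (rule mult_left_mono) simp
        then show ?thesis using True by (simp add: L_def norm_mult)
      qed (simp add: L_def)
      then show "AE u in lborel. norm (L u * of_real (\<bar>u\<bar> powr (-1/2))) \<le> norm (2 * (J u * of_real (\<bar>u\<bar> powr (-1/2))))"
        by (auto simp: norm_mult mult.assoc[symmetric] intro!: AE_I2 mult_right_mono)
    qed (simp add: L_def)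
  qed (simp add: L_def[abs_def])
  have "borel_mellin L z = 0" if z: "Re z = 1/2" for z
  proof -
    let ?w = "\<lambda>z u. if u > 0 then cpow u (z - 1) else 0"
    have "L u * ?w z u = J u * ?w (z + \<i>) u - J u * ?w z u" for u
    proof (cases "u > 0")
      case True
      have "cpow u (z + \<i> - 1) = cpow u (z - 1) * cpow u \<i>"
        by (simp add: algebra_simps flip: cpow_add)
      with True show ?thesis by (simp add: L_def algebra_simps)
    qed (simp add: L_def)
    then have "borel_mellin L z = (LINT u|lborel. J u * ?w (z + \<i>) u - J u * ?w z u)"
      by (simp only: borel_mellin_def)
    also have "\<dots> = borel_mellin J (z + \<i>) - borel_mellin J z"
      unfolding borel_mellin_def using z
      by (intro Bochner_Integration.integral_diff integrable_kernel_weight[OF J] kernel_weight_cpow) auto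
    also have "\<dots> = 0" using z by (simp add: const)
    finally show ?thesis .
  qed
  from borel_mellin_injective[OF L this]
  have L0: "AE u in lborel. u > 0 \<longrightarrow> L u = 0" .
  have "countable (range (\<lambda>n::int. exp (2 * of_int n * pi)))" by simp
  then have "AE u in lborel. u \<notin> range (\<lambda>n::int. exp (2 * of_int n * pi))"
    by (intro AE_not_in countable_imp_null_set_lborel)
  with L0 show J0: "AE u in lborel. u > 0 \<longrightarrow> J u = 0"
  proof eventually_elim
    fix u :: real
    assume *: "u > 0 \<longrightarrow> L u = 0" "u \<notin> range (\<lambda>n::int. exp (2 * of_int n * pi))"
    show "u > 0 \<longrightarrow> J u = 0"
    proof
      assume u: "u > 0"
      have "cpow u \<i> \<noteq> 1"
      proof
        assume "cpow u \<i> = 1"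
        then have "exp (\<i> * of_real (ln u)) = 1" by (simp add: cpow_def)
        then obtain n :: int where "ln u = 2 * of_int n * pi"
          unfolding exp_eq_1 by auto
        then have "u = exp (2 * of_int n * pi)" using u by (metis exp_ln)
        with * show False by blast
      qed
      with * u show "J u = 0" by (auto simp: L_def)
    qed
  qed
  have "borel_mellin J (1/2) = (LINT u|(lborel :: real measure). 0)"
    unfolding borel_mellin_def
  proof (rule Bochner_Integration.integral_cong_AE)
    show "AE u in lborel. J u * (if u > 0 then cpow u (1/2 - 1) else 0) = 0"
      using J0 by eventually_elim auto
  qed simp_all
  then show "c = 0" using const[of "1/2"] by simp
qed

section \<open>Uniqueness of the kernel\<close>

lemma sq_integrable_indicator:
  assumes [measurable]: "S \<in> sets borel" and "S \<subseteq> {a..b}"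
  shows "sq_integrable (indicator S)"
proof -
  have "emeasure lborel S \<le> emeasure lborel {a..b}"
    by (rule emeasure_mono) (use assms in auto)
  also have "\<dots> < \<infinity>" by (simp add: emeasure_lborel_Icc_eq)
  finally have "integrable lborel (indicator S :: real \<Rightarrow> real)" by simp
  moreover have "(norm (indicator S x :: complex))\<^sup>2 = indicator S x" for x
    by (simp add: indicator_def)
  ultimately show ?thesis by (simp add: sq_integrable_def)
qed

text \<open>
  The Mellin transform in \<open>b\<close> of \<open>min b (1/u)\<close>, taken at \<open>z - 1\<close>; the factor \<open>1 / z + 1 / (1 - z) = 1 / (z (1 - z))\<close>
  never vanishes.
\<close>

lemma min_power_integral:
  assumes u: "u > 0" and z: "0 < Re z" "Re z < 1"
  defines "g \<equiv> \<lambda>b. if b > 0 then cpow b (z - 2) * of_real (min b (1 / u)) else 0"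
  shows "integrable lborel g" and "(LINT b|lborel. g b) = (1 / z + 1 / (1 - z)) * cpow u (- z)"
proof -
  let ?A = "\<lambda>b. indicator {0<..<1/u} b *\<^sub>R cpow b (z - 1)"
  let ?B = "\<lambda>b. of_real (1 / u) * (indicator {1/u<..} b *\<^sub>R cpow b ((z - 1) - 1))"
  have split: "g b = ?A b + ?B b" if b: "b \<noteq> 1 / u" for b
  proof -
    have e: "z - 2 = (z - 1) - 1" by simp
    have c2: "cpow b (z - 2) = cpow b (z - 1) / of_real b" if "b > 0"
      using cpow_minus_one[OF that, of "z - 1"] by simp
    consider "b \<le> 0" | "0 < b" "b < 1 / u" | "1 / u < b" using b by linarith
    then show ?thesis
    proof cases
      case 2
      then show ?thesis
        unfolding g_def by (simp add: c2)
    next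
      case 3
      have "0 < 1 / u" using u by simp
      with 3 have "0 < b" by linarith
      with 3 show ?thesis unfolding g_def e by simp
    next
      case 1
      have "0 < 1 / u" using u by simp
      with 1 have "\<not> 1 / u < b" by linarith
      with 1 show ?thesis unfolding g_def by simp
    qed
  qed
  have A: "integrable lborel ?A" "(LINT b|lborel. ?A b) = cpow (1 / u) z / z"
    using cpow_integral_near_0[of z "1 / u"] u z
    by (simp_all add: set_integrable_def set_lebesgue_integral_def)
  have "Re (z - 1) < 0" "1 / u > 0" using u z by simp_all
  note inf = cpow_integral_near_infinity[OF this, unfolded set_integrable_def set_lebesgue_integral_def]
  have B: "integrable lborel ?B" "(LINT b|lborel. ?B b) = of_real (1 / u) * (- cpow (1 / u) (z - 1) / (z - 1))"
    using inf(1) by (rule integrable_mult_right) (simp only: integral_mult_right_zero inf(2))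
  have [measurable]: "g \<in> borel_measurable borel"
    unfolding g_def by measurable
  have ae: "AE b in lborel. ?A b + ?B b = g b"
    using AE_lborel_singleton[of "1 / u"] by eventually_elim (rule split[symmetric])
  have AB: "integrable lborel (\<lambda>b. ?A b + ?B b)"
    by (rule Bochner_Integration.integrable_add[OF A(1) B(1)])
  have mAB: "(\<lambda>b. ?A b + ?B b) \<in> borel_measurable lborel"
    using AB by (rule borel_measurable_integrable)
  show "integrable lborel g"
    using AB integrable_cong_AE[OF mAB _ ae] by simp
  have "(LINT b|lborel. g b) = (LINT b|lborel. ?A b + ?B b)"
    using Bochner_Integration.integral_cong_AE[OF mAB _ ae] by simp
  also have "\<dots> = cpow (1 / u) z / z + of_real (1 / u) * (- cpow (1 / u) (z - 1) / (z - 1))"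
    unfolding Bochner_Integration.integral_add[OF A(1) B(1)] A(2) B(2) ..
  also have "of_real (1 / u) * (- cpow (1 / u) (z - 1) / (z - 1)) = cpow (1 / u) z / (1 - z)"
  proof -
    have "of_real (1 / u) * cpow (1 / u) (z - 1) = cpow (1 / u) z"
      using u by (subst cpow_minus_one) auto
    moreover have "- x / (z - 1) = x / (1 - z)" for x
      by (metis minus_diff_eq minus_divide_divide minus_minus)
    ultimately show ?thesis by (simp only: times_divide_eq_right mult_minus_right)
  qed
  also have "cpow (1 / u) z = cpow u (- z)"
    using u by (simp add: cpow_divide cpow_minus)
  finally show "(LINT b|lborel. g b) = (1 / z + 1 / (1 - z)) * cpow u (- z)"
    by (simp add: distrib_right)
qed

text \<open>
  Integrating the moments against powers of \<open>b\<close> turns them into a nonzero multiple of the Mellin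
  transform of \<open>J\<close>.
\<close>

lemma kernel_zero_of_min_moments:
  assumes J: "borel_kernel J"
    and zero: "\<And>b. b > 0 \<Longrightarrow> (LINT u|lborel. J u * (if u > 0 then of_real (min b (1 / u)) else 0)) = 0"
  shows "AE u in lborel. u > 0 \<longrightarrow> J u = 0"
proof (rule borel_mellin_injective[OF J])
  fix z0 :: complex assume z0: "Re z0 = 1/2"
  define z where "z = 1 - z0"
  have z: "Re z = 1/2" using z0 by (simp add: z_def)
  note [measurable] = borel_kernel_measurable[OF J]
  let ?g = "\<lambda>z u b. if b > 0 then cpow b (z - 2) * of_real (min b (1 / u)) else 0"
  define c where "c = 1 / z + 1 / (1 - z)"
  have zne: "z \<noteq> 0" "z \<noteq> 1" using z by auto
  have "c = 1 / (z * (1 - z))" using zne by (simp add: c_def field_simps)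
  then have c: "c \<noteq> 0" using zne by simp
  let ?f = "\<lambda>u b. if u > 0 then J u * ?g z u b else 0"
  have nn: "(\<integral>\<^sup>+b. norm (?f u b) \<partial>lborel) \<le> ennreal 4 * ennreal (norm (J u) * \<bar>u\<bar> powr (-1/2))" for u
  proof (cases "u > 0")
    case u: True
    have half: "0 < Re (1/2 :: complex)" "Re (1/2 :: complex) < 1" by simp_all
    have norm: "?g (1/2) u b = of_real (norm (?g z u b))" for b
    proof (cases "b > 0")
      case True
      have "cpow b (1/2 - 2) = of_real (b powr (-3/2))"
        using cpow_of_real[OF True, of "-3/2"] by simp
      with True u show ?thesis by (simp add: norm_mult norm_cpow z)
    qed simp
    have int: "integrable lborel (\<lambda>b. norm (?g z u b))"
      using min_power_integral(1)[OF u, of z] z by (intro integrable_norm) auto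
    have "complex_of_real (LINT b|lborel. norm (?g z u b)) = (LINT b|lborel. ?g (1/2) u b)"
      unfolding norm by (rule integral_complex_of_real[symmetric])
    also have "\<dots> = 4 * cpow u (- (1/2))"
      unfolding min_power_integral(2)[OF u half] by simp
    also have "\<dots> = of_real (4 * u powr (-1/2))"
      using cpow_of_real[OF u, of "-1/2"] by simp
    finally have "(LINT b|lborel. norm (?g z u b)) = 4 * u powr (-1/2)"
      by (simp only: of_real_eq_iff)
    then have g: "(\<integral>\<^sup>+b. norm (?g z u b) \<partial>lborel) = ennreal (4 * u powr (-1/2))"
      using nn_integral_eq_integral[OF int] by simp
    have "(\<integral>\<^sup>+b. norm (?f u b) \<partial>lborel) = ennreal (norm (J u)) * (\<integral>\<^sup>+b. norm (?g z u b) \<partial>lborel)"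
      using u by (subst nn_integral_cmult[symmetric]) (auto simp: norm_mult ennreal_mult intro!: nn_integral_cong)
    also have "\<dots> = ennreal 4 * ennreal (norm (J u) * \<bar>u\<bar> powr (-1/2))"
      unfolding g using u by (simp only: ennreal_mult[symmetric] norm_ge_zero mult_nonneg_nonneg
          powr_ge_zero zero_le_numeral abs_of_pos mult_ac)
    finally show ?thesis by simp
  qed simp
  have "(\<integral>\<^sup>+u. \<integral>\<^sup>+b. norm (?f u b) \<partial>lborel \<partial>lborel) \<le>
      (\<integral>\<^sup>+u. ennreal 4 * ennreal (norm (J u) * \<bar>u\<bar> powr (-1/2)) \<partial>lborel)"
    by (intro nn_integral_mono nn)
  also have "\<dots> = ennreal 4 * ennreal (kernel_norm J)"
    unfolding nn_integral_kernel[OF J, symmetric] by (rule nn_integral_cmult) simp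
  also have "\<dots> < \<infinity>" by (simp add: ennreal_mult_less_top)
  finally have fin: "(\<integral>\<^sup>+u. \<integral>\<^sup>+b. norm (?f u b) \<partial>lborel \<partial>lborel) < \<infinity>" .
  have "c * borel_mellin J z0 = (LINT u|lborel. c * (J u * (if u > 0 then cpow u (z0 - 1) else 0)))"
    unfolding borel_mellin_def by (rule integral_mult_right_zero[symmetric])
  also have "\<dots> = (LINT u|lborel. LINT b|lborel. ?f u b)"
  proof (intro Bochner_Integration.integral_cong refl)
    fix u :: real
    show "c * (J u * (if u > 0 then cpow u (z0 - 1) else 0)) = (LINT b|lborel. ?f u b)"
    proof (cases "u > 0")
      case u: True
      have "(LINT b|lborel. ?f u b) = J u * (LINT b|lborel. ?g z u b)"
        using u by (simp only: if_True integral_mult_right_zero)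
      also have "(LINT b|lborel. ?g z u b) = c * cpow u (- z)"
        unfolding c_def by (rule min_power_integral(2)[OF u]) (simp_all add: z)
      also have "- z = z0 - 1" by (simp add: z_def)
      finally have "(LINT b|lborel. ?f u b) = J u * (c * cpow u (z0 - 1))" .
      then show ?thesis using u by (simp only: if_True mult.left_commute[of c])
    qed simp
  qed
  also have "\<dots> = (LINT b|lborel. LINT u|lborel. ?f u b)"
    by (rule lborel_Fubini(1)[OF _ fin]) measurable
  also have "\<dots> = (LINT b|(lborel :: real measure). 0)"
  proof (intro Bochner_Integration.integral_cong refl)
    fix b :: real
    show "(LINT u|lborel. ?f u b) = 0"
    proof (cases "b > 0")
      case True
      have "(LINT u|lborel. ?f u b) =
          (LINT u|lborel. cpow b (z - 2) * (J u * (if u > 0 then of_real (min b (1 / u)) else 0)))"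
        using True by (intro Bochner_Integration.integral_cong refl) auto
      also have "\<dots> = cpow b (z - 2) * (LINT u|lborel. J u * (if u > 0 then of_real (min b (1 / u)) else 0))"
        by (rule integral_mult_right_zero)
      finally show ?thesis using zero[OF True] by simp
    qed (simp cong: if_cong)
  qed
  finally show "borel_mellin J z0 = 0" using c by simp
qed

lemma borel_kernel_diff:
  assumes "borel_kernel K" "borel_kernel L"
  shows "borel_kernel (\<lambda>u. K u - L u)"
proof -
  have "integrable lborel (\<lambda>u. K u * of_real (\<bar>u\<bar> powr (-1/2)) - L u * of_real (\<bar>u\<bar> powr (-1/2)))"
    using assms unfolding borel_kernel_def by (intro Bochner_Integration.integrable_diff) auto
  then show ?thesis
    using assms unfolding borel_kernel_def
    by (auto simp: left_diff_distrib intro: borel_measurable_diff)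
qed

lemma borel_kernel_reflect:
  assumes "borel_kernel K"
  shows "borel_kernel (\<lambda>u. K (- u))"
proof -
  note [measurable] = borel_kernel_measurable[OF assms]
  have "integrable lborel (\<lambda>u. K (0 + (-1) * u) * of_real (\<bar>0 + (-1) * u\<bar> powr (-1/2)))"
    using assms unfolding borel_kernel_def
    by (intro lborel_integrable_real_affine[of "\<lambda>u. K u * of_real (\<bar>u\<bar> powr (-1/2))"]) auto
  then show ?thesis by (simp add: borel_kernel_def)
qed

text \<open>
  Indicators of intervals at \<open>0\<close> have the dilation coefficients \<open>min b (1/u)\<close>.  If \<open>g\<close> is supported on the
  positive axis they see the kernel for \<open>u > 0\<close>, if \<open>g\<close> is reflected, for \<open>u < 0\<close>.
\<close>

theorem hausdorff_injective:
  assumes K: "borel_kernel K" and L: "borel_kernel L" and eq: "hausdorff K = hausdorff L"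
  shows "AE u in lborel. K u = L u"
proof -
  define J where "J u = K u - L u" for u
  have J: "borel_kernel J" unfolding J_def by (rule borel_kernel_diff[OF K L])
  note [measurable] = borel_kernel_measurable[OF J]
  have J0: "(LINT u|lborel. J u * dilation_coeff f g u) = 0" if f: "sq_integrable f" and g: "sq_integrable g" for f g
    using cinner_hausdorff[OF K f g] cinner_hausdorff[OF L f g] eq
      integrable_kernel_weight[OF K kernel_weight_dilation_coeff[OF f g]]
      integrable_kernel_weight[OF L kernel_weight_dilation_coeff[OF f g]]
    by (simp add: J_def left_diff_distrib)
  define f :: "real \<Rightarrow> complex" where "f = indicator {0<..1}"
  define g :: "real \<Rightarrow> real \<Rightarrow> complex" where "g b = indicator {0<..b}" for b
  have f: "sq_integrable f" and g: "sq_integrable (g b)" for b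
    by (auto simp: f_def g_def intro: sq_integrable_indicator[of _ 0 1] sq_integrable_indicator[of _ 0 b])
  have g': "sq_integrable (\<lambda>x. g b (- x))" for b
    using sq_integrable_dilate[OF g[of b], of "-1"] by simp
  have coeff: "dilation_coeff f (g b) u = (if u > 0 then of_real (min b (1 / u)) else 0)" if b: "b > 0" for b u
  proof (cases "u > 0")
    case True
    have "f (u * x) * cnj (g b x) = indicator {0<..min b (1 / u)} x *\<^sub>R 1" for x
      using True by (auto simp: f_def g_def indicator_def field_simps zero_less_mult_iff)
    then have "dilation_coeff f (g b) u = of_real (measure lborel {0<..min b (1 / u)})"
      by (simp only: dilation_coeff_def) (simp add: scaleR_conv_of_real)
    then show ?thesis using b True by simp
  next
    case False
    have "f (u * x) * cnj (g b x) = 0" for x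
      using False by (auto simp: f_def g_def indicator_def zero_less_mult_iff)
    then have "dilation_coeff f (g b) u = (LINT x|(lborel :: real measure). 0)"
      by (simp only: dilation_coeff_def)
    with False show ?thesis by simp
  qed
  have coeff': "dilation_coeff f (\<lambda>x. g b (- x)) u = dilation_coeff f (g b) (- u)" for b u
    unfolding dilation_coeff_def by (subst lborel_integral_real_affine[of "-1" _ 0]) simp_all
  have "AE u in lborel. u > 0 \<longrightarrow> J u = 0"
  proof (rule kernel_zero_of_min_moments[OF J])
    fix b :: real assume b: "b > 0"
    show "(LINT u|lborel. J u * (if u > 0 then of_real (min b (1 / u)) else 0)) = 0"
      using J0[OF f g, of b] by (simp only: coeff[OF b])
  qed
  moreover have "AE u in lborel. u > 0 \<longrightarrow> J (- u) = 0"
  proof (rule kernel_zero_of_min_moments[OF borel_kernel_reflect[OF J]])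
    fix b :: real assume b: "b > 0"
    have "(LINT u|lborel. J (- u) * dilation_coeff f (g b) u) = (LINT u|lborel. J u * dilation_coeff f (\<lambda>x. g b (- x)) u)"
      unfolding coeff' by (subst lborel_integral_real_affine[of "-1" _ 0]) simp_all
    also have "\<dots> = 0" by (rule J0[OF f g'])
    finally show "(LINT u|lborel. J (- u) * (if u > 0 then of_real (min b (1 / u)) else 0)) = 0"
      by (simp only: coeff[OF b])
  qed
  then have "AE u in lborel. 0 + (-1) * u > 0 \<longrightarrow> J (- (0 + (-1) * u)) = 0"
    by (intro AE_borel_affine[of "-1" "\<lambda>u. u > 0 \<longrightarrow> J (- u) = 0" 0]) simp_all
  moreover note AE_lborel_singleton[of "0::real"]
  ultimately show ?thesis
    by eventually_elim (auto simp: J_def neq_iff)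
qed

section \<open>Kernels from contour integrals over circles\<close>

text \<open>
  Fubini's theorem for a superposition of power kernels that are dominated by a single one.
  The domination makes the double integral against any kernel weight absolutely convergent.
\<close>

lemma kernel_superposition:
  fixes a w :: "real \<Rightarrow> complex" and \<rho> :: real
  assumes a: "integrable lborel a" and w [measurable]: "w \<in> borel_measurable borel"
    and \<rho>: "\<rho> \<noteq> 1/2"
    and dom: "\<And>t u. norm (power_kernel (w t) u) \<le> norm (power_kernel (of_real \<rho>) u)"
  defines "K \<equiv> \<lambda>u. LINT t|lborel. a t * power_kernel (w t) u"
  shows "borel_kernel K"
    and "kernel_weight \<phi> \<Longrightarrow>
      (LINT u|lborel. K u * \<phi> u) = (LINT t|lborel. a t * (LINT u|lborel. power_kernel (w t) u * \<phi> u))"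
proof -
  have am [measurable]: "a \<in> borel_measurable borel"
    using borel_measurable_integrable[OF a] by simp
  define A where "A = (LINT t|lborel. norm (a t))"
  have A: "(\<integral>\<^sup>+t. ennreal (norm (a t)) \<partial>lborel) = ennreal A" "0 \<le> A"
    unfolding A_def using a by (auto intro!: nn_integral_eq_integral)
  have P: "borel_kernel (power_kernel (of_real \<rho>))"
    using \<rho> by (intro borel_kernel_power_kernel) simp
  have Km: "K \<in> borel_measurable borel"
    unfolding K_def by measurable
  have bound: "norm (K u) \<le> A * norm (power_kernel (of_real \<rho>) u)" for u
  proof -
    let ?P = "norm (power_kernel (of_real \<rho>) u)"
    have le: "norm (a t * power_kernel (w t) u) \<le> norm (a t) * ?P" for t
      unfolding norm_mult by (intro mult_left_mono dom) simp
    have int: "integrable lborel (\<lambda>t. norm (a t) * ?P)"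
      using a by (intro integrable_mult_left integrable_norm)
    have int': "integrable lborel (\<lambda>t. a t * power_kernel (w t) u)"
      by (rule Bochner_Integration.integrable_bound[OF int]) (use le in \<open>simp_all add: norm_mult\<close>)
    have "norm (K u) \<le> (LINT t|lborel. norm (a t) * ?P)"
      unfolding K_def by (rule Bochner_Integration.integral_norm_bound_integral[OF int' int le])
    then show ?thesis by (simp add: A_def)
  qed
  show "borel_kernel K"
    unfolding borel_kernel_def
  proof
    show "integrable lborel (\<lambda>u. K u * of_real (\<bar>u\<bar> powr (-1/2)))"
    proof (rule Bochner_Integration.integrable_bound)
      show "integrable lborel (\<lambda>u. of_real A * (power_kernel (of_real \<rho>) u * of_real (\<bar>u\<bar> powr (-1/2))))"
        using P by (intro integrable_mult_right) (simp add: borel_kernel_def)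
      show "(\<lambda>u. K u * of_real (\<bar>u\<bar> powr (-1/2))) \<in> borel_measurable lborel"
        using Km by simp
      have "norm (K u) * \<bar>u\<bar> powr (-1/2) \<le> A * norm (power_kernel (of_real \<rho>) u) * \<bar>u\<bar> powr (-1/2)" for u
        using bound[of u] by (rule mult_right_mono) simp
      then show "AE u in lborel. norm (K u * of_real (\<bar>u\<bar> powr (-1/2)))
          \<le> norm (of_real A * (power_kernel (of_real \<rho>) u * of_real (\<bar>u\<bar> powr (-1/2))))"
        using A(2) by (intro AE_I2) (simp add: norm_mult mult.assoc)
    qed
  qed (rule Km)
  assume \<phi>: "kernel_weight \<phi>"
  note [measurable] = kernel_weight_measurable[OF \<phi>]
  let ?p = "\<lambda>u. norm (power_kernel (of_real \<rho>) u * \<phi> u)"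
  have "(\<integral>\<^sup>+u. \<integral>\<^sup>+t. norm (a t * power_kernel (w t) u * \<phi> u) \<partial>lborel \<partial>lborel) \<le>
      (\<integral>\<^sup>+u. \<integral>\<^sup>+t. ennreal (?p u) * ennreal (norm (a t)) \<partial>lborel \<partial>lborel)"
  proof (intro nn_integral_mono)
    fix u t
    have "norm (a t * power_kernel (w t) u * \<phi> u) \<le> norm (a t) * norm (power_kernel (of_real \<rho>) u) * norm (\<phi> u)"
      unfolding norm_mult by (intro mult_right_mono mult_left_mono dom) auto
    also have "\<dots> = ?p u * norm (a t)" by (simp add: norm_mult)
    finally show "ennreal (norm (a t * power_kernel (w t) u * \<phi> u)) \<le> ennreal (?p u) * ennreal (norm (a t))"
      by (simp add: ennreal_mult[symmetric] ennreal_leI)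
  qed
  also have "\<dots> = (\<integral>\<^sup>+u. ennreal (?p u) * ennreal A \<partial>lborel)"
    by (subst nn_integral_cmult) (simp_all add: A)
  also have "\<dots> = (\<integral>\<^sup>+u. ennreal (?p u) \<partial>lborel) * ennreal A"
    by (rule nn_integral_multc) simp
  also have "\<dots> < \<infinity>"
    using integrable_kernel_weight[OF P \<phi>] by (simp add: integrable_iff_bounded ennreal_mult_less_top)
  finally have fin: "(\<integral>\<^sup>+u. \<integral>\<^sup>+t. norm (a t * power_kernel (w t) u * \<phi> u) \<partial>lborel \<partial>lborel) < \<infinity>" .
  have "(LINT u|lborel. K u * \<phi> u) = (LINT u|lborel. LINT t|lborel. a t * power_kernel (w t) u * \<phi> u)"
    by (simp only: K_def integral_mult_left_zero)
  also have "\<dots> = (LINT t|lborel. LINT u|lborel. a t * power_kernel (w t) u * \<phi> u)"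
    by (rule lborel_Fubini(1)[OF _ fin]) measurable
  also have "\<dots> = (LINT t|lborel. a t * (LINT u|lborel. power_kernel (w t) u * \<phi> u))"
    by (simp only: mult.assoc integral_mult_right_zero)
  finally show "(LINT u|lborel. K u * \<phi> u) = (LINT t|lborel. a t * (LINT u|lborel. power_kernel (w t) u * \<phi> u))" .
qed

lemma sphere_avoids_zero: "r \<noteq> 1 \<Longrightarrow> z \<in> sphere (1 :: complex) r \<Longrightarrow> z \<noteq> 0"
  by auto

text \<open>
  A circle of radius other than \<open>1\<close> is compact and misses the critical circle, so the extremal
  value of \<open>Re (1/z)\<close> on it is attained and differs from \<open>1/2\<close>.
\<close>

lemma power_kernel_dominated_on_circle:
  assumes r: "0 < r" "r \<noteq> 1"
  obtains \<rho> :: real where "\<rho> \<noteq> 1/2"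
    "\<And>z u. z \<in> sphere 1 r \<Longrightarrow> norm (power_kernel (1 / z) u) \<le> norm (power_kernel (of_real \<rho>) u)"
proof -
  have c: "continuous_on (sphere (1 :: complex) r) (\<lambda>z. Re (1 / z))"
    using sphere_avoids_zero[OF r(2)] by (intro continuous_intros) auto
  have ne: "sphere (1 :: complex) r \<noteq> {}" "compact (sphere (1 :: complex) r)"
    using r by auto
  have norm: "norm (z - 1) = r" if "z \<in> sphere 1 r" for z :: complex
    using that by (simp add: dist_norm norm_minus_commute)
  show ?thesis
  proof (cases "r > 1")
    case True
    obtain z0 where z0: "z0 \<in> sphere 1 r" "\<And>z. z \<in> sphere 1 r \<Longrightarrow> Re (1 / z) \<le> Re (1 / z0)"
      using continuous_attains_sup[OF ne(2,1) c] by blast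
    have \<rho>: "Re (1 / z0) < 1/2"
      using Re_inverse_half_iff(2)[OF sphere_avoids_zero[OF r(2) z0(1)]] norm[OF z0(1)] True by simp
    show ?thesis
    proof (rule that[of "Re (1 / z0)"])
      show "Re (1 / z0) \<noteq> 1/2" using \<rho> by simp
      fix z :: complex and u assume z: "z \<in> sphere 1 r"
      have le: "Re (1 / z) \<le> Re (1 / z0)" by (rule z0(2)[OF z])
      with \<rho> have lt: "Re (1 / z) < 1/2" by linarith
      have "u powr (- Re (1 / z)) \<le> u powr (- Re (1 / z0))" if "0 < u" "u < 1"
        using that le by (intro powr_mono') auto
      then show "norm (power_kernel (1 / z) u) \<le> norm (power_kernel (of_real (Re (1 / z0))) u)"
        unfolding norm_power_kernel Re_complex_of_real using \<rho> lt by (simp only: if_True) auto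
    qed
  next
    case False
    with r have r1: "r < 1" by simp
    obtain z0 where z0: "z0 \<in> sphere 1 r" "\<And>z. z \<in> sphere 1 r \<Longrightarrow> Re (1 / z0) \<le> Re (1 / z)"
      using continuous_attains_inf[OF ne(2,1) c] by blast
    have \<rho>: "Re (1 / z0) > 1/2"
      using Re_inverse_half_iff(1)[OF sphere_avoids_zero[OF r(2) z0(1)]] norm[OF z0(1)] r1 by simp
    show ?thesis
    proof (rule that[of "Re (1 / z0)"])
      show "Re (1 / z0) \<noteq> 1/2" using \<rho> by simp
      fix z :: complex and u assume z: "z \<in> sphere 1 r"
      have le: "Re (1 / z0) \<le> Re (1 / z)" by (rule z0(2)[OF z])
      with \<rho> have lt: "\<not> Re (1 / z) < 1/2" "\<not> Re (1 / z0) < 1/2" by linarith+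
      have "u powr (- Re (1 / z)) \<le> u powr (- Re (1 / z0))" if "1 < u"
        using that le by (intro powr_mono) auto
      then show "norm (power_kernel (1 / z) u) \<le> norm (power_kernel (of_real (Re (1 / z0))) u)"
        unfolding norm_power_kernel Re_complex_of_real using lt by (simp only: if_False) auto
    qed
  qed
qed

lemma circlepath_in_sphere: "0 \<le> r \<Longrightarrow> circlepath 1 r t \<in> sphere 1 r"
  by (simp add: circlepath dist_norm norm_mult)

definition circle_speed :: "real \<Rightarrow> real \<Rightarrow> complex" where
  "circle_speed r t = 2 * of_real pi * \<i> * of_real r * exp (2 * of_real pi * \<i> * of_real t)"

lemma continuous_circle [continuous_intros]:
  "continuous_on S (circlepath 1 r)" "continuous_on S (circle_speed r)"
  unfolding circlepath circle_speed_def[abs_def] by (intro continuous_intros)+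

lemma circle_integral:
  assumes r: "0 \<le> r" and h: "continuous_on (sphere 1 r) h"
  shows "integrable lborel (\<lambda>t. indicator {0..1} t * circle_speed r t * h (circlepath 1 r t))"
    and "contour_integral (circlepath 1 r) h =
      (LINT t|lborel. indicator {0..1} t * circle_speed r t * h (circlepath 1 r t))"
proof -
  let ?f = "\<lambda>t. circle_speed r t * h (circlepath 1 r t)"
  have c: "continuous_on {0..1} ?f"
    by (intro continuous_intros continuous_on_compose2[OF h])
       (use circlepath_in_sphere[OF r] in auto)
  have eq: "indicator {0..1} t * circle_speed r t * h (circlepath 1 r t) = indicator {0..1} t *\<^sub>R ?f t" for t
    by (simp add: indicator_def)
  have int: "set_integrable lborel {0..1} ?f"
    unfolding set_integrable_def by (rule borel_integrable_compact[OF compact_Icc c])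
  then show "integrable lborel (\<lambda>t. indicator {0..1} t * circle_speed r t * h (circlepath 1 r t))"
    unfolding eq by (simp add: set_integrable_def)
  have "contour_integral (circlepath 1 r) h = integral {0..1} ?f"
    unfolding contour_integral_integral vector_derivative_circlepath
    by (simp add: circle_speed_def mult_ac)
  also have "\<dots> = (LINT t|lborel. indicator {0..1} t *\<^sub>R ?f t)"
    using set_borel_integral_eq_integral(2)[OF int] by (simp add: set_lebesgue_integral_def)
  finally show "contour_integral (circlepath 1 r) h =
      (LINT t|lborel. indicator {0..1} t * circle_speed r t * h (circlepath 1 r t))"
    unfolding eq .
qed

text \<open>
  The contour integral of \<open>F z / z\<^sup>2 * power_kernel (1 / z) u\<close> over the circle, as a Lebesgue integral.
\<close>

definition circle_kernel :: "(complex \<Rightarrow> complex) \<Rightarrow> real \<Rightarrow> real \<Rightarrow> complex" where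
  "circle_kernel F r u = (LINT t|lborel.
     indicator {0..1} t * circle_speed r t * (F (circlepath 1 r t) / (circlepath 1 r t)\<^sup>2) *
       power_kernel (1 / circlepath 1 r t) u)"

lemma circle_kernel:
  assumes r: "0 < r" "r \<noteq> 1" and F: "continuous_on (sphere 1 r) F"
  shows "borel_kernel (circle_kernel F r)"
    and "\<lbrakk>kernel_weight \<phi>; continuous_on (sphere 1 r) (\<lambda>z. F z / z\<^sup>2 * (LINT u|lborel. power_kernel (1 / z) u * \<phi> u))\<rbrakk> \<Longrightarrow>
      (LINT u|lborel. circle_kernel F r u * \<phi> u) =
      contour_integral (circlepath 1 r) (\<lambda>z. F z / z\<^sup>2 * (LINT u|lborel. power_kernel (1 / z) u * \<phi> u))"
proof -
  have r0: "0 \<le> r" using r by simp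
  obtain \<rho> :: real where \<rho>: "\<rho> \<noteq> 1/2"
    "\<And>z u. z \<in> sphere 1 r \<Longrightarrow> norm (power_kernel (1 / z) u) \<le> norm (power_kernel (of_real \<rho>) u)"
    using power_kernel_dominated_on_circle[OF r] by blast
  let ?a = "\<lambda>t. indicator {0..1} t * circle_speed r t * (F (circlepath 1 r t) / (circlepath 1 r t)\<^sup>2)"
  let ?w = "\<lambda>t. 1 / circlepath 1 r t"
  have "continuous_on (sphere 1 r) (\<lambda>z. F z / z\<^sup>2)"
    using sphere_avoids_zero[OF r(2)] by (intro continuous_intros F) auto
  from circle_integral(1)[OF r0 this] have a: "integrable lborel ?a" .
  have "continuous_on UNIV ?w"
    using circlepath_in_sphere[OF r0] sphere_avoids_zero[OF r(2)] by (intro continuous_intros) blast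
  then have w: "?w \<in> borel_measurable borel" by (rule borel_measurable_continuous_onI)
  have dom: "norm (power_kernel (?w t) u) \<le> norm (power_kernel (of_real \<rho>) u)" for t u
    by (rule \<rho>(2)[OF circlepath_in_sphere[OF r0]])
  show "borel_kernel (circle_kernel F r)"
    using kernel_superposition(1)[OF a w \<rho>(1) dom] by (simp only: circle_kernel_def[abs_def])
  assume \<phi>: "kernel_weight \<phi>"
    and c: "continuous_on (sphere 1 r) (\<lambda>z. F z / z\<^sup>2 * (LINT u|lborel. power_kernel (1 / z) u * \<phi> u))"
  have "(LINT u|lborel. circle_kernel F r u * \<phi> u) =
      (LINT t|lborel. ?a t * (LINT u|lborel. power_kernel (?w t) u * \<phi> u))"
    unfolding circle_kernel_def by (rule kernel_superposition(2)[OF a w \<rho>(1) dom \<phi>])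
  also have "\<dots> = contour_integral (circlepath 1 r) (\<lambda>z. F z / z\<^sup>2 * (LINT u|lborel. power_kernel (1 / z) u * \<phi> u))"
    unfolding circle_integral(2)[OF r0 c] by (simp only: mult.assoc)
  finally show "(LINT u|lborel. circle_kernel F r u * \<phi> u) =
      contour_integral (circlepath 1 r) (\<lambda>z. F z / z\<^sup>2 * (LINT u|lborel. power_kernel (1 / z) u * \<phi> u))" .
qed

lemma circle_kernel_neg: "u \<le> 0 \<Longrightarrow> circle_kernel F r u = 0"
  by (simp add: circle_kernel_def power_kernel_neg)

lemma borel_kernel_cmult:
  assumes "borel_kernel K"
  shows "borel_kernel (\<lambda>u. c * K u)"
proof -
  have "integrable lborel (\<lambda>u. c * (K u * of_real (\<bar>u\<bar> powr (-1/2))))"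
    using assms unfolding borel_kernel_def by (intro integrable_mult_right) auto
  then show ?thesis
    using assms unfolding borel_kernel_def by (auto simp: mult.assoc intro: borel_measurable_times)
qed

section \<open>The functional calculus of the Cesaro operator\<close>

text \<open>
  The positively oriented boundary of the annulus of width \<open>2 \<epsilon>\<close> around the critical circle.
\<close>

definition annulus_boundary :: "real \<Rightarrow> (real \<Rightarrow> complex) list" where
  "annulus_boundary \<epsilon> = [circlepath 1 (1 + \<epsilon>), reversepath (circlepath 1 (1 - \<epsilon>))]"

lemma exists_annulus:
  assumes "open U" "sphere 1 1 \<subseteq> U"
  obtains \<epsilon> :: real where "0 < \<epsilon>" "\<epsilon> < 1" "\<And>z :: complex. \<bar>norm (z - 1) - 1\<bar> \<le> \<epsilon> \<Longrightarrow> z \<in> U"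
proof -
  have "sphere (1 :: complex) 1 \<noteq> {}" by simp
  then obtain e where e: "e > 0" "{z. infdist z (sphere 1 1) \<le> e} \<subseteq> U"
    using compact_in_open_separated[OF _ compact_sphere assms] by blast
  define \<epsilon> where "\<epsilon> = min e (1/2)"
  have \<epsilon>: "0 < \<epsilon>" "\<epsilon> < 1" "\<epsilon> \<le> e" using e by (auto simp: \<epsilon>_def)
  have "z \<in> U" if z: "\<bar>norm (z - 1) - 1\<bar> \<le> \<epsilon>" for z :: complex
  proof -
    have n: "norm (z - 1) > 0" using z \<epsilon> by auto
    \<comment> \<open>the radial projection to the circle\<close>
    define p where "p = 1 + (z - 1) / of_real (norm (z - 1))"
    have p: "p \<in> sphere 1 1" using n by (simp add: p_def dist_norm norm_divide)
    have "z - p = (z - 1) * of_real (1 - 1 / norm (z - 1))"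
      by (simp add: p_def algebra_simps)
    then have "dist z p = norm (z - 1) * \<bar>1 - 1 / norm (z - 1)\<bar>"
      by (simp only: dist_norm norm_mult norm_of_real)
    also have "\<dots> = \<bar>norm (z - 1) * (1 - 1 / norm (z - 1))\<bar>"
      using n by (simp only: abs_mult abs_norm_cancel)
    also have "\<dots> = \<bar>norm (z - 1) - 1\<bar>"
      using n by (simp add: right_diff_distrib)
    finally have "infdist z (sphere 1 1) \<le> e"
      using infdist_le2[OF p] z \<epsilon> by auto
    then show ?thesis using e by blast
  qed
  with \<epsilon> that show ?thesis by blast
qed

lemma annulus_boundary_contour_integral:
  "(\<Sum>\<gamma>\<leftarrow>annulus_boundary \<epsilon>. contour_integral \<gamma> h) =
     contour_integral (circlepath 1 (1 + \<epsilon>)) h - contour_integral (circlepath 1 (1 - \<epsilon>)) h"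
  by (simp add: annulus_boundary_def contour_integral_reversepath)

lemma winding_number_annulus_boundary:
  assumes \<epsilon>: "0 < \<epsilon>" "\<epsilon> < 1" and z: "norm (z - 1) \<noteq> 1 + \<epsilon>" "norm (z - 1) \<noteq> 1 - \<epsilon>"
  shows "(\<Sum>\<gamma>\<leftarrow>annulus_boundary \<epsilon>. winding_number \<gamma> z) = (if \<bar>norm (z - 1) - 1\<bar> < \<epsilon> then 1 else 0)"
proof -
  have circ: "winding_number (circlepath 1 r) z = (if norm (z - 1) < r then 1 else 0)"
    if "0 < r" "norm (z - 1) \<noteq> r" for r
  proof (cases "norm (z - 1) < r")
    case True
    then show ?thesis by (simp add: winding_number_circlepath)
  next
    case False
    then have "winding_number (circlepath 1 r) z = 0"
      using that by (intro winding_number_zero_outside[of _ "cball 1 r"])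
        (auto simp: dist_norm norm_minus_commute)
    with False show ?thesis by simp
  qed
  have "z \<notin> path_image (circlepath 1 (1 - \<epsilon>))"
    using z \<epsilon> by (auto simp: dist_norm norm_minus_commute)
  then have "winding_number (reversepath (circlepath 1 (1 - \<epsilon>))) z = - winding_number (circlepath 1 (1 - \<epsilon>)) z"
    by (intro winding_number_reversepath) (auto simp: valid_path_imp_path)
  then show ?thesis
    using \<epsilon> z by (auto simp: annulus_boundary_def circ abs_less_iff)
qed

lemma surrounds_annulus_boundary:
  assumes \<epsilon>: "0 < \<epsilon>" "\<epsilon> < 1" and U: "\<And>z :: complex. \<bar>norm (z - 1) - 1\<bar> \<le> \<epsilon> \<Longrightarrow> z \<in> U"
    and \<sigma>: "\<sigma> \<subseteq> sphere 1 1"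
  shows "surrounds (annulus_boundary \<epsilon>) \<sigma> U"
  unfolding surrounds_def
proof (intro conjI ballI allI impI)
  have norm: "norm (z - 1) = r" if "z \<in> sphere 1 r" for z :: complex and r
    using that by (simp add: dist_norm norm_minus_commute)
  have sub: "sphere 1 (1 + \<epsilon>) \<subseteq> U - \<sigma>" "sphere 1 (1 - \<epsilon>) \<subseteq> U - \<sigma>"
    using U \<sigma> norm \<epsilon> by fastforce+
  fix \<gamma> assume "\<gamma> \<in> set (annulus_boundary \<epsilon>)"
  then show "valid_path \<gamma>" "pathfinish \<gamma> = pathstart \<gamma>" "path_image \<gamma> \<subseteq> U - \<sigma>"
    using sub \<epsilon> by (auto simp: annulus_boundary_def)
next
  fix z assume "z \<in> \<sigma>"
  then have "norm (z - 1) = 1" using \<sigma> by (auto simp: dist_norm norm_minus_commute)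
  then show "(\<Sum>\<gamma>\<leftarrow>annulus_boundary \<epsilon>. winding_number \<gamma> z) = 1"
    using winding_number_annulus_boundary[OF \<epsilon>, of z] \<epsilon> by simp
next
  fix z assume "z \<notin> U"
  then have "\<not> \<bar>norm (z - 1) - 1\<bar> \<le> \<epsilon>" using U by blast
  moreover from this \<epsilon> have "norm (z - 1) \<noteq> 1 + \<epsilon>" "norm (z - 1) \<noteq> 1 - \<epsilon>" by auto
  ultimately show "(\<Sum>\<gamma>\<leftarrow>annulus_boundary \<epsilon>. winding_number \<gamma> z) = 0"
    using winding_number_annulus_boundary[OF \<epsilon>, of z] by simp
qed

text \<open>
  On the annulus boundary the resolvent is \<open>1/z + H / z\<^sup>2\<close> with \<open>H\<close> the Hausdorff operator of
  \<open>power_kernel (1 / z)\<close>.  The first term produces \<open>F 0\<close> by Cauchy's formula; the second is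
  \<open>hausdorff K\<close> for the superposition \<open>K\<close> of these kernels.  The Mellin transform
  of \<open>K\<close> is found from \<open>1 / (z\<^sup>2 (z0 - 1/z)) = 1 / (z - w) - 1 / z\<close> with \<open>w = 1 / z0\<close>, again by
  Cauchy's formula, at the points \<open>w\<close> and \<open>0\<close> of the circle.
\<close>

theorem cesaro_calculus_kernel:
  assumes U: "open U" "sphere 1 1 \<subseteq> U" and F: "F holomorphic_on U"
  shows "\<exists>K. borel_kernel K \<and> (\<forall>u\<le>0. K u = 0) \<and>
    (\<forall>z. Re z = 1/2 \<longrightarrow> borel_mellin K z = F (inverse z) - F 0) \<and>
    holomorphic_calculus U F cesaro = scalar_op (F 0) + hausdorff K"
proof -
  obtain \<epsilon> where \<epsilon>: "0 < \<epsilon>" "\<epsilon> < 1" "\<And>z. \<bar>norm (z - 1) - 1\<bar> \<le> \<epsilon> \<Longrightarrow> z \<in> U"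
    using exists_annulus[OF U] by blast
  let ?\<Gamma> = "annulus_boundary \<epsilon>" and ?V = "U - sphere 1 1"
  have surr: "surrounds ?\<Gamma> \<sigma> U" if "\<sigma> \<subseteq> sphere 1 1" for \<sigma>
    using surrounds_annulus_boundary[OF \<epsilon> that] .
  have cyc: "cycle_in ?V ?\<Gamma>"
    by (rule surrounds_imp_cycle_in[OF surr]) simp
  have cauchy: "(\<Sum>\<gamma>\<leftarrow>?\<Gamma>. contour_integral \<gamma> (\<lambda>z. F z / (z - w))) = 2 * of_real pi * \<i> * F w"
    if w: "w \<in> sphere 1 1" for w
  proof -
    have "cycle_in (U - {w}) ?\<Gamma>" using cyc w by (auto intro: cycle_in_mono)
    then show ?thesis
      using Cauchy_integral_formula_cycle[OF U(1) F, of w ?\<Gamma>] surr[of "{w}"] U(2) w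
      by (auto simp: surrounds_def)
  qed
  define K where "K u = (circle_kernel F (1 + \<epsilon>) u - circle_kernel F (1 - \<epsilon>) u) / (2 * of_real pi * \<i>)" for u
  have radii: "0 < 1 + \<epsilon>" "1 + \<epsilon> \<noteq> 1" "0 < 1 - \<epsilon>" "1 - \<epsilon> \<noteq> 1" using \<epsilon> by auto
  have spheres: "sphere 1 (1 + \<epsilon>) \<subseteq> ?V" "sphere 1 (1 - \<epsilon>) \<subseteq> ?V"
    using cyc \<epsilon> by (auto simp: cycle_in_def annulus_boundary_def)
  have Fc: "continuous_on (sphere 1 (1 + \<epsilon>)) F" "continuous_on (sphere 1 (1 - \<epsilon>)) F"
    using spheres by (auto intro!: holomorphic_on_imp_continuous_on holomorphic_on_subset[OF F])
  have K: "borel_kernel K"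
  proof -
    have "borel_kernel (\<lambda>u. circle_kernel F (1 + \<epsilon>) u - circle_kernel F (1 - \<epsilon>) u)"
      by (intro borel_kernel_diff circle_kernel(1) radii Fc)
    then show ?thesis
      using borel_kernel_cmult[of _ "1 / (2 * of_real pi * \<i>)"] by (simp add: K_def[abs_def])
  qed
  have K_integral: "(LINT u|lborel. K u * \<phi> u) =
      1 / (2 * of_real pi * \<i>) * (\<Sum>\<gamma>\<leftarrow>?\<Gamma>. contour_integral \<gamma> (\<lambda>z. F z / z\<^sup>2 * (LINT u|lborel. power_kernel (1 / z) u * \<phi> u)))"
    if \<phi>: "kernel_weight \<phi>" and c: "continuous_on ?V (\<lambda>z. F z / z\<^sup>2 * (LINT u|lborel. power_kernel (1 / z) u * \<phi> u))" for \<phi>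
  proof -
    have "(LINT u|lborel. K u * \<phi> u) =
        (LINT u|lborel. (circle_kernel F (1 + \<epsilon>) u * \<phi> u - circle_kernel F (1 - \<epsilon>) u * \<phi> u) / (2 * of_real pi * \<i>))"
      by (simp add: K_def left_diff_distrib)
    also have "\<dots> = ((LINT u|lborel. circle_kernel F (1 + \<epsilon>) u * \<phi> u) -
        (LINT u|lborel. circle_kernel F (1 - \<epsilon>) u * \<phi> u)) / (2 * of_real pi * \<i>)"
      using integrable_kernel_weight[OF circle_kernel(1)[OF radii(1,2) Fc(1)] \<phi>]
        integrable_kernel_weight[OF circle_kernel(1)[OF radii(3,4) Fc(2)] \<phi>] by simp
    also have "\<dots> = 1 / (2 * of_real pi * \<i>) *
        (\<Sum>\<gamma>\<leftarrow>?\<Gamma>. contour_integral \<gamma> (\<lambda>z. F z / z\<^sup>2 * (LINT u|lborel. power_kernel (1 / z) u * \<phi> u)))"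
      unfolding annulus_boundary_contour_integral
        circle_kernel(2)[OF radii(1,2) Fc(1) \<phi> continuous_on_subset[OF c spheres(1)]]
        circle_kernel(2)[OF radii(3,4) Fc(2) \<phi> continuous_on_subset[OF c spheres(2)]] by simp
    finally show ?thesis .
  qed
  have opV: "open ?V" using U by (intro open_Diff) auto
  have V: "z \<noteq> 0" "norm (z - 1) \<noteq> 1" "Re (1 / z) \<noteq> 1/2" if "z \<in> ?V" for z
  proof -
    show z: "z \<noteq> 0" and n: "norm (z - 1) \<noteq> 1"
      using that by (auto simp: dist_norm norm_minus_commute)
    show "Re (1 / z) \<noteq> 1/2" using Re_inverse_half_iff[OF z] n by linarith
  qed
  have FV: "F holomorphic_on ?V" by (rule holomorphic_on_subset[OF F]) auto
  have \<Gamma>V: "valid_path \<gamma>" "path_image \<gamma> \<subseteq> ?V" if "\<gamma> \<in> set ?\<Gamma>" for \<gamma>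
    using cyc that by (auto simp: cycle_in_def)
  have int: "h contour_integrable_on \<gamma>" if "h holomorphic_on ?V" "\<gamma> \<in> set ?\<Gamma>" for h \<gamma>
    using contour_integrable_holomorphic_simple[OF that(1) opV \<Gamma>V[OF that(2)]] .
  have sum_add: "(\<Sum>\<gamma>\<leftarrow>?\<Gamma>. contour_integral \<gamma> (\<lambda>z. h1 z + h2 z)) =
      (\<Sum>\<gamma>\<leftarrow>?\<Gamma>. contour_integral \<gamma> h1) + (\<Sum>\<gamma>\<leftarrow>?\<Gamma>. contour_integral \<gamma> h2)"
    if "h1 holomorphic_on ?V" "h2 holomorphic_on ?V" for h1 h2
    unfolding sum_list_addf[symmetric]
    using int[OF that(1)] int[OF that(2)] by (intro arg_cong[of _ _ sum_list] map_cong refl contour_integral_add)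
  have sum_cong: "(\<Sum>\<gamma>\<leftarrow>?\<Gamma>. contour_integral \<gamma> h1) = (\<Sum>\<gamma>\<leftarrow>?\<Gamma>. contour_integral \<gamma> h2)"
    if "\<And>z. z \<in> ?V \<Longrightarrow> h1 z = h2 z" for h1 h2
    using that \<Gamma>V by (intro arg_cong[of _ _ sum_list] map_cong refl contour_integral_eq) blast
  have hol_frac: "(\<lambda>z. F z / (z - w)) holomorphic_on ?V" if "w \<in> sphere 1 1" for w
    using that by (intro holomorphic_intros FV) auto
  have "borel_mellin K z0 = F (inverse z0) - F 0" if z0: "Re z0 = 1/2" for z0
  proof -
    let ?\<phi> = "\<lambda>u. if u > 0 then cpow u (z0 - 1) else 0"
    define w where "w = inverse z0"
    have z0': "z0 \<noteq> 0" using z0 by auto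
    then have w0: "w \<noteq> 0" and zw: "z0 = 1 / w" by (auto simp: w_def field_simps)
    have "norm (w - 1) = 1"
      using Re_inverse_half_iff[OF w0] z0 zw by force
    then have w: "w \<in> sphere 1 1" by (simp add: dist_norm norm_minus_commute)
    have val: "F z / z\<^sup>2 * (LINT u|lborel. power_kernel (1 / z) u * ?\<phi> u) = F z / (z - w) + (- 1) * (F z / (z - 0))"
      if z: "z \<in> ?V" for z
    proof -
      have "(LINT u|lborel. power_kernel (1 / z) u * ?\<phi> u) = (LINT u|lborel. power_kernel (1 / z) u * cpow u (z0 - 1))"
        by (intro Bochner_Integration.integral_cong) (auto simp: power_kernel_neg)
      also have "\<dots> = 1 / (z0 - 1 / z)"
        by (rule mellin_power_kernel[OF V(3)[OF z] z0])
      finally have i: "(LINT u|lborel. power_kernel (1 / z) u * ?\<phi> u) = 1 / (z0 - 1 / z)" .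
      have "z \<noteq> w" using w z by auto
      then have "1 / (z0 - 1 / z) = z * w / (z - w)"
        using w0 V(1)[OF z] by (simp add: zw field_simps)
      then have "F z / z\<^sup>2 * (LINT u|lborel. power_kernel (1 / z) u * ?\<phi> u) = F z / z\<^sup>2 * (z * w / (z - w))"
        by (simp only: i)
      also have "\<dots> = F z / (z - w) + (- 1) * (F z / (z - 0))"
        using \<open>z \<noteq> w\<close> V(1)[OF z] by (simp add: field_simps power2_eq_square)
      finally show ?thesis .
    qed
    have hol: "(\<lambda>z. F z / (z - w) + (- 1) * (F z / (z - 0))) holomorphic_on ?V"
      using hol_frac[OF w] hol_frac[of 0] by (intro holomorphic_on_add holomorphic_on_mult) auto
    have cont: "continuous_on ?V (\<lambda>z. F z / z\<^sup>2 * (LINT u|lborel. power_kernel (1 / z) u * ?\<phi> u))"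
      using holomorphic_on_imp_continuous_on[OF hol] by (subst continuous_on_cong[OF refl val]) auto
    have "borel_mellin K z0 = 1 / (2 * of_real pi * \<i>) *
        (\<Sum>\<gamma>\<leftarrow>?\<Gamma>. contour_integral \<gamma> (\<lambda>z. F z / (z - w) + (- 1) * (F z / (z - 0))))"
      unfolding borel_mellin_def K_integral[OF kernel_weight_cpow[OF z0] cont]
      by (subst sum_cong[OF val]) auto
    also have "(\<Sum>\<gamma>\<leftarrow>?\<Gamma>. contour_integral \<gamma> (\<lambda>z. F z / (z - w) + (- 1) * (F z / (z - 0)))) =
        (\<Sum>\<gamma>\<leftarrow>?\<Gamma>. contour_integral \<gamma> (\<lambda>z. F z / (z - w))) + (\<Sum>\<gamma>\<leftarrow>?\<Gamma>. contour_integral \<gamma> (\<lambda>z. (- 1) * (F z / (z - 0))))"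
      using hol_frac[OF w] hol_frac[of 0] by (intro sum_add holomorphic_on_mult) auto
    also have "(\<Sum>\<gamma>\<leftarrow>?\<Gamma>. contour_integral \<gamma> (\<lambda>z. (- 1) * (F z / (z - 0)))) =
        (- 1) * (\<Sum>\<gamma>\<leftarrow>?\<Gamma>. contour_integral \<gamma> (\<lambda>z. F z / (z - 0)))"
      unfolding sum_list_const_mult[symmetric]
      using int[OF hol_frac[of 0]] by (intro arg_cong[of _ _ sum_list] map_cong refl contour_integral_lmul) auto
    also have "(\<Sum>\<gamma>\<leftarrow>?\<Gamma>. contour_integral \<gamma> (\<lambda>z. F z / (z - w))) + \<dots> = 2 * of_real pi * \<i> * (F w - F 0)"
      using cauchy[OF w] cauchy[of 0] by (simp add: algebra_simps)
    finally show ?thesis by (simp add: w_def)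
  qed
  moreover have "holomorphic_calculus U F cesaro = scalar_op (F 0) + hausdorff K"
  proof -
    note T = complex_linear_cesaro
    have s: "surrounds ?\<Gamma> (op_spectrum cesaro) U" by (rule surr[OF op_spectrum_cesaro])
    have "dunford_integral ?\<Gamma> F cesaro = scalar_op (F 0) + hausdorff K"
    proof (rule op_eqI)
      fix f g
      obtain f' where f: "sq_integrable f'" "f = abs_L2 f'" by (rule L2_cases)
      obtain g' where g: "sq_integrable g'" "g = abs_L2 g'" by (rule L2_cases)
      let ?\<phi> = "dilation_coeff f' g'"
      let ?h2 = "\<lambda>z. F z / z\<^sup>2 * (LINT u|lborel. power_kernel (1 / z) u * ?\<phi> u)"
      let ?h1 = "\<lambda>z. cinner f g * (F z / (z - 0))"
      have \<phi>: "kernel_weight ?\<phi>" by (rule kernel_weight_dilation_coeff[OF f(1) g(1)])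
      have val: "F z * cinner (resolvent cesaro z f) g = ?h1 z + ?h2 z" if z: "z \<in> ?V" for z
        unfolding resolvent_cesaro[OF V(1,2)[OF z]]
        using cinner_hausdorff[OF borel_kernel_power_kernel[OF V(3)[OF z]] f(1) g(1)]
        by (simp add: blinfun.add_left cinner_simps f g algebra_simps)
      have "(\<lambda>z. cinner (resolvent cesaro z f) g) holomorphic_on ?V"
        by (rule holomorphic_on_subset[OF holomorphic_resolvent_coefficient[OF T]]) (use op_spectrum_cesaro in auto)
      then have h: "(\<lambda>z. F z * cinner (resolvent cesaro z f) g) holomorphic_on ?V"
        by (intro holomorphic_on_mult FV)
      have h1: "?h1 holomorphic_on ?V"
        using hol_frac[of 0] by (intro holomorphic_on_mult) auto
      \<comment> \<open>holomorphy of the integral over \<open>u\<close> comes for free from that of the resolvent\<close>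
      have h2: "?h2 holomorphic_on ?V"
        using holomorphic_on_diff[OF h h1] by (rule holomorphic_transform) (simp add: val)
      have "cinner (dunford_integral ?\<Gamma> F cesaro f) g = 1 / (2 * of_real pi * \<i>) *
          (\<Sum>\<gamma>\<leftarrow>?\<Gamma>. contour_integral \<gamma> (\<lambda>z. ?h1 z + ?h2 z))"
        unfolding cinner_dunford_integral[OF T U(1) F s] by (subst sum_cong[OF val]) auto
      also have "\<dots> = 1 / (2 * of_real pi * \<i>) * (\<Sum>\<gamma>\<leftarrow>?\<Gamma>. contour_integral \<gamma> ?h1) +
          1 / (2 * of_real pi * \<i>) * (\<Sum>\<gamma>\<leftarrow>?\<Gamma>. contour_integral \<gamma> ?h2)"
        unfolding sum_add[OF h1 h2] by (rule distrib_left)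
      also have "1 / (2 * of_real pi * \<i>) * (\<Sum>\<gamma>\<leftarrow>?\<Gamma>. contour_integral \<gamma> ?h1) = F 0 * cinner f g"
      proof -
        have "(\<Sum>\<gamma>\<leftarrow>?\<Gamma>. contour_integral \<gamma> ?h1) = cinner f g * (\<Sum>\<gamma>\<leftarrow>?\<Gamma>. contour_integral \<gamma> (\<lambda>z. F z / (z - 0)))"
          unfolding sum_list_const_mult[symmetric]
          using int[OF hol_frac[of 0]] by (intro arg_cong[of _ _ sum_list] map_cong refl contour_integral_lmul) auto
        also have "(\<Sum>\<gamma>\<leftarrow>?\<Gamma>. contour_integral \<gamma> (\<lambda>z. F z / (z - 0))) = 2 * of_real pi * \<i> * F 0"
          by (rule cauchy) simp
        finally have h1_sum: "(\<Sum>\<gamma>\<leftarrow>?\<Gamma>. contour_integral \<gamma> ?h1) = cinner f g * (2 * of_real pi * \<i> * F 0)" .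
        have cancel: "1 / p * (x * (p * y)) = y * x" if "p \<noteq> 0" for p x y :: complex
          using that by simp
        show ?thesis unfolding h1_sum by (rule cancel) simp
      qed
      also have "1 / (2 * of_real pi * \<i>) * (\<Sum>\<gamma>\<leftarrow>?\<Gamma>. contour_integral \<gamma> ?h2) = cinner (hausdorff K f) g"
        using K_integral[OF \<phi> holomorphic_on_imp_continuous_on[OF h2]] cinner_hausdorff[OF K f(1) g(1)]
        by (simp only: f g)
      finally show "cinner (dunford_integral ?\<Gamma> F cesaro f) g = cinner ((scalar_op (F 0) + hausdorff K) f) g"
        by (simp add: blinfun.add_left cinner_simps)
    qed
    then show ?thesis
      using holomorphic_calculus_eq_dunford_integral[OF T U(1) F s] by simp
  qed
  moreover have "K u = 0" if "u \<le> 0" for u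
    using that by (simp add: K_def circle_kernel_neg)
  ultimately show ?thesis using K by blast
qed


section \<open>Hausdorff operators as functions of the Cesaro operator\<close>

lemma mellin_eq_borel_mellin:
  assumes K: "K \<in> borel_measurable lebesgue" and K' [measurable]: "K' \<in> borel_measurable borel"
    and eq: "AE u in lebesgue. K u = K' u"
  shows "mellin K z = borel_mellin K' z"
proof -
  let ?w = "\<lambda>u. if u > 0 then cpow u (z - 1) else 0"
  have w: "?w \<in> borel_measurable lebesgue"
    by (intro measurable_completion) measurable
  have pw: "indicator {0<..} u *\<^sub>R (K u * of_real u powr (z - 1)) = K u * ?w u" for u
    by (simp add: indicator_def cpow_conv_powr)
  have "mellin K z = (LINT u|lebesgue. K u * ?w u)"
    by (simp only: mellin_def set_lebesgue_integral_def pw)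
  also have "\<dots> = (LINT u|lebesgue. K' u * ?w u)"
  proof (rule Bochner_Integration.integral_cong_AE)
    show "(\<lambda>u. K u * ?w u) \<in> borel_measurable lebesgue"
      using K w by (rule borel_measurable_times)
    show "(\<lambda>u. K' u * ?w u) \<in> borel_measurable lebesgue"
      by (intro measurable_completion) measurable
    show "AE u in lebesgue. K u * ?w u = K' u * ?w u"
      using eq by eventually_elim simp
  qed
  also have "\<dots> = borel_mellin K' z"
    unfolding borel_mellin_def by (rule integral_completion) measurable
  finally show ?thesis .
qed

text \<open>
  The two integrands differ only at \<open>0\<close> and on the negative half-line, where \<open>K\<close> vanishes.
\<close>

lemma set_integrable_positive_kernel_iff:
  assumes "K \<in> borel_measurable lebesgue" "AE u in lebesgue. u < 0 \<longrightarrow> K u = 0"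
  shows "set_integrable lebesgue {0<..} (\<lambda>u. K u * of_real (u powr (-1/2))) \<longleftrightarrow> hausdorff_kernel K"
proof -
  let ?w = "\<lambda>u::real. complex_of_real (\<bar>u\<bar> powr (-1/2))"
  have w: "?w \<in> borel_measurable lebesgue"
    by (intro measurable_completion) measurable
  have i: "(indicator {0<..} :: real \<Rightarrow> real) \<in> borel_measurable lebesgue"
    by (intro measurable_completion) measurable
  have e: "indicator {0<..} u *\<^sub>R (K u * of_real (u powr (-1/2))) = indicator {0<..} u *\<^sub>R (K u * ?w u)" for u
    by (cases "u > 0") simp_all
  have "set_integrable lebesgue {0<..} (\<lambda>u. K u * of_real (u powr (-1/2))) \<longleftrightarrow>
      integrable lebesgue (\<lambda>u. indicator {0<..} u *\<^sub>R (K u * ?w u))"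
    by (simp only: set_integrable_def e)
  also have "\<dots> \<longleftrightarrow> integrable lebesgue (\<lambda>u. K u * ?w u)"
  proof (rule Bochner_Integration.integrable_cong_AE)
    show "(\<lambda>u. indicator {0<..} u *\<^sub>R (K u * ?w u)) \<in> borel_measurable lebesgue"
      by (intro borel_measurable_scaleR borel_measurable_times i w assms(1))
    show "(\<lambda>u. K u * ?w u) \<in> borel_measurable lebesgue"
      by (intro borel_measurable_times w assms(1))
    have "AE u in lebesgue. u \<noteq> (0::real)"
      by (intro AE_completion AE_lborel_singleton)
    with assms(2) show "AE u in lebesgue. indicator {0<..} u *\<^sub>R (K u * ?w u) = K u * ?w u"
      by eventually_elim (auto simp: indicator_def)
  qed
  finally show ?thesis
    using assms(1) by (simp add: hausdorff_kernel_def)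
qed

theorem theorem2:
  fixes U :: "complex set" and F :: "complex \<Rightarrow> complex"
  assumes "open U" and "sphere 1 1 \<subseteq> U" and "F holomorphic_on U"
  shows "(F 0 = 0 \<longrightarrow>
            (\<exists>K. hausdorff_kernel K \<and> holomorphic_calculus U F cesaro = hausdorff K \<and>
                 (\<forall>K'. hausdorff_kernel K' \<and> holomorphic_calculus U F cesaro = hausdorff K' \<longrightarrow>
                       (AE u in lebesgue. K' u = K u)) \<and>
                 (AE u in lebesgue. u < 0 \<longrightarrow> K u = 0) \<and>
                 set_integrable lebesgue {0<..} (\<lambda>u. K u * of_real (u powr (-1/2))) \<and>
                 (\<forall>z. Re z = 1/2 \<longrightarrow> mellin K z = F (inverse z)))) \<and>
         (\<forall>K. K \<in> borel_measurable lebesgue \<and>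
              (AE u in lebesgue. u < 0 \<longrightarrow> K u = 0) \<and>
              set_integrable lebesgue {0<..} (\<lambda>u. K u * of_real (u powr (-1/2))) \<and>
              (\<forall>z. Re z = 1/2 \<longrightarrow> mellin K z = F (inverse z)) \<longrightarrow>
              F 0 = 0 \<and> hausdorff K = holomorphic_calculus U F cesaro)"
proof -
  obtain K where K: "borel_kernel K" and supp: "\<And>u. u \<le> 0 \<Longrightarrow> K u = 0"
    and mel: "\<And>z. Re z = 1/2 \<Longrightarrow> borel_mellin K z = F (inverse z) - F 0"
    and calc: "holomorphic_calculus U F cesaro = scalar_op (F 0) + hausdorff K"
    using cesaro_calculus_kernel[OF assms] by blast
  have hK: "hausdorff_kernel K" by (rule borel_kernel_imp_hausdorff_kernel[OF K])
  then have mK: "K \<in> borel_measurable lebesgue" by (simp add: hausdorff_kernel_def)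
  have scalar0: "scalar_op 0 = 0"
    by (rule blinfun_eqI) simp
  show ?thesis
  proof (intro conjI impI allI)
    assume F0: "F 0 = 0"
    have eq: "holomorphic_calculus U F cesaro = hausdorff K"
      by (simp add: calc F0 scalar0)
    have uniq: "AE u in lebesgue. L u = K u" if L: "hausdorff_kernel L" "holomorphic_calculus U F cesaro = hausdorff L" for L
    proof -
      obtain L' where L': "borel_kernel L'" "AE u in lebesgue. L u = L' u"
        using hausdorff_kernel_borel[OF L(1)] .
      have "hausdorff L = hausdorff L'"
        using L(1) borel_kernel_imp_hausdorff_kernel[OF L'(1)] L'(2)
        by (intro hausdorff_cong_AE) (auto simp: hausdorff_kernel_def)
      then have "hausdorff L' = hausdorff K" using L(2) eq by simp
      from AE_completion[OF hausdorff_injective[OF L'(1) K this]] L'(2)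
      show ?thesis by eventually_elim simp
    qed
    have neg: "AE u in lebesgue. u < 0 \<longrightarrow> K u = 0"
      using supp by (intro AE_I2) simp
    have "mellin K z = F (inverse z)" if "Re z = 1/2" for z
      using mellin_eq_borel_mellin[OF mK borel_kernel_measurable[OF K], of z] mel[OF that] F0 by simp
    with hK eq uniq neg set_integrable_positive_kernel_iff[OF mK neg]
    show "\<exists>K. hausdorff_kernel K \<and> holomorphic_calculus U F cesaro = hausdorff K \<and>
                 (\<forall>K'. hausdorff_kernel K' \<and> holomorphic_calculus U F cesaro = hausdorff K' \<longrightarrow>
                       (AE u in lebesgue. K' u = K u)) \<and>
                 (AE u in lebesgue. u < 0 \<longrightarrow> K u = 0) \<and>
                 set_integrable lebesgue {0<..} (\<lambda>u. K u * of_real (u powr (-1/2))) \<and>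
                 (\<forall>z. Re z = 1/2 \<longrightarrow> mellin K z = F (inverse z))"
      by blast
  next
    fix L
    assume "L \<in> borel_measurable lebesgue \<and> (AE u in lebesgue. u < 0 \<longrightarrow> L u = 0) \<and>
        set_integrable lebesgue {0<..} (\<lambda>u. L u * of_real (u powr (-1/2))) \<and>
        (\<forall>z. Re z = 1/2 \<longrightarrow> mellin L z = F (inverse z))"
    then have mL: "L \<in> borel_measurable lebesgue" and neg: "AE u in lebesgue. u < 0 \<longrightarrow> L u = 0"
      and int: "set_integrable lebesgue {0<..} (\<lambda>u. L u * of_real (u powr (-1/2)))"
      and melL: "\<And>z. Re z = 1/2 \<Longrightarrow> mellin L z = F (inverse z)"
      by blast+
    have hL: "hausdorff_kernel L"
      using set_integrable_positive_kernel_iff[OF mL neg] int by blast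
    obtain L' where L': "borel_kernel L'" "AE u in lebesgue. L u = L' u"
      using hausdorff_kernel_borel[OF hL] .
    \<comment> \<open>the transforms of \<open>L\<close> and \<open>K\<close> are \<open>F (1/z)\<close> and \<open>F (1/z) - F 0\<close>\<close>
    have const: "borel_mellin (\<lambda>u. L' u - K u) z = F 0" if z: "Re z = 1/2" for z
    proof -
      note w = kernel_weight_cpow[OF z]
      have "borel_mellin (\<lambda>u. L' u - K u) z = borel_mellin L' z - borel_mellin K z"
        unfolding borel_mellin_def left_diff_distrib
        by (rule Bochner_Integration.integral_diff[OF integrable_kernel_weight[OF L'(1) w] integrable_kernel_weight[OF K w]])
      then show ?thesis
        using mellin_eq_borel_mellin[OF mL borel_kernel_measurable[OF L'(1)] L'(2), of z] melL[OF z] mel[OF z]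
        by simp
    qed
    have diff: "borel_kernel (\<lambda>u. L' u - K u)" by (rule borel_kernel_diff[OF L'(1) K])
    show F0: "F 0 = 0" by (rule borel_mellin_constant(1)[OF diff const])
    have J: "AE u in lborel. u > 0 \<longrightarrow> L' u - K u = 0" by (rule borel_mellin_constant(2)[OF diff const])
    have "AE u in lebesgue. u \<noteq> (0::real)"
      by (intro AE_completion AE_lborel_singleton)
    with AE_completion[OF J] L'(2) neg have "AE u in lebesgue. L u = K u"
    proof eventually_elim
      fix u :: real
      assume "0 < u \<longrightarrow> L' u - K u = 0" "L u = L' u" "u < 0 \<longrightarrow> L u = 0" "u \<noteq> 0"
      then show "L u = K u" using supp[of u] by (cases "u < 0") auto
    qed
    then have "hausdorff L = hausdorff K" by (rule hausdorff_cong_AE[OF mL mK])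
    then show "hausdorff L = holomorphic_calculus U F cesaro"
      by (simp add: calc F0 scalar0)
  qed
qed

end
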